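(* If $v$ is an odd integer with $7\leq v\leq 19$, then every (connected) symmetric configuration $v_3$ is upper embeddable in every orientation of triples.
   Context: A symmetric configuration $v_3$ is a pair $(V,\mathcal{B})$ where $V$ is a set of $v$ points and $\mathcal{B}$ is a set of $v$ three-element subsets of $V$ (blocks, or triples) such that each point lies in exactly $3$ blocks and any two distinct points lie in at most one block. Its Levi graph is the bipartite graph with vertex set $V\cup\mathcal{B}$, where a point $p$ is adjacent to a block $B$ iff $p\in B$; configurations are assumed connected, i.e. the Levi graph is connected. The associated graph $K$ has vertex set $V$ and an edge $uv$ for each pair of distinct points lying in a common block. An embedding of the configuration is a cellular embedding of $K$ in a closed orientable surface such that every block triangle bounds a face (a block face); the other faces are outer faces. It is an upper embedding if there is exactly one outer face. An orientation of triples assigns to each block a cyclic order of its three points; the configuration is upper embeddable in that orientation if it has an upper embedding in which the orientation of the surface induces the preassigned cyclic order on every block face. It is upper embeddable in every orientation if this holds for every orientation of triples. *)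

theory Defs
  imports "Graph_Theory.Graph_Theory" "HOL-Combinatorics.Orbits"
begin

section \<open>Symmetric configurations\<close>

locale symmetric_configuration =
  fixes v :: nat and V :: "'a set" and \<B> :: "'a set set"
  assumes finite_points: "finite V"
    and card_points: "card V = v"
    and finite_blocks: "finite \<B>"
    and card_blocks: "card \<B> = v"
    and block_subset: "\<And>b. b \<in> \<B> \<Longrightarrow> b \<subseteq> V"
    and block_size: "\<And>b. b \<in> \<B> \<Longrightarrow> card b = 3"
    and point_degree: "\<And>p. p \<in> V \<Longrightarrow> card {b \<in> \<B>. p \<in> b} = 3"
    and at_most_one_block: "\<And>p q. p \<in> V \<Longrightarrow> q \<in> V \<Longrightarrow> p \<noteq> q \<Longrightarrow>
          card {b \<in> \<B>. p \<in> b \<and> q \<in> b} \<le> 1"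

text \<open>
  An undirected simple graph is represented by the symmetric loop-free digraph that contains both
  arcs \<open>(x, y)\<close> and \<open>(y, x)\<close> for every edge \<open>xy\<close>.
\<close>

definition levi_graph :: "'a set \<Rightarrow> 'a set set \<Rightarrow> ('a + 'a set) pair_pre_digraph" where
  "levi_graph V \<B> =
     \<lparr> pverts = Inl ` V \<union> Inr ` \<B>,
       parcs = {(Inl p, Inr b) | p b. p \<in> V \<and> b \<in> \<B> \<and> p \<in> b}
             \<union> {(Inr b, Inl p) | p b. p \<in> V \<and> b \<in> \<B> \<and> p \<in> b} \<rparr>"

definition connected_configuration :: "'a set \<Rightarrow> 'a set set \<Rightarrow> bool" where
  "connected_configuration V \<B> \<longleftrightarrow> connected (with_proj (levi_graph V \<B>))"

definition associated_graph :: "'a set \<Rightarrow> 'a set set \<Rightarrow> 'a pair_pre_digraph" where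
  "associated_graph V \<B> =
     \<lparr> pverts = V,
       parcs = {(x, y). x \<in> V \<and> y \<in> V \<and> x \<noteq> y \<and> (\<exists>b\<in>\<B>. x \<in> b \<and> y \<in> b)} \<rparr>"

section \<open>Cellular embeddings in closed oriented surfaces\<close>

text \<open>
  A cellular embedding of a finite connected graph in a closed oriented surface is represented by
  its rotation system (Heffter, Edmonds): a map \<open>\<rho>\<close> on the arcs which, at every vertex \<open>x\<close>, permutes
  the arcs leaving \<open>x\<close> in a single cycle. This is the order in which these arcs occur around \<open>x\<close>;
  we read it clockwise with respect to the orientation of the surface. Every rotation system
  arises from a cellular embedding, which is unique up to orientation-preserving homeomorphism.
\<close>

definition cellular_embedding :: "'a pair_pre_digraph \<Rightarrow> ('a \<times> 'a \<Rightarrow> 'a \<times> 'a) \<Rightarrow> bool" where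
  "cellular_embedding G \<rho> \<longleftrightarrow>
     finite (pverts G) \<and> connected (with_proj G) \<and>
     (\<forall>x\<in>pverts G. out_arcs (with_proj G) x \<noteq> {} \<longrightarrow> cyclic_on \<rho> (out_arcs (with_proj G) x))"

text \<open>
  Face tracing: having traversed \<open>(x, y)\<close>, continue with the arc that follows the reversed arc
  \<open>(y, x)\<close> in the clockwise rotation at \<open>y\<close>. The face then always lies on the left, so its boundary
  is traversed in the direction induced by the orientation of the surface. Each face is
  represented by the set of arcs of its directed boundary walk; as an orbit of a permutation, this
  set determines the closed walk, and every arc belongs to exactly one face.
\<close>

definition face_succ :: "('a \<times> 'a \<Rightarrow> 'a \<times> 'a) \<Rightarrow> 'a \<times> 'a \<Rightarrow> 'a \<times> 'a" where
  "face_succ \<rho> e = \<rho> (prod.swap e)"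

definition faces :: "'a pair_pre_digraph \<Rightarrow> ('a \<times> 'a \<Rightarrow> 'a \<times> 'a) \<Rightarrow> ('a \<times> 'a) set set" where
  "faces G \<rho> = orbit (face_succ \<rho>) ` parcs G"

section \<open>Embeddings of configurations\<close>

text \<open>
  The face boundary \<open>f\<close> is the triangle \<open>b\<close>, traversed once in one of its two directions.
\<close>

definition bounded_by_triangle :: "('a \<times> 'a) set \<Rightarrow> 'a set \<Rightarrow> bool" where
  "bounded_by_triangle f b \<longleftrightarrow>
     (\<exists>x y z. distinct [x, y, z] \<and> b = {x, y, z} \<and> f = {(x, y), (y, z), (z, x)})"

definition configuration_embedding ::
    "'a set \<Rightarrow> 'a set set \<Rightarrow> ('a \<times> 'a \<Rightarrow> 'a \<times> 'a) \<Rightarrow> bool" where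
  "configuration_embedding V \<B> \<rho> \<longleftrightarrow>
     cellular_embedding (associated_graph V \<B>) \<rho> \<and>
     (\<forall>b\<in>\<B>. \<exists>f\<in>faces (associated_graph V \<B>) \<rho>. bounded_by_triangle f b)"

definition block_faces ::
    "'a set \<Rightarrow> 'a set set \<Rightarrow> ('a \<times> 'a \<Rightarrow> 'a \<times> 'a) \<Rightarrow> ('a \<times> 'a) set set" where
  "block_faces V \<B> \<rho> =
     {f \<in> faces (associated_graph V \<B>) \<rho>. \<exists>b\<in>\<B>. bounded_by_triangle f b}"

definition outer_faces ::
    "'a set \<Rightarrow> 'a set set \<Rightarrow> ('a \<times> 'a \<Rightarrow> 'a \<times> 'a) \<Rightarrow> ('a \<times> 'a) set set" where
  "outer_faces V \<B> \<rho> = faces (associated_graph V \<B>) \<rho> - block_faces V \<B> \<rho>"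

definition upper_embedding ::
    "'a set \<Rightarrow> 'a set set \<Rightarrow> ('a \<times> 'a \<Rightarrow> 'a \<times> 'a) \<Rightarrow> bool" where
  "upper_embedding V \<B> \<rho> \<longleftrightarrow>
     configuration_embedding V \<B> \<rho> \<and> card (outer_faces V \<B> \<rho>) = 1"

section \<open>Orientations of triples\<close>

text \<open>
  The cyclic order assigned to a block \<open>b\<close> is given by its successor function \<open>\<sigma> b\<close>, of which only
  the values on \<open>b\<close> matter.
\<close>

definition triple_orientation :: "'a set set \<Rightarrow> ('a set \<Rightarrow> 'a \<Rightarrow> 'a) \<Rightarrow> bool" where
  "triple_orientation \<B> \<sigma> \<longleftrightarrow> (\<forall>b\<in>\<B>. cyclic_on (\<sigma> b) b)"

definition induces_orientation ::
    "'a set \<Rightarrow> 'a set set \<Rightarrow> ('a \<times> 'a \<Rightarrow> 'a \<times> 'a) \<Rightarrow> ('a set \<Rightarrow> 'a \<Rightarrow> 'a) \<Rightarrow> bool" where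
  "induces_orientation V \<B> \<rho> \<sigma> \<longleftrightarrow>
     (\<forall>b\<in>\<B>. \<forall>f\<in>faces (associated_graph V \<B>) \<rho>.
        bounded_by_triangle f b \<longrightarrow> f = {(x, \<sigma> b x) | x. x \<in> b})"

definition upper_embeddable_in_orientation ::
    "'a set \<Rightarrow> 'a set set \<Rightarrow> ('a set \<Rightarrow> 'a \<Rightarrow> 'a) \<Rightarrow> bool" where
  "upper_embeddable_in_orientation V \<B> \<sigma> \<longleftrightarrow>
     (\<exists>\<rho>. upper_embedding V \<B> \<rho> \<and> induces_orientation V \<B> \<rho> \<sigma>)"

definition upper_embeddable_in_every_orientation :: "'a set \<Rightarrow> 'a set set \<Rightarrow> bool" where
  "upper_embeddable_in_every_orientation V \<B> \<longleftrightarrow>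
     (\<forall>\<sigma>. triple_orientation \<B> \<sigma> \<longrightarrow> upper_embeddable_in_orientation V \<B> \<sigma>)"

end

theory Submission
  imports Defs Complex_Main "HOL-Library.Disjoint_Sets"
begin

text \<open>
  Regard the blocks as the vertices of a 3-uniform hypergraph whose edges are the points. Suppose that
  a set of \<open>(v - 1) / 2\<close> points already connects all \<open>v\<close> blocks (a spanning hypertree). Start with the \<open>v\<close>
  block triangles, each traversed backwards. Fixing the rotation at a point of the hypertree, in either
  of the two possible ways, merges three closed walks into one, so in the end a single walk remains.
  At each further point all three corners lie on this walk, and one of the two rotations keeps it in
  one piece. The resulting rotation system has one outer face, whatever the orientation of the triples.

  A spanning hypertree is an instance of graphic matroid parity, with triples instead of pairs. As in
  Lovasz's min-max theorem, it exists unless there are an equivalence relation \<open>R\<close> on the blocks and a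
  partition \<open>\<Q>\<close> of the points with \<open>rk R + (\<Sum>W\<in>\<Q>. \<lfloor>\<rho> W / 2\<rfloor>) < (v - 1) / 2\<close>, where \<open>\<rho> W\<close> is the rank that
  \<open>W\<close> adds to \<open>R\<close>. The sufficiency is proved by induction on the number of points: either some point
  can be deleted, or a partition attains equality, and Rado's selection principle distributes the rank
  among its parts so that each of them can be solved separately.

  No such \<open>R\<close> and \<open>\<Q>\<close> exist for \<open>v \<le> 19\<close>. After refining \<open>\<Q>\<close>, a part that meets \<open>b\<close> classes of
  \<open>R\<close> connects them all, so that it adds the rank \<open>b - 1\<close>. Give each class of \<open>R\<close> the weight 42, distributed over its
  flags so that a part \<open>W\<close> meeting \<open>b\<close> classes carries weight at most \<open>24 |W| + 21 (b - 1 - \<epsilon>)\<close>, where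
  \<open>\<epsilon>\<close> is 1 if \<open>b\<close> is even and 0 otherwise. Summing over all parts, a violation would give \<open>v + 3 \<le> 8 v / 7\<close>.
\<close>

section \<open>Equivalence closure and rank of a relation\<close>

text \<open>The obstacle is parity: points supply rank in steps of two, so a part of odd rank wastes
  one unit. In a tight pair \<open>(P, \<Q>)\<close> the rank of \<open>P\<close> over
  \<open>R0\<close> has to be supplied by the points as well, and the room for it lies in the odd
  parts. Each of them either takes over one unit of \<open>P\<close> or gives up one unit of its
  own; choosing which, so that the result still spans, is the selection problem. The set function
  given to Rado's principle adds a rank over \<open>R0\<close>, for the units taken over, and a dual
  rank over \<open>P\<close>, for the units given up. Every part then has an even target, but over a
  base whose rank may differ by one from that of the trace of \<open>P\<close>. To absorb this unit
  the tight pair is chosen maximal, which makes proper refinements strictly worse. The constants of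
  the weighting fit the Fano plane: seven hyperedges on seven vertices add rank 6, half of which is
  3, and 42 * (7 - 3) = 24 * 7. Equality recurs for a Fano plane, and for a single hyperedge, in
  which two vertices are identified.\<close>

locale relation_rank =
  fixes V :: "'v set"
  assumes finite_V: "finite V"
begin

text \<open>Intersecting with \<open>V \<times> V\<close> lets \<open>cl\<close> and
  \<open>rk\<close> take arbitrary relations; pairs that leave \<open>V\<close> behave like loops of
  the matroid.\<close>

definition cl :: "('v \<times> 'v) set \<Rightarrow> ('v \<times> 'v) set" where
  "cl X = ((X \<inter> V \<times> V) \<union> (X \<inter> V \<times> V)\<inverse>)\<^sup>* \<inter> V \<times> V"

text \<open>The rank function of the graphic matroid: vertices minus components.\<close>

definition rk :: "('v \<times> 'v) set \<Rightarrow> nat" where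
  "rk X = card V - card (V // cl X)"

text \<open>The rank of \<open>X\<close> after contraction of \<open>A\<close>. The subtraction
  never truncates, because the rank is monotone.\<close>

definition inc :: "('v \<times> 'v) set \<Rightarrow> ('v \<times> 'v) set \<Rightarrow> nat" where
  "inc A X = rk (A \<union> X) - rk A"

lemma cl_sub: "cl X \<subseteq> V \<times> V"
  by (auto simp: cl_def)

lemma equiv_cl: "equiv V (cl X)"
proof (rule equivI)
  let ?E = "(X \<inter> V \<times> V) \<union> (X \<inter> V \<times> V)\<inverse>"
  show "cl X \<subseteq> V \<times> V" by (rule cl_sub)
  show "refl_on V (cl X)" by (auto simp: cl_def refl_on_def)
  have "sym (?E\<^sup>*)" by (intro sym_rtrancl sym_Un_converse)
  then show "sym (cl X)" by (auto simp: cl_def sym_def)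
  show "trans (cl X)" unfolding cl_def by (auto intro!: transI intro: rtrancl_trans)
qed

lemma cl_refl: "x \<in> V \<Longrightarrow> (x, x) \<in> cl X"
  using equiv_cl[of X] by (auto simp: equiv_def refl_on_def)

lemma cl_sym: "(x, y) \<in> cl X \<Longrightarrow> (y, x) \<in> cl X"
  using equiv_cl[of X] by (auto simp: equiv_def sym_def)

lemma cl_trans: "(x, y) \<in> cl X \<Longrightarrow> (y, z) \<in> cl X \<Longrightarrow> (x, z) \<in> cl X"
  using equiv_cl[of X] by (meson equiv_def transD)

lemma cl_inV: "(x, y) \<in> cl X \<Longrightarrow> x \<in> V \<and> y \<in> V"
  using cl_sub by blast

lemma cl_incl: "X \<inter> V \<times> V \<subseteq> cl X"
  by (auto simp: cl_def)

lemma cl_inclI: "X \<subseteq> V \<times> V \<Longrightarrow> X \<subseteq> cl X"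
  using cl_incl[of X] by blast

lemma cl_least:
  assumes S: "equiv V S" and X: "X \<inter> V \<times> V \<subseteq> S"
  shows "cl X \<subseteq> S"
proof
  fix e assume "e \<in> cl X"
  then obtain x y where e: "e = (x, y)" and xV: "x \<in> V"
    and r: "(x, y) \<in> ((X \<inter> V \<times> V) \<union> (X \<inter> V \<times> V)\<inverse>)\<^sup>*"
    by (cases e) (auto simp: cl_def)
  from r have "(x, y) \<in> S"
  proof (induction rule: rtrancl_induct)
    case base
    then show ?case using S xV by (auto simp: equiv_def refl_on_def)
  next
    case (step y z)
    then have "(y, z) \<in> S" using X S by (auto simp: equiv_def sym_def)
    then show ?case using step S by (meson equiv_def transD)
  qed
  then show "e \<in> S" using e by simp
qed

lemma cl_minimal: "X \<subseteq> cl Y \<Longrightarrow> cl X \<subseteq> cl Y"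
  by (rule cl_least[OF equiv_cl]) blast

lemma cl_mono: "X \<subseteq> Y \<Longrightarrow> cl X \<subseteq> cl Y"
  by (rule cl_least[OF equiv_cl]) (use cl_incl[of Y] in blast)

lemma cl_idem: "cl (cl X) = cl X"
  using cl_minimal[of "cl X" X] cl_incl[of "cl X"] cl_sub[of X] by blast

lemma cl_Un_absorb:
  assumes "X \<inter> V \<times> V \<subseteq> cl Y"
  shows "cl (Y \<union> X) = cl Y"
proof
  show "cl (Y \<union> X) \<subseteq> cl Y"
    by (rule cl_least[OF equiv_cl]) (use assms cl_incl[of Y] in blast)
  show "cl Y \<subseteq> cl (Y \<union> X)" by (rule cl_mono) simp
qed

lemma cl_cl_Un: "cl (cl A \<union> B) = cl (A \<union> B)"
proof
  show "cl (cl A \<union> B) \<subseteq> cl (A \<union> B)"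
    by (rule cl_least[OF equiv_cl])
      (use cl_mono[of A "A \<union> B"] cl_incl[of "A \<union> B"] in blast)
  show "cl (A \<union> B) \<subseteq> cl (cl A \<union> B)"
    by (rule cl_least[OF equiv_cl])
      (use cl_incl[of A] cl_incl[of "cl A \<union> B"] cl_sub in blast)
qed

lemma cl_Un_square:
  assumes "U \<subseteq> V"
  shows "cl (X \<union> U \<times> U) = cl X \<union> (cl X `` U) \<times> (cl X `` U)"
proof
  let ?K = "cl X `` U"
  have "equiv V (cl X \<union> ?K \<times> ?K)"
  proof (rule equivI)
    show "cl X \<union> ?K \<times> ?K \<subseteq> V \<times> V" using cl_sub by blast
    show "refl_on V (cl X \<union> ?K \<times> ?K)" using cl_refl by (auto simp: refl_on_def)
    show "sym (cl X \<union> ?K \<times> ?K)" using cl_sym by (auto simp: sym_def)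
    show "trans (cl X \<union> ?K \<times> ?K)"
      by (rule transI) (use cl_trans cl_sym in blast)
  qed
  moreover have "U \<subseteq> ?K" using assms cl_refl by blast
  ultimately show "cl (X \<union> U \<times> U) \<subseteq> cl X \<union> ?K \<times> ?K"
    by (intro cl_least) (use cl_incl[of X] in blast)+
  have "cl X \<subseteq> cl (X \<union> U \<times> U)" by (rule cl_mono) simp
  moreover have "U \<times> U \<subseteq> cl (X \<union> U \<times> U)"
    using assms cl_incl[of "X \<union> U \<times> U"] by blast
  ultimately show "cl X \<union> ?K \<times> ?K \<subseteq> cl (X \<union> U \<times> U)"
    using cl_sym cl_trans by blast
qed

lemma finite_classes: "finite (V // cl X)"
  using finite_V equiv_cl finite_equiv_class finite_quotient by (metis equiv_def)

lemma card_classes_le: "card (V // cl X) \<le> card V"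
proof -
  have "V // cl X = (\<lambda>x. cl X `` {x}) ` V" by (auto simp: quotient_def)
  then show ?thesis using card_image_le[OF finite_V] by simp
qed

lemma rk_eq: "rk X + card (V // cl X) = card V"
  using card_classes_le[of X] by (simp add: rk_def)

lemma rk_cong: "cl X = cl Y \<Longrightarrow> rk X = rk Y"
  by (simp add: rk_def)

lemma rk_cl: "rk (cl X) = rk X"
  by (simp add: rk_def cl_idem)

text \<open>A clique on \<open>U\<close> fuses exactly the classes that meet \<open>U\<close> into
  one, so the number of classes drops by the number of these less one. The \<open>+ 1\<close> on the
  left avoids a truncated difference.\<close>

lemma rk_Un_square:
  assumes U: "U \<subseteq> V" "U \<noteq> {}"
  shows "rk (X \<union> U \<times> U) + 1 = rk X + card ((\<lambda>x. cl X `` {x}) ` U)"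
proof -
  let ?K = "cl X `` U"
  let ?N = "{C \<in> V // cl X. C \<inter> U = {}}"
  have img: "(\<lambda>x. cl X `` {x}) ` U = {C \<in> V // cl X. C \<inter> U \<noteq> {}}"
  proof
    show "(\<lambda>x. cl X `` {x}) ` U \<subseteq> {C \<in> V // cl X. C \<inter> U \<noteq> {}}"
      using U cl_refl by (auto simp: quotient_def)
    show "{C \<in> V // cl X. C \<inter> U \<noteq> {}} \<subseteq> (\<lambda>x. cl X `` {x}) ` U"
    proof
      fix C assume "C \<in> {C \<in> V // cl X. C \<inter> U \<noteq> {}}"
      then obtain x u where "C = cl X `` {x}" "u \<in> U" "u \<in> C" by (auto simp: quotient_def)
      then have "C = cl X `` {u}" using equiv_class_eq[OF equiv_cl] by fastforce
      then show "C \<in> (\<lambda>x. cl X `` {x}) ` U" using \<open>u \<in> U\<close> by blast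
    qed
  qed
  have cls: "cl (X \<union> U \<times> U) `` {v} = (if v \<in> ?K then ?K else cl X `` {v})" for v
  proof -
    have "w \<in> ?K" if "v \<in> ?K" "(v, w) \<in> cl X" for w
      using that cl_trans by blast
    then show ?thesis unfolding cl_Un_square[OF U(1)] by auto
  qed
  have "V // cl (X \<union> U \<times> U) = insert ?K ?N"
  proof
    show "V // cl (X \<union> U \<times> U) \<subseteq> insert ?K ?N"
    proof
      fix C assume "C \<in> V // cl (X \<union> U \<times> U)"
      then obtain v where v: "v \<in> V" "C = cl (X \<union> U \<times> U) `` {v}" by (auto simp: quotient_def)
      show "C \<in> insert ?K ?N"
      proof (cases "v \<in> ?K")
        case True then show ?thesis using v cls by simp
      next
        case False
        then have C: "C = cl X `` {v}" using v cls[of v] by simp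
        moreover have "C \<inter> U = {}"
        proof (rule ccontr)
          assume "C \<inter> U \<noteq> {}"
          then obtain u where "u \<in> U" "(v, u) \<in> cl X" using C by blast
          then show False using False cl_sym by blast
        qed
        ultimately show ?thesis using v by (auto simp: quotient_def)
      qed
    qed
    show "insert ?K ?N \<subseteq> V // cl (X \<union> U \<times> U)"
    proof
      fix C assume C: "C \<in> insert ?K ?N"
      show "C \<in> V // cl (X \<union> U \<times> U)"
      proof (cases "C = ?K")
        case True
        obtain u where u: "u \<in> U" using U by blast
        then have "u \<in> ?K" "u \<in> V" using U cl_refl by blast+
        then have "C = cl (X \<union> U \<times> U) `` {u}" using True cls by simp
        then show ?thesis using \<open>u \<in> V\<close> by (auto simp: quotient_def)
      next
        case False
        then obtain v where v: "v \<in> V" "C = cl X `` {v}" "C \<inter> U = {}" using C by (auto simp: quotient_def)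
        then have "v \<notin> ?K" using cl_sym by blast
        then have "C = cl (X \<union> U \<times> U) `` {v}" using v cls by simp
        then show ?thesis using v by (auto simp: quotient_def)
      qed
    qed
  qed
  moreover have "?K \<notin> ?N" using U cl_refl by blast
  moreover have "finite ?N" using finite_classes by simp
  ultimately have 1: "card (V // cl (X \<union> U \<times> U)) = card ?N + 1" by simp
  have "V // cl X = {C \<in> V // cl X. C \<inter> U \<noteq> {}} \<union> ?N" by blast
  then have "card (V // cl X) = card {C \<in> V // cl X. C \<inter> U \<noteq> {}} + card ?N"
    using card_Un_disjoint[of "{C \<in> V // cl X. C \<inter> U \<noteq> {}}" ?N] finite_classes[of X] by fastforce
  then show ?thesis using 1 rk_eq[of X] rk_eq[of "X \<union> U \<times> U"] unfolding img by linarith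
qed

lemma rk_insert:
  "rk (insert (x, y) X) = (if (x, y) \<in> cl X \<or> (x, y) \<notin> V \<times> V then rk X else rk X + 1)"
proof (cases "(x, y) \<in> cl X \<or> (x, y) \<notin> V \<times> V")
  case True
  then have "cl (X \<union> {(x, y)}) = cl X" by (intro cl_Un_absorb) auto
  then have "rk (X \<union> {(x, y)}) = rk X" by (rule rk_cong)
  then show ?thesis using True by simp
next
  case False
  then have V: "x \<in> V" "y \<in> V" by auto
  have "cl (insert (x, y) X) = cl (X \<union> {x, y} \<times> {x, y})"
  proof
    have *: "(x, y) \<in> cl (insert (x, y) X)" using cl_incl[of "insert (x, y) X"] V by blast
    have "{x, y} \<times> {x, y} \<subseteq> cl (insert (x, y) X)"
      using * cl_sym[OF *] cl_refl[OF V(1)] cl_refl[OF V(2)] by simp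
    then show "cl (X \<union> {x, y} \<times> {x, y}) \<subseteq> cl (insert (x, y) X)"
      by (intro cl_least[OF equiv_cl]) (use cl_incl[of "insert (x, y) X"] in blast)
    show "cl (insert (x, y) X) \<subseteq> cl (X \<union> {x, y} \<times> {x, y})" by (rule cl_mono) blast
  qed
  then have "rk (insert (x, y) X) = rk (X \<union> {x, y} \<times> {x, y})" by (rule rk_cong)
  moreover have "cl X `` {x} \<noteq> cl X `` {y}" using False eq_equiv_class[OF _ equiv_cl] V by blast
  then have "card ((\<lambda>v. cl X `` {v}) ` {x, y}) = 2" by simp
  ultimately show ?thesis using rk_Un_square[of "{x, y}" X] V False by simp
qed

lemma rk_restrict: "rk (X \<inter> V \<times> V) = rk X"
  by (simp add: rk_def cl_def)

lemma rk_Un_restrict: "rk (A \<union> (X \<inter> V \<times> V)) = rk (A \<union> X)"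
  using rk_restrict[of "A \<union> X"] rk_restrict[of "A \<union> (X \<inter> V \<times> V)"]
  by (simp add: Int_Un_distrib2 Int_assoc)

text \<open>\<open>X\<close> may be infinite: rank and closure depend only on its trace on the
  finite set \<open>V \<times> V\<close>, and the case \<open>restrict\<close> passes to that
  trace.\<close>

lemma finite_rel_induct [consumes 0, case_names restrict empty insert]:
  assumes "\<And>X. P (X \<inter> V \<times> V) \<Longrightarrow> P X" "P {}"
    and "\<And>x y X. x \<in> V \<Longrightarrow> y \<in> V \<Longrightarrow> X \<subseteq> V \<times> V \<Longrightarrow> P X \<Longrightarrow> P (insert (x, y) X)"
  shows "P X"
proof -
  have "finite Y \<Longrightarrow> Y \<subseteq> V \<times> V \<Longrightarrow> P Y" for Y
    by (induction Y rule: finite_induct) (use assms in auto)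
  then show ?thesis using assms(1)[of X] finite_V by (simp add: finite_subset[of _ "V \<times> V"])
qed

lemma rk_Un_ge: "rk A \<le> rk (A \<union> X)"
  by (induction X rule: finite_rel_induct) (auto simp: rk_insert rk_Un_restrict)

lemma rk_mono: "A \<subseteq> B \<Longrightarrow> rk A \<le> rk B"
  using rk_Un_ge[of A B] by (simp add: Un_absorb1)

lemma rk_inc: "rk (A \<union> X) = rk A + inc A X"
  using rk_Un_ge[of A X] by (simp add: inc_def)

text \<open>Submodularity in the form of diminishing increments. The pairs of \<open>X\<close> are
  added one at a time; a pair that joins two classes of the coarser relation, generated with
  \<open>B\<close>, also joins two classes of the finer one, generated with
  \<open>A\<close>.\<close>

lemma rk_submodular:
  assumes "A \<inter> V \<times> V \<subseteq> cl B"
  shows "inc B X \<le> inc A X"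
proof -
  have "rk (B \<union> X) + rk A \<le> rk (A \<union> X) + rk B"
  proof (induction X rule: finite_rel_induct)
    case (insert x y X)
    have "cl (A \<union> X) \<subseteq> cl (B \<union> X)"
      by (rule cl_least[OF equiv_cl]) (use assms cl_mono[of B "B \<union> X"] insert(3) cl_incl[of "B \<union> X"] in blast)
    then show ?case using insert by (auto simp: rk_insert)
  qed (simp_all add: rk_Un_restrict)
  then show ?thesis by (simp add: rk_inc)
qed

lemma inc_antimono: "A \<subseteq> cl B \<Longrightarrow> inc B X \<le> inc A X"
  by (rule rk_submodular) blast

lemma inc_le_card:
  assumes "finite X"
  shows "inc A X \<le> card X"
proof -
  have "rk (A \<union> X) \<le> rk A + card X"
    using assms
  proof (induction X rule: finite_induct)
    case (insert e X)
    then show ?case by (cases e) (auto simp: rk_insert)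
  qed simp
  then show ?thesis by (simp add: inc_def)
qed

lemma cl_eqI_rk:
  assumes "rk (A \<union> X) = rk A"
  shows "X \<inter> V \<times> V \<subseteq> cl A"
proof
  fix e assume e: "e \<in> X \<inter> V \<times> V"
  show "e \<in> cl A"
  proof (rule ccontr)
    assume "e \<notin> cl A"
    then have "rk (insert e A) = rk A + 1" using e rk_insert by (cases e) auto
    moreover have "rk (insert e A) \<le> rk (A \<union> X)" by (rule rk_mono) (use e in blast)
    ultimately show False using assms by simp
  qed
qed

lemma cl_eq_of_rk_le:
  assumes "A \<subseteq> cl B" "rk B \<le> rk A" "A \<subseteq> V \<times> V"
  shows "cl B = cl A"
proof -
  have "cl (B \<union> A) = cl B" by (rule cl_Un_absorb) (use assms in blast)
  then have "rk (A \<union> B) = rk A"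
    using rk_cong[of "B \<union> A" B] rk_Un_ge[of A B] assms(2) by (simp add: Un_commute)
  then have "cl (A \<union> B) = cl A" using cl_eqI_rk cl_Un_absorb by blast
  then show ?thesis using \<open>cl (B \<union> A) = cl B\<close> by (simp add: Un_commute)
qed

lemma inc_mono: "X \<subseteq> Y \<Longrightarrow> inc A X \<le> inc A Y"
  unfolding inc_def by (intro diff_le_mono rk_mono) blast

lemma inc_Un: "inc A (X \<union> Y) = inc A X + inc (A \<union> X) Y"
  using rk_inc[of A X] rk_inc[of "A \<union> X" Y] rk_inc[of A "X \<union> Y"] by (simp add: Un_assoc)

lemma rk_basis: "\<exists>Y\<subseteq>X. finite Y \<and> card Y = inc A X \<and> cl (A \<union> Y) = cl (A \<union> X)"
proof (induction X rule: finite_rel_induct)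
  case (restrict X)
  have "cl (A \<union> (X \<inter> V \<times> V)) = cl (A \<union> X)"
    by (simp add: cl_def Int_Un_distrib2 Int_assoc)
  then show ?case using restrict by (auto simp: inc_def rk_Un_restrict)
next
  case empty
  then show ?case by (auto simp: inc_def)
next
  case (insert x y X)
  then obtain Y where Y: "Y \<subseteq> X" "finite Y" "card Y = inc A X" "cl (A \<union> Y) = cl (A \<union> X)" by blast
  show ?case
  proof (cases "(x, y) \<in> cl (A \<union> X)")
    case True
    then have "cl (A \<union> X \<union> {(x, y)}) = cl (A \<union> X)" by (intro cl_Un_absorb) auto
    then have "cl (A \<union> insert (x, y) X) = cl (A \<union> X)" by simp
    moreover have "inc A (insert (x, y) X) = inc A X" using True by (simp add: inc_def rk_insert)
    ultimately show ?thesis using Y by (intro exI[of _ Y]) auto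
  next
    case False
    then have "(x, y) \<notin> Y" using Y cl_incl[of "A \<union> X"] insert by blast
    moreover have "inc A (insert (x, y) X) = inc A X + 1"
      using False insert rk_inc[of A X] rk_inc[of A "insert (x, y) X"] by (simp add: rk_insert)
    moreover have "cl (A \<union> insert (x, y) Y) = cl (A \<union> insert (x, y) X)"
      using cl_cl_Un[of "A \<union> Y" "{(x, y)}"] cl_cl_Un[of "A \<union> X" "{(x, y)}"] Y(4) by simp
    ultimately show ?thesis using Y by (intro exI[of _ "insert (x, y) Y"]) auto
  qed
qed

text \<open>A path in \<open>D \<union> X\<close> between vertices of \<open>U\<close> uses
  \<open>X\<close> only inside \<open>U\<close>, so it breaks into stretches of \<open>D\<close>
  whose ends lie in \<open>U\<close>. Hence only the trace of \<open>cl D\<close> on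
  \<open>U\<close> matters.\<close>

lemma cl_local:
  assumes U: "U \<subseteq> V" and X: "X \<subseteq> U \<times> U"
  shows "cl (D \<union> X) \<inter> U \<times> U \<subseteq> cl ((cl D \<inter> U \<times> U) \<union> X)"
proof
  let ?C = "cl ((cl D \<inter> U \<times> U) \<union> X)"
  \<comment> \<open>\<open>?S\<close> describes arbitrary paths: either within \<open>D\<close>, or
    entering \<open>U\<close> along \<open>D\<close>, moving inside \<open>U\<close> by
    \<open>?C\<close>, and leaving along \<open>D\<close>.\<close>
  let ?S = "cl D \<union> {(a, b). \<exists>u\<in>U. \<exists>v\<in>U. (a, u) \<in> cl D \<and> (u, v) \<in> ?C \<and> (v, b) \<in> cl D}"
  have D: "cl D \<inter> U \<times> U \<subseteq> ?C" using cl_incl[of "(cl D \<inter> U \<times> U) \<union> X"] U by blast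
  have XC: "X \<subseteq> ?C" using cl_incl[of "(cl D \<inter> U \<times> U) \<union> X"] U X by blast
  have "equiv V ?S"
  proof (rule equivI)
    show "?S \<subseteq> V \<times> V" using cl_inV by auto
    show "refl_on V ?S" using cl_refl by (auto simp: refl_on_def)
    show "sym ?S"
    proof (rule symI)
      fix a b assume "(a, b) \<in> ?S"
      then show "(b, a) \<in> ?S" using cl_sym by blast
    qed
    show "trans ?S"
    proof (rule transI)
      fix a b c assume ab: "(a, b) \<in> ?S" and bc: "(b, c) \<in> ?S"
      show "(a, c) \<in> ?S"
      proof (cases "(a, b) \<in> cl D \<or> (b, c) \<in> cl D")
        case True
        then show ?thesis using ab bc cl_trans by blast
      next
        case False
        then obtain u v u' v' where "u \<in> U" "v \<in> U" "(a, u) \<in> cl D" "(u, v) \<in> ?C" "(v, b) \<in> cl D"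
          "u' \<in> U" "v' \<in> U" "(b, u') \<in> cl D" "(u', v') \<in> ?C" "(v', c) \<in> cl D"
          using ab bc by blast
        moreover from this have "(v, u') \<in> ?C" using cl_trans D by blast
        ultimately have "(u, v') \<in> ?C" using cl_trans by blast
        then show ?thesis using \<open>u \<in> U\<close> \<open>v' \<in> U\<close> \<open>(a, u) \<in> cl D\<close> \<open>(v', c) \<in> cl D\<close> by blast
      qed
    qed
  qed
  moreover have "(D \<union> X) \<inter> V \<times> V \<subseteq> ?S"
  proof
    fix e assume e: "e \<in> (D \<union> X) \<inter> V \<times> V"
    show "e \<in> ?S"
    proof (cases "e \<in> D")
      case True then show ?thesis using e cl_incl by blast
    next
      case False
      then have "e \<in> X" using e by simp
      then obtain a b where ab: "e = (a, b)" "a \<in> U" "b \<in> U" "(a, b) \<in> ?C" using X XC by blast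
      then have "(a, a) \<in> cl D" "(b, b) \<in> cl D" using U cl_refl by blast+
      then show ?thesis using ab by blast
    qed
  qed
  ultimately have S: "cl (D \<union> X) \<subseteq> ?S" by (rule cl_least)
  fix e assume e: "e \<in> cl (D \<union> X) \<inter> U \<times> U"
  then obtain a b where ab: "e = (a, b)" "a \<in> U" "b \<in> U" "(a, b) \<in> ?S" using S by blast
  show "e \<in> ?C"
  proof (cases "(a, b) \<in> cl D")
    case True then show ?thesis using ab D by blast
  next
    case False
    then obtain u v where "u \<in> U" "v \<in> U" "(a, u) \<in> cl D" "(u, v) \<in> ?C" "(v, b) \<in> cl D"
      using ab by blast
    moreover from this ab have "(a, u) \<in> ?C" "(v, b) \<in> ?C" using D by blast+
    ultimately show ?thesis using ab cl_trans by blast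
  qed
qed

text \<open>This is what allows a part to be treated on its own: everything else acts on it only
  through the trace of a closure.\<close>

lemma inc_local:
  assumes U: "U \<subseteq> V" and X: "X \<subseteq> U \<times> U"
  shows "inc D X = inc (cl D \<inter> U \<times> U) X"
proof -
  have "finite X" by (rule finite_subset[OF X]) (use U finite_V finite_subset in blast)
  then have "X \<subseteq> U \<times> U \<Longrightarrow> rk (D \<union> X) + rk (cl D \<inter> U \<times> U) = rk ((cl D \<inter> U \<times> U) \<union> X) + rk D"
  proof (induction X rule: finite_induct)
    case (insert e X)
    have "cl ((cl D \<inter> U \<times> U) \<union> X) \<subseteq> cl (D \<union> X)"
      using cl_mono[of "(cl D \<inter> U \<times> U) \<union> X" "cl D \<union> X"] cl_cl_Un[of D X] by blast
    then have "e \<in> cl (D \<union> X) \<longleftrightarrow> e \<in> cl ((cl D \<inter> U \<times> U) \<union> X)"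
      using cl_local[OF U, of X D] insert by blast
    then show ?case using insert U by (cases e) (auto simp: rk_insert)
  qed simp
  then show ?thesis using X by (simp add: inc_def)
qed

lemma rk_empty: "rk {} = 0"
proof -
  have "cl {} = Id_on V" unfolding cl_def by auto
  then have "V // cl {} = (\<lambda>x. {x}) ` V" by (auto simp: quotient_def)
  then have "card (V // cl {}) = card V" by (simp add: card_image)
  then show ?thesis using rk_eq[of "{}"] by simp
qed

lemma rk_connected:
  assumes "cl X = V \<times> V" "V \<noteq> {}"
  shows "rk X + 1 = card V"
proof -
  have "(V \<times> V) `` {x} = V" if "x \<in> V" for x using that by auto
  then have "V // cl X = {V}" using assms unfolding quotient_def by auto
  then show ?thesis using rk_eq[of X] by simp
qed

end

section \<open>Transversals of large value\<close>

text \<open>As long as some \<open>A i\<close> has two elements, one of them can be removed without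
  violating the counting condition. In the end all sets are singletons, and the condition for
  \<open>I\<close> itself is the claim. The hypothesis \<open>f {} \<le> 0\<close> keeps the sets
  from becoming empty.\<close>

lemma Rado_selection:
  fixes f :: "'e set \<Rightarrow> int"
  assumes "finite I" "\<And>i. i \<in> I \<Longrightarrow> finite (A i)"
    and mono: "\<And>X Y. X \<subseteq> Y \<Longrightarrow> f X \<le> f Y"
    and submodular: "\<And>X Y. f (X \<union> Y) + f (X \<inter> Y) \<le> f X + f Y"
    and empty: "f {} \<le> 0"
    and "\<And>J. J \<subseteq> I \<Longrightarrow> int (card J) \<le> f (\<Union>(A ` J))"
  shows "\<exists>x. (\<forall>i\<in>I. x i \<in> A i) \<and> int (card I) \<le> f (x ` I)"
  using assms(2,6)
proof (induction "\<Sum>i\<in>I. card (A i)" arbitrary: A rule: less_induct)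
  case less
  note fin = less.prems(1) and cond = less.prems(2)
  show ?case
  proof (cases "\<exists>i\<in>I. \<exists>a\<in>A i. \<exists>b\<in>A i. a \<noteq> b")
    case False
    have "\<exists>a. A i = {a}" if i: "i \<in> I" for i
    proof -
      have "1 \<le> f (A i)" using cond[of "{i}"] i by simp
      then have "A i \<noteq> {}" using empty by auto
      then show ?thesis using False i by blast
    qed
    then obtain x where x: "\<And>i. i \<in> I \<Longrightarrow> A i = {x i}" by metis
    then have "\<Union>(A ` I) = x ` I" by auto
    then show ?thesis using cond[of I] x by auto
  next
    case True
    then obtain i a b where i: "i \<in> I" and ab: "a \<in> A i" "b \<in> A i" "a \<noteq> b" by blast
    let ?A = "\<lambda>c. A(i := A i - {c})"
    have "(\<exists>x. (\<forall>j\<in>I. x j \<in> A j) \<and> int (card I) \<le> f (x ` I)) \<or>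
        (\<exists>J\<subseteq>I - {i}. f ((A i - {c}) \<union> \<Union>(A ` J)) \<le> int (card J))" if c: "c \<in> A i" for c
    proof (cases "\<forall>J\<subseteq>I. int (card J) \<le> f (\<Union>(?A c ` J))")
      case True
      have "card (A i - {c}) < card (A i)" using c fin i by (intro psubset_card_mono) auto
      then have sum_less: "(\<Sum>j\<in>I. card (?A c j)) < (\<Sum>j\<in>I. card (A j))"
        using assms(1) i by (intro sum_strict_mono_ex1) auto
      have "\<exists>x. (\<forall>j\<in>I. x j \<in> ?A c j) \<and> int (card I) \<le> f (x ` I)"
      proof (rule less.hyps)
        show "(\<Sum>j\<in>I. card (?A c j)) < (\<Sum>j\<in>I. card (A j))" by (rule sum_less)
        show "finite (?A c j)" if "j \<in> I" for j using fin[OF that] by (cases "j = i") auto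
        show "int (card J) \<le> f (\<Union>(?A c ` J))" if "J \<subseteq> I" for J using True that by blast
      qed
      moreover have "?A c j \<subseteq> A j" for j by auto
      ultimately show ?thesis by blast
    next
      case False
      then obtain J where J: "J \<subseteq> I" "f (\<Union>(?A c ` J)) < int (card J)" by (auto simp: not_le)
      have iJ: "i \<in> J"
      proof (rule ccontr)
        assume "i \<notin> J"
        then have "\<Union>(?A c ` J) = \<Union>(A ` J)" by auto
        then show False using J cond[of J] by simp
      qed
      have "\<Union>(?A c ` J) = (A i - {c}) \<union> \<Union>(A ` (J - {i}))" using iJ by auto
      moreover have "card J = card (J - {i}) + 1"
        using iJ J assms(1) by (metis Suc_eq_plus1 card_Suc_Diff1 finite_subset)
      ultimately have "f ((A i - {c}) \<union> \<Union>(A ` (J - {i}))) \<le> int (card (J - {i}))" using J by simp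
      then show ?thesis using J by blast
    qed
    note * = this
    show ?thesis
    proof (rule ccontr)
      assume "\<not> ?thesis"
      then obtain J K where J: "J \<subseteq> I - {i}" "f ((A i - {a}) \<union> \<Union>(A ` J)) \<le> int (card J)"
        and K: "K \<subseteq> I - {i}" "f ((A i - {b}) \<union> \<Union>(A ` K)) \<le> int (card K)"
        using *[OF ab(1)] *[OF ab(2)] by blast
      \<comment> \<open>Two violating families, one for each of the deleted elements. The union
        regains all of \<open>A i\<close> and so counts the index \<open>i\<close> in addition to
        \<open>J \<union> K\<close>, while the intersection covers \<open>J \<inter> K\<close>;
        submodularity then fails by one.\<close>
      let ?X = "(A i - {a}) \<union> \<Union>(A ` J)" and ?Y = "(A i - {b}) \<union> \<Union>(A ` K)"
      have eq: "?X \<union> ?Y = \<Union>(A ` (insert i (J \<union> K)))" using ab by auto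
      have "insert i (J \<union> K) \<subseteq> I" using J K i by blast
      from cond[OF this] have 1: "int (card (insert i (J \<union> K))) \<le> f (?X \<union> ?Y)"
        unfolding eq .
      have fJK: "finite J" "finite K" using J K assms(1) by (meson finite_Diff finite_subset)+
      have "card (insert i (J \<union> K)) = card (J \<union> K) + 1" using J K fJK by (subst card_insert_disjoint) auto
      moreover have "card (J \<union> K) + card (J \<inter> K) = card J + card K"
        using card_Un_Int[OF fJK] by simp
      moreover have "int (card (J \<inter> K)) \<le> f (\<Union>(A ` (J \<inter> K)))" using cond[of "J \<inter> K"] J by blast
      moreover have "f (\<Union>(A ` (J \<inter> K))) \<le> f (?X \<inter> ?Y)" by (rule mono) blast
      ultimately show False using 1 submodular[of ?X ?Y] J(2) K(2) by linarith
    qed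
  qed
qed

lemma partition_on_refine:
  assumes part: "partition_on Q \<Q>" and W: "W \<in> \<Q>" "partition_on W \<W>"
  shows "partition_on Q (\<Q> - {W} \<union> \<W>)" "(\<Q> - {W}) \<inter> \<W> = {}"
proof -
  have dis: "A \<inter> W = {}" if "A \<in> \<Q> - {W}" for A
    using that W(1) part unfolding partition_on_def disjoint_def by blast
  have sub: "A \<subseteq> W" if "A \<in> \<W>" for A
    unfolding partition_onD1[OF W(2)] using that by (rule Union_upper)
  have ne: "A \<noteq> {}" if "A \<in> \<W>" for A
    using that partition_onD3[OF W(2)] by metis
  show "(\<Q> - {W}) \<inter> \<W> = {}"
  proof (rule ccontr)
    assume "\<not> ?thesis"
    then obtain A where A: "A \<in> \<Q> - {W}" "A \<in> \<W>" by blast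
    show False using dis[OF A(1)] sub[OF A(2)] ne[OF A(2)] by blast
  qed
  show "partition_on Q (\<Q> - {W} \<union> \<W>)"
  proof (rule partition_onI)
    have "\<Union>(\<Q> - {W} \<union> \<W>) = \<Union>(\<Q> - {W}) \<union> W"
      unfolding Union_Un_distrib using partition_onD1[OF W(2)] by simp
    also have "\<dots> = \<Union>\<Q>" using W(1) by blast
    finally show "\<Union>(\<Q> - {W} \<union> \<W>) = Q" using partition_onD1[OF part] by simp
    show "disjnt A B" if AB: "A \<in> \<Q> - {W} \<union> \<W>" "B \<in> \<Q> - {W} \<union> \<W>" "A \<noteq> B" for A B
    proof -
      consider "A \<in> \<Q>" "B \<in> \<Q>" | "A \<in> \<Q> - {W}" "B \<in> \<W>" | "A \<in> \<W>" "B \<in> \<Q> - {W}" | "A \<in> \<W>" "B \<in> \<W>"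
        using AB(1,2) by blast
      then have "A \<inter> B = {}"
      proof cases
        case 1
        then show ?thesis using part AB(3) unfolding partition_on_def disjoint_def by blast
      next
        case 2
        then show ?thesis using dis[of A] sub[of B] by blast
      next
        case 3
        then show ?thesis using dis[of B] sub[of A] by blast
      next
        case 4
        then show ?thesis using W(2) AB(3) unfolding partition_on_def disjoint_def by blast
      qed
      then show ?thesis by (simp add: disjnt_def)
    qed
    show "{} \<notin> \<Q> - {W} \<union> \<W>" using partition_onD3[OF part] ne by blast
  qed
qed

section \<open>Spanning hyperforests\<close>

text \<open>A hyperedge enters the graphic matroid as a clique. A clique on three vertices has rank
  2 and takes the role of a pair of elements in matroid parity.\<close>

definition pairs :: "('p \<Rightarrow> 'v set) \<Rightarrow> 'p set \<Rightarrow> ('v \<times> 'v) set" where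
  "pairs N W = (\<Union>p\<in>W. N p \<times> N p)"

lemma pairs_Un: "pairs N (A \<union> B) = pairs N A \<union> pairs N B"
  by (auto simp: pairs_def)

lemma pairs_mono: "A \<subseteq> B \<Longrightarrow> pairs N A \<subseteq> pairs N B"
  by (auto simp: pairs_def)

lemma pairs_UN: "pairs N (\<Union>\<A>) = (\<Union>W\<in>\<A>. pairs N W)"
  by (auto simp: pairs_def)

lemma pairs_sub_square: "pairs N W \<subseteq> \<Union>(N ` W) \<times> \<Union>(N ` W)"
  by (auto simp: pairs_def)

context relation_rank begin

lemma rk_Un_Int:
  assumes "C \<subseteq> A" "C \<subseteq> B"
  shows "rk (A \<union> B) + rk C \<le> rk A + rk B"
proof -
  have "inc A B \<le> inc C B" by (rule rk_submodular) (use assms cl_incl in blast)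
  moreover have "C \<union> B = B" using assms by blast
  ultimately show ?thesis using rk_inc[of A B] rk_inc[of C B] by simp
qed

lemma inc_square_le:
  assumes "U \<subseteq> V"
  shows "inc A (U \<times> U) \<le> card U - 1"
proof (cases "U = {}")
  case True
  then show ?thesis by (simp add: inc_def)
next
  case False
  have "card ((\<lambda>x. cl A `` {x}) ` U) \<le> card U"
    by (rule card_image_le) (use assms finite_V finite_subset in blast)
  then show ?thesis using rk_Un_square[OF assms False, of A] by (simp add: inc_def)
qed

text \<open>The bound is required over every larger base because the sets are added one after
  another, each to a base that contains the earlier ones.\<close>

lemma inc_UN_le:
  assumes "finite S" "\<And>i B. i \<in> S \<Longrightarrow> A \<subseteq> B \<Longrightarrow> inc B (Y i) \<le> b i"
  shows "inc A (\<Union>i\<in>S. Y i) \<le> (\<Sum>i\<in>S. b i)"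
  using assms
proof (induction S rule: finite_induct)
  case empty
  then show ?case by (simp add: inc_def)
next
  case (insert j S)
  have "inc (A \<union> (\<Union>i\<in>S. Y i)) (Y j) \<le> b j" using insert.prems by blast
  moreover have "inc A (\<Union>i\<in>S. Y i) \<le> (\<Sum>i\<in>S. b i)" using insert by blast
  moreover have "(\<Union>i\<in>insert j S. Y i) = (\<Union>i\<in>S. Y i) \<union> Y j" by blast
  ultimately show ?case using insert.hyps by (simp add: inc_Un)
qed

lemma inc_pairs_le:
  assumes "finite W" "\<And>p. p \<in> W \<Longrightarrow> N p \<subseteq> V \<and> card (N p) \<le> 3"
  shows "inc A (pairs N W) \<le> 2 * card W"
proof -
  have "inc A (pairs N W) \<le> (\<Sum>p\<in>W. 2)"
    unfolding pairs_def
  proof (rule inc_UN_le[OF assms(1)])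
    fix p B assume "p \<in> W"
    then have "N p \<subseteq> V" "card (N p) \<le> 3" using assms by blast+
    then show "inc B (N p \<times> N p) \<le> 2" using inc_square_le[of "N p" B] by linarith
  qed
  then show ?thesis by simp
qed

text \<open>\<open>K\<close> is a union of classes of \<open>D\<close>. Cliques inside
  \<open>K\<close> leave the trace of the closure on \<open>V - K\<close> unchanged, so by
  \<open>inc_local\<close> the cliques outside gain the same rank with or without them.\<close>

lemma inc_pairs_split:
  assumes K: "\<And>a b. (a, b) \<in> cl D \<Longrightarrow> a \<in> K \<longleftrightarrow> b \<in> K"
    and W1: "\<And>p. p \<in> W1 \<Longrightarrow> N p \<subseteq> K" and W2: "\<And>p. p \<in> W2 \<Longrightarrow> N p \<inter> K = {}"
    and KV: "K \<subseteq> V" and N2: "\<And>p. p \<in> W2 \<Longrightarrow> N p \<subseteq> V"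
  shows "inc D (pairs N (W1 \<union> W2)) = inc D (pairs N W1) + inc D (pairs N W2)"
proof -
  let ?U = "V - K"
  have "equiv V (cl D \<union> K \<times> K)"
  proof (rule equivI)
    show "cl D \<union> K \<times> K \<subseteq> V \<times> V" using cl_sub KV by blast
    show "refl_on V (cl D \<union> K \<times> K)" using cl_refl by (auto simp: refl_on_def)
    show "sym (cl D \<union> K \<times> K)" by (rule symI) (use cl_sym in blast)
    show "trans (cl D \<union> K \<times> K)"
    proof (rule transI)
      fix a b c assume "(a, b) \<in> cl D \<union> K \<times> K" "(b, c) \<in> cl D \<union> K \<times> K"
      then consider "(a, b) \<in> cl D" "(b, c) \<in> cl D" | "a \<in> K" "c \<in> K" using K by blast
      then show "(a, c) \<in> cl D \<union> K \<times> K" using cl_trans by cases blast+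
    qed
  qed
  moreover have "(D \<union> pairs N W1) \<inter> V \<times> V \<subseteq> cl D \<union> K \<times> K"
    using W1 cl_incl[of D] unfolding pairs_def by blast
  ultimately have "cl (D \<union> pairs N W1) \<subseteq> cl D \<union> K \<times> K" by (rule cl_least)
  then have eq: "cl (D \<union> pairs N W1) \<inter> ?U \<times> ?U = cl D \<inter> ?U \<times> ?U"
    using cl_mono[of D "D \<union> pairs N W1"] by blast
  have sub: "pairs N W2 \<subseteq> ?U \<times> ?U" using W2 N2 unfolding pairs_def by blast
  have "inc (D \<union> pairs N W1) (pairs N W2) = inc D (pairs N W2)"
    using inc_local[OF _ sub, of "D \<union> pairs N W1"] inc_local[OF _ sub, of D] eq by simp
  then show ?thesis by (simp add: pairs_Un inc_Un)
qed

text \<open>A class of \<open>D \<union> pairs N W\<close> serves as separator: each clique of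
  \<open>W\<close> lies inside it or avoids it, and both kinds occur.\<close>

lemma disconnected_split:
  assumes W: "\<And>p. p \<in> W \<Longrightarrow> N p \<subseteq> V"
    and dis: "\<not> \<Union>(N ` W) \<times> \<Union>(N ` W) \<subseteq> cl (D \<union> pairs N W)"
  obtains W1 W2 where "W1 \<noteq> {}" "W2 \<noteq> {}" "W1 \<inter> W2 = {}" "W1 \<union> W2 = W"
    "inc D (pairs N W) = inc D (pairs N W1) + inc D (pairs N W2)"
proof -
  let ?C = "cl (D \<union> pairs N W)"
  obtain x y p q where xy: "(x, y) \<notin> ?C" "x \<in> N p" "p \<in> W" "y \<in> N q" "q \<in> W"
    using dis by blast
  let ?K = "?C `` {x}"
  have sq: "N p' \<times> N p' \<subseteq> ?C" if "p' \<in> W" for p'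
    using that W[OF that] cl_incl[of "D \<union> pairs N W"] unfolding pairs_def by blast
  have dich: "N p' \<subseteq> ?K \<or> N p' \<inter> ?K = {}" if "p' \<in> W" for p'
    using sq[OF that] cl_trans by blast
  let ?W1 = "{p' \<in> W. N p' \<subseteq> ?K}" and ?W2 = "{p' \<in> W. \<not> N p' \<subseteq> ?K}"
  have "p \<in> ?W1" using xy sq by blast
  moreover have "q \<in> ?W2" using xy by blast
  moreover have "inc D (pairs N (?W1 \<union> ?W2)) = inc D (pairs N ?W1) + inc D (pairs N ?W2)"
  proof (rule inc_pairs_split)
    fix a b assume "(a, b) \<in> cl D"
    then have "(a, b) \<in> ?C" "(b, a) \<in> ?C" using cl_mono[of D "D \<union> pairs N W"] cl_sym by blast+
    then show "a \<in> ?K \<longleftrightarrow> b \<in> ?K" using cl_trans by blast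
  next
    show "?K \<subseteq> V" using cl_inV by blast
  qed (use dich W in blast)+
  moreover have "?W1 \<union> ?W2 = W" by blast
  ultimately show ?thesis using that[of ?W1 ?W2] by auto
qed

text \<open>The dual value in Lovasz's formula: over \<open>R\<close>, a part of rank increment
  \<open>k\<close> contains at most \<open>k div 2\<close> points of a hyperforest.\<close>

definition cost :: "('p \<Rightarrow> 'v set) \<Rightarrow> ('v \<times> 'v) set \<Rightarrow> 'p set set \<Rightarrow> nat" where
  "cost N R \<Q> = rk R + (\<Sum>W\<in>\<Q>. inc R (pairs N W) div 2)"

text \<open>Doubling avoids halving the increment. The term \<open>2 * rk R0\<close> compensates for
  \<open>cost\<close> measuring the rank of \<open>R\<close> from zero rather than from
  \<open>R0\<close>.\<close>

definition robust :: "('p \<Rightarrow> 'v set) \<Rightarrow> ('v \<times> 'v) set \<Rightarrow> 'p set \<Rightarrow> bool" where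
  "robust N R0 Q \<longleftrightarrow> even (inc R0 (pairs N Q)) \<and>
     (\<forall>R \<Q>. R0 \<subseteq> R \<longrightarrow> R \<subseteq> cl (R0 \<union> pairs N Q) \<longrightarrow> partition_on Q \<Q> \<longrightarrow>
        2 * rk R0 + inc R0 (pairs N Q) \<le> 2 * cost N R \<Q>)"

text \<open>With cliques of rank at most 2 the cardinality forces every point of \<open>M\<close> to
  add exactly 2, so \<open>M\<close> is a spanning hyperforest relative to
  \<open>R0\<close>.\<close>

definition solvable :: "('p \<Rightarrow> 'v set) \<Rightarrow> ('v \<times> 'v) set \<Rightarrow> 'p set \<Rightarrow> bool" where
  "solvable N R0 Q \<longleftrightarrow> (\<exists>M\<subseteq>Q. 2 * card M = inc R0 (pairs N Q) \<and>
     cl (R0 \<union> pairs N M) = cl (R0 \<union> pairs N Q))"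

end

text \<open>The case in which no point can be deleted; the induction hypothesis is carried along as
  the assumption \<open>IH\<close>. Among the tight pairs with at least two parts,
  \<open>(P, \<Q>)\<close> is lexicographically maximal in rank and number of parts. This is the
  source of all strict inequalities obtained for refinements.\<close>

locale tight_partition = relation_rank V
  for V :: "'v set" +
  fixes N :: "'p \<Rightarrow> 'v set" and Q :: "'p set" and R0 P :: "('v \<times> 'v) set" and \<Q> :: "'p set set"
  assumes finite_Q: "finite Q"
    and N_V: "\<And>p. p \<in> Q \<Longrightarrow> N p \<subseteq> V"
    and N_card: "\<And>p. p \<in> Q \<Longrightarrow> card (N p) \<le> 3"
    and R0_V: "R0 \<subseteq> V \<times> V"
    and robust: "robust N R0 Q"
    and IH: "\<And>W B. W \<subseteq> Q \<Longrightarrow> card W < card Q \<Longrightarrow> B \<subseteq> V \<times> V \<Longrightarrow> robust N B W \<Longrightarrow> solvable N B W"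
    and P_ge: "R0 \<subseteq> P" and P_le: "P \<subseteq> cl (R0 \<union> pairs N Q)"
    and part: "partition_on Q \<Q>" and card_ge2: "2 \<le> card \<Q>"
    and tight: "2 * cost N P \<Q> = 2 * rk R0 + inc R0 (pairs N Q)"
    and maximal: "\<And>R \<W>. R0 \<subseteq> R \<Longrightarrow> R \<subseteq> cl (R0 \<union> pairs N Q) \<Longrightarrow> partition_on Q \<W> \<Longrightarrow> 2 \<le> card \<W> \<Longrightarrow>
       2 * cost N R \<W> = 2 * rk R0 + inc R0 (pairs N Q) \<Longrightarrow>
       rk R < rk P \<or> rk R = rk P \<and> card \<W> \<le> card \<Q>"
begin

abbreviation U :: "'p set \<Rightarrow> 'v set" where "U W \<equiv> \<Union>(N ` W)"
abbreviation r :: "'p set \<Rightarrow> nat" where "r W \<equiv> inc P (pairs N W)"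
abbreviation PU :: "'p set \<Rightarrow> ('v \<times> 'v) set" where "PU W \<equiv> cl P \<inter> U W \<times> U W"
abbreviation T :: nat where "T \<equiv> rk (R0 \<union> pairs N Q)"

lemma finite_parts: "finite \<Q>"
  using part finite_Q by (metis finite_UnionD partition_onD1)

lemma part_sub: "W \<in> \<Q> \<Longrightarrow> W \<subseteq> Q"
  using part partition_onD1 by blast

lemma part_ne: "W \<in> \<Q> \<Longrightarrow> W \<noteq> {}"
  using part partition_onD3 by blast

lemma U_V: "W \<in> \<Q> \<Longrightarrow> U W \<subseteq> V"
  using part_sub N_V by blast

lemma card_part_less:
  assumes "W \<in> \<Q>"
  shows "card W < card Q"
proof -
  have "\<exists>W'\<in>\<Q>. W' \<noteq> W"
  proof (rule ccontr)
    assume "\<not> ?thesis"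
    then have "\<Q> \<subseteq> {W}" by blast
    then have "card \<Q> \<le> 1" by (metis card.empty card_mono finite.intros is_singletonI is_singleton_altdef)
    then show False using card_ge2 by simp
  qed
  then obtain W' where W': "W' \<in> \<Q>" "W' \<noteq> W" by blast
  then have "W' \<inter> W = {}" using assms part unfolding partition_on_def disjoint_def by blast
  then have "W \<subset> Q" using W' part_sub part_ne assms by blast
  then show ?thesis using finite_Q psubset_card_mono by blast
qed

lemmas refine_partition = partition_on_refine[OF part]

text \<open>Robustness is applied to the pair in which \<open>W\<close> is refined and
  \<open>P\<close> is raised to \<open>R\<close>. The terms of the other parts only decrease, so a
  local inequality remains. Equality would make the new pair tight as well, and it would beat
  \<open>(P, \<Q>)\<close> in rank or in number of parts.\<close>

lemma refine:
  assumes W: "W \<in> \<Q>" "partition_on W \<W>" and R: "P \<subseteq> R" "R \<subseteq> cl (R0 \<union> pairs N Q)"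
  shows "rk P + r W div 2 \<le> rk R + (\<Sum>X\<in>\<W>. inc R (pairs N X) div 2)"
    and "rk P < rk R \<or> 2 \<le> card \<W> \<Longrightarrow>
      rk P + r W div 2 < rk R + (\<Sum>X\<in>\<W>. inc R (pairs N X) div 2)"
proof -
  let ?s = "\<Sum>X\<in>\<W>. inc R (pairs N X) div 2" and ?\<R> = "\<Q> - {W} \<union> \<W>"
  have "finite W" using W(1) part_sub finite_Q finite_subset by blast
  then have fW: "finite \<W>" using W(2) by (metis finite_UnionD partition_onD1)
  have "(\<Sum>X\<in>?\<R>. inc R (pairs N X) div 2) = (\<Sum>X\<in>\<Q> - {W}. inc R (pairs N X) div 2) + ?s"
    by (rule sum.union_disjoint) (use refine_partition(2)[OF W] finite_parts fW in simp_all)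
  then have "cost N R ?\<R> = rk R + (\<Sum>X\<in>\<Q> - {W}. inc R (pairs N X) div 2) + ?s"
    by (simp add: cost_def)
  also have "\<dots> \<le> rk R + (\<Sum>X\<in>\<Q> - {W}. r X div 2) + ?s"
  proof -
    have "R \<subseteq> V \<times> V" using R(2) cl_sub by (rule subset_trans)
    with R(1) have "P \<subseteq> cl R" using cl_inclI by (meson subset_trans)
    then have "inc R (pairs N X) \<le> r X" for X by (rule inc_antimono)
    then have "(\<Sum>X\<in>\<Q> - {W}. inc R (pairs N X) div 2) \<le> (\<Sum>X\<in>\<Q> - {W}. r X div 2)"
      by (intro sum_mono div_le_mono)
    then show ?thesis by simp
  qed
  finally have up: "cost N R ?\<R> + rk P + r W div 2 \<le> cost N P \<Q> + rk R + ?s"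
    using W(1) finite_parts by (simp add: cost_def sum.remove[of \<Q> W])
  have R0: "R0 \<subseteq> R" using R P_ge by blast
  have pt: "partition_on Q ?\<R>" by (rule refine_partition(1)[OF W])
  have "2 * rk R0 + inc R0 (pairs N Q) \<le> 2 * cost N R ?\<R>"
    using robust R0 R(2) pt unfolding robust_def by blast
  then have lo': "cost N P \<Q> \<le> cost N R ?\<R>" using tight by simp
  show ge: "rk P + r W div 2 \<le> rk R + ?s" using up lo' by simp
  assume st: "rk P < rk R \<or> 2 \<le> card \<W>"
  show "rk P + r W div 2 < rk R + ?s"
  proof (rule ccontr)
    assume "\<not> ?thesis"
    then have "cost N R ?\<R> = cost N P \<Q>" using up lo' by simp
    then have eq: "2 * cost N R ?\<R> = 2 * rk R0 + inc R0 (pairs N Q)" using tight by simp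
    have cd: "card ?\<R> + 1 = card \<Q> + card \<W>"
      using refine_partition(2)[OF W] finite_parts fW W(1)
      by (simp add: card_Un_disjoint) (metis Suc_pred card_gt_0_iff empty_iff)
    have "W \<noteq> {}" using W(1) part_ne by blast
    then have "\<W> \<noteq> {}" using W(2) unfolding partition_on_def by blast
    then have "1 \<le> card \<W>" using fW by (simp add: Suc_leI card_gt_0_iff)
    then have "2 \<le> card ?\<R>" using cd card_ge2 by simp
    then have "rk R < rk P \<or> rk R = rk P \<and> card ?\<R> \<le> card \<Q>"
      using maximal[OF R0 R(2) pt _ eq] by simp
    moreover have "rk P \<le> rk R" by (rule rk_mono[OF R(1)])
    ultimately show False using st cd by linarith
  qed
qed

text \<open>Halving with rounding down is superadditive, so such a split would not increase the
  cost, against the strict half of \<open>refine\<close>.\<close>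

lemma not_split:
  assumes "W \<in> \<Q>" "W1 \<noteq> {}" "W2 \<noteq> {}" "W1 \<inter> W2 = {}" "W1 \<union> W2 = W"
    and "r W1 + r W2 \<le> r W"
  shows False
proof -
  have "W1 \<noteq> W2" using assms(2-4) by blast
  moreover have "partition_on W {W1, W2}"
    using assms unfolding partition_on_def disjoint_def by blast
  ultimately have "rk P + r W div 2 < rk P + (r W1 div 2 + r W2 div 2)"
    using refine(2)[OF assms(1), of "{W1, W2}" P] P_le by simp
  moreover have "r W1 div 2 + r W2 div 2 \<le> (r W1 + r W2) div 2" by linarith
  moreover have "(r W1 + r W2) div 2 \<le> r W div 2" using assms(6) by (rule div_le_mono)
  ultimately show False by linarith
qed

lemma connected_part:
  assumes "W \<in> \<Q>"
  shows "U W \<times> U W \<subseteq> cl (P \<union> pairs N W)"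
proof (rule ccontr)
  assume dis: "\<not> U W \<times> U W \<subseteq> cl (P \<union> pairs N W)"
  have "N p \<subseteq> V" if "p \<in> W" for p using that assms part_sub N_V by blast
  from disconnected_split[OF this dis] show False
    using not_split[OF assms] by (metis order_refl)
qed

lemma cl_square: "W \<in> \<Q> \<Longrightarrow> cl (P \<union> U W \<times> U W) = cl (P \<union> pairs N W)"
proof
  assume W: "W \<in> \<Q>"
  show "cl (P \<union> U W \<times> U W) \<subseteq> cl (P \<union> pairs N W)"
    by (rule cl_least[OF equiv_cl]) (use connected_part[OF W] cl_incl[of "P \<union> pairs N W"] in blast)
  show "cl (P \<union> pairs N W) \<subseteq> cl (P \<union> U W \<times> U W)"
    by (rule cl_mono) (use pairs_sub_square[of N W] in blast)
qed

lemma inc_square: "W \<in> \<Q> \<Longrightarrow> inc P (U W \<times> U W) = r W"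
  using rk_cong[OF cl_square] by (simp add: inc_def)

lemma rk_square: "W \<in> \<Q> \<Longrightarrow> rk (U W \<times> U W) = rk (PU W) + r W"
proof -
  assume W: "W \<in> \<Q>"
  have "inc (PU W) (U W \<times> U W) = r W"
    using inc_local[OF U_V[OF W] subset_refl, of P] inc_square[OF W] by simp
  moreover have "PU W \<union> U W \<times> U W = U W \<times> U W" by blast
  ultimately show ?thesis using rk_inc[of "PU W" "U W \<times> U W"] by simp
qed

lemma square_global: "W \<in> \<Q> \<Longrightarrow> U W \<times> U W \<subseteq> cl (R0 \<union> pairs N Q)"
proof -
  assume W: "W \<in> \<Q>"
  have "cl (P \<union> pairs N W) \<subseteq> cl (R0 \<union> pairs N Q)"
  proof (rule cl_minimal)
    have "pairs N W \<subseteq> pairs N Q" by (rule pairs_mono[OF part_sub[OF W]])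
    moreover have "pairs N Q \<subseteq> V \<times> V" using N_V by (auto simp: pairs_def)
    ultimately show "P \<union> pairs N W \<subseteq> cl (R0 \<union> pairs N Q)"
      using P_le cl_incl[of "R0 \<union> pairs N Q"] by blast
  qed
  then show ?thesis using connected_part[OF W] by blast
qed

text \<open>\<open>B\<close> stands for what the other parts leave behind on \<open>U W\<close>; its
  rank may differ by one from that of the trace \<open>PU W\<close>, in either direction. A
  violation of robustness over \<open>B\<close> yields a refinement of \<open>W\<close> over
  \<open>P \<union> R\<close>. With equal ranks, parity and the weak inequality in
  \<open>refine\<close> exclude it; a unit of difference is paid for, where necessary, by the strict
  inequality.\<close>

lemma local_solution:
  assumes W: "W \<in> \<Q>" and BU: "B \<subseteq> U W \<times> U W"
    and ev: "even (rk (U W \<times> U W) - rk B)"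
    and cases: "PU W \<subseteq> B \<and> rk B \<le> rk (PU W) + 1 \<or> B \<subseteq> PU W \<and> rk B + 1 = rk (PU W)"
  shows "\<exists>M\<subseteq>W. 2 * card M + rk B = rk (U W \<times> U W) \<and> U W \<times> U W \<subseteq> cl (B \<union> pairs N M)"
proof -
  let ?U2 = "U W \<times> U W"
  have UV: "U W \<subseteq> V" using U_V W by blast
  have NV: "N p \<subseteq> V" if "p \<in> W" for p using that W part_sub N_V by blast
  have pU: "pairs N W \<subseteq> ?U2" by (rule pairs_sub_square)
  have rU: "rk ?U2 = rk (PU W) + r W" by (rule rk_square[OF W])
  have incPU: "inc (PU W) (pairs N X) = r X" if "X \<subseteq> W" for X
    by (rule inc_local[OF UV, symmetric]) (use pairs_mono[OF that, of N] pU in blast)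
  have span: "?U2 \<subseteq> cl (B \<union> pairs N W)"
  proof (rule ccontr)
    assume dis: "\<not> ?thesis"
    have sp: "?U2 \<subseteq> cl (PU W \<union> pairs N W)"
      using connected_part[OF W] cl_local[OF UV pU, of P] by blast
    show False
    proof (cases "PU W \<subseteq> B")
      case True
      then show False using sp dis cl_mono[of "PU W \<union> pairs N W" "B \<union> pairs N W"] by blast
    next
      case False
      then have c: "B \<subseteq> PU W" "rk B + 1 = rk (PU W)" using cases by blast+
      obtain W1 W2 where s: "W1 \<noteq> {}" "W2 \<noteq> {}" "W1 \<inter> W2 = {}" "W1 \<union> W2 = W"
        "inc B (pairs N W) = inc B (pairs N W1) + inc B (pairs N W2)"
        using disconnected_split[OF NV dis] by blast
      have BP: "B \<subseteq> cl (PU W)" using c(1) UV cl_inclI[of "PU W"] by blast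
      have "r X \<le> inc B (pairs N X)" if "X \<subseteq> W" for X
        using inc_antimono[of B "PU W" "pairs N X"] BP incPU[OF that] by simp
      note this[of W1] this[of W2]
      \<comment> \<open>\<open>B\<close> is one unit short of \<open>PU W\<close>, and the
        disconnected \<open>W\<close> is at least one unit short of spanning \<open>?U2\<close>. The
        two defects cancel, so the halves of \<open>W\<close> would violate
        \<open>not_split\<close>.\<close>
      moreover have "rk (B \<union> pairs N W) < rk ?U2"
      proof -
        have "rk (B \<union> pairs N W) \<le> rk ?U2" by (rule rk_mono) (use BU pU in blast)
        moreover have "rk (B \<union> pairs N W) \<noteq> rk ?U2"
        proof
          assume eq: "rk (B \<union> pairs N W) = rk ?U2"
          have "(B \<union> pairs N W) \<union> ?U2 = ?U2" using BU pU by blast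
          then have "?U2 \<inter> V \<times> V \<subseteq> cl (B \<union> pairs N W)" using cl_eqI_rk[of "B \<union> pairs N W" ?U2] eq by simp
          then show False using dis UV by blast
        qed
        ultimately show ?thesis by simp
      qed
      then have "inc B (pairs N W) \<le> r W" using rU c(2) rk_inc[of B "pairs N W"] by linarith
      ultimately have "r W1 + r W2 \<le> r W" using s by auto
      then show False using not_split[OF W s(1-4)] by blast
    qed
  qed
  have clspan: "cl (B \<union> pairs N W) = cl ?U2"
  proof
    show "cl (B \<union> pairs N W) \<subseteq> cl ?U2" by (rule cl_mono) (use BU pU in blast)
    show "cl ?U2 \<subseteq> cl (B \<union> pairs N W)" by (rule cl_minimal[OF span])
  qed
  then have rkspan: "rk (B \<union> pairs N W) = rk ?U2" by (rule rk_cong)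
  then have rkU: "rk ?U2 = rk B + inc B (pairs N W)" by (simp add: rk_inc)
  have evB: "even (inc B (pairs N W))" using ev rkU by simp
  have "robust N B W"
    unfolding robust_def
  proof (intro conjI allI impI evB)
    fix R \<W> assume R: "B \<subseteq> R" "R \<subseteq> cl (B \<union> pairs N W)" and \<W>: "partition_on W \<W>"
    show "2 * rk B + inc B (pairs N W) \<le> 2 * cost N R \<W>"
    proof (rule ccontr)
      assume "\<not> ?thesis"
      then have lt: "2 * cost N R \<W> < 2 * rk B + inc B (pairs N W)" by simp
      obtain h where h: "inc B (pairs N W) = 2 * h" using evB by blast
      \<comment> \<open>Both sides of the violated inequality are even, so it fails by at least
        2.\<close>
      have "2 * cost N R \<W> + 2 \<le> rk B + rk ?U2" proof -
        have "cost N R \<W> < rk B + h" using lt unfolding h by simp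
        then show ?thesis using rkU unfolding h by simp
      qed
      then have viol: "2 * (rk R + (\<Sum>X\<in>\<W>. inc R (pairs N X) div 2)) + 2 \<le> rk B + rk ?U2"
        by (simp only: cost_def)
      let ?R = "P \<union> R"
      define s s' h where "s = (\<Sum>X\<in>\<W>. inc R (pairs N X) div 2)"
        and "s' = (\<Sum>X\<in>\<W>. inc ?R (pairs N X) div 2)" and "h = r W div 2"
      note defs = this
      have viol: "2 * rk R + 2 * s + 2 \<le> rk B + rk ?U2" using viol[folded defs] by simp
      have RV: "R \<subseteq> V \<times> V" using R(2) cl_sub by blast
      have PV: "P \<subseteq> V \<times> V" using P_le cl_sub by blast
      have ss: "s' \<le> s"
        unfolding defs by (intro sum_mono div_le_mono inc_antimono) (use RV PV cl_inclI[of ?R] in blast)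
      have "cl ?U2 \<subseteq> cl (R0 \<union> pairs N Q)" by (rule cl_minimal[OF square_global[OF W]])
      then have R': "P \<subseteq> ?R" "?R \<subseteq> cl (R0 \<union> pairs N Q)" using P_le R clspan by auto
      have "inc P R \<le> inc (PU W) R" by (rule inc_antimono) blast
      then have rkR: "rk ?R + rk (PU W) \<le> rk P + rk (R \<union> PU W)"
        using rk_inc[of P R] rk_inc[of "PU W" R] by (simp add: Un_commute)
      note ref = refine[OF W \<W> R', folded defs]
      have rdiv: "r W \<le> 2 * h + 1" unfolding defs by linarith
      show False
      proof (cases "PU W \<subseteq> B")
        case True
        then have "R \<union> PU W = R" using R by blast
        then have eq: "rk (R \<union> PU W) = rk R" by (simp only:)
        have le1: "rk B \<le> rk (PU W) + 1" using cases True rk_mono[of B "PU W"] by auto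
        have ge1: "rk (PU W) \<le> rk B" by (rule rk_mono[OF True])
        show False
        proof (cases "rk B = rk (PU W)")
          case True
          then show False using ref(1) rkR eq ss viol rU rdiv by linarith
        next
          case False
          then have B1: "rk B = rk (PU W) + 1" using le1 ge1 by simp
          \<comment> \<open>\<open>B\<close> has larger rank than \<open>PU W\<close>, so
            \<open>R\<close> leaves the closure of \<open>P\<close> and the strict inequality
            becomes available.\<close>
          have "rk P < rk ?R"
          proof (rule ccontr)
            assume "\<not> rk P < rk ?R"
            then have "rk (P \<union> R) = rk P" using rk_mono[of P ?R] by simp
            then have "R \<subseteq> cl P" using cl_eqI_rk RV by blast
            then have "B \<subseteq> PU W" using R BU by blast
            then show False using rk_mono[of B "PU W"] B1 by simp
          qed
          then show False using ref(2) rkR eq ss viol rU rdiv B1 by linarith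
        qed
      next
        case False
        then have c: "B \<subseteq> PU W" "rk B + 1 = rk (PU W)" using cases by blast+
        have "B \<subseteq> cl R" using R(1) RV cl_inclI by blast
        then have "inc R (PU W) \<le> inc B (PU W)" by (rule inc_antimono)
        moreover have "B \<union> PU W = PU W" using c by blast
        ultimately have i1: "inc R (PU W) \<le> 1" using c rk_inc[of B "PU W"] by simp
        show False
        proof (cases "inc R (PU W) = 0")
          case True
          then have "rk (R \<union> PU W) = rk R" by (simp add: rk_inc)
          then show False using ref(1) rkR ss viol rU rdiv c(2) by linarith
        next
          case False
          then have e: "rk (R \<union> PU W) = rk R + 1" using i1 by (simp add: rk_inc)
          show False
          proof (cases "2 \<le> card \<W>")
            case True
            then show False using ref(2) rkR ss viol rU rdiv c(2) e by linarith
          next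
            case False
            \<comment> \<open>A single part is not a proper refinement. Here the contradiction comes
              from ranks alone, since \<open>R\<close> together with the cliques of \<open>W\<close>
              spans \<open>?U2\<close>.\<close>
            have "finite W" using W part_sub finite_Q finite_subset by blast
            then have "finite \<W>" using \<W> by (metis finite_UnionD partition_onD1)
            moreover have "\<W> \<noteq> {}" using \<W> part_ne[OF W] unfolding partition_on_def by blast
            ultimately have "card \<W> = 1" using False by (metis One_nat_def Suc_1 Suc_leI card_gt_0_iff le_SucE le_less_linear not_less_eq_eq)
            then obtain X where "\<W> = {X}" by (auto simp: card_1_singleton_iff)
            then have "\<W> = {W}" using partition_onD1[OF \<W>] by simp
            then have "2 * rk R + 2 * (inc R (pairs N W) div 2) + 2 \<le> rk B + rk ?U2" using viol by (simp add: defs)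
            moreover have "rk (B \<union> pairs N W) \<le> rk (R \<union> pairs N W)" by (rule rk_mono) (use R in blast)
            moreover have "inc R (pairs N W) \<le> 2 * (inc R (pairs N W) div 2) + 1" by linarith
            moreover have "rk B \<le> rk R" by (rule rk_mono[OF R(1)])
            ultimately show False using rkspan rk_inc[of R "pairs N W"] by linarith
          qed
        qed
      qed
    qed
  qed
  then have "solvable N B W"
    using IH[OF part_sub[OF W] card_part_less[OF W]] BU UV by blast
  then obtain M where "M \<subseteq> W" "2 * card M = inc B (pairs N W)" "cl (B \<union> pairs N M) = cl (B \<union> pairs N W)"
    unfolding solvable_def by blast
  then show ?thesis using rkU span by (intro exI[of _ M]) auto
qed

section \<open>Even target sizes for the parts\<close>

abbreviation odd_parts :: "'p set set" where "odd_parts \<equiv> {W \<in> \<Q>. odd (r W)}"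

lemma T_eq: "T = rk R0 + inc R0 (pairs N Q)"
  by (simp add: rk_inc)

lemma pairs_Q_V: "pairs N Q \<subseteq> V \<times> V"
  using N_V by (auto simp: pairs_def)

lemma P_V: "P \<subseteq> V \<times> V"
  using P_le cl_sub by (rule subset_trans)

lemma cl_P_pairs: "cl (P \<union> pairs N Q) = cl (R0 \<union> pairs N Q)"
proof
  show "cl (P \<union> pairs N Q) \<subseteq> cl (R0 \<union> pairs N Q)"
    by (rule cl_minimal) (use P_le cl_incl[of "R0 \<union> pairs N Q"] pairs_Q_V in blast)
  show "cl (R0 \<union> pairs N Q) \<subseteq> cl (P \<union> pairs N Q)"
    by (rule cl_mono) (use P_ge in blast)
qed

text \<open>Tightness without rounding: each odd part accounts for one unit of error.\<close>

lemma sum_r: "2 * rk P + (\<Sum>W\<in>\<Q>. r W) = rk R0 + T + card odd_parts"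
proof -
  have "(\<Sum>W\<in>\<Q>. r W) = (\<Sum>W\<in>\<Q>. 2 * (r W div 2) + (if odd (r W) then 1 else 0))"
    by (rule sum.cong) (auto elim: oddE)
  also have "\<dots> = 2 * (\<Sum>W\<in>\<Q>. r W div 2) + card odd_parts"
    using finite_parts by (simp add: sum.distrib sum_distrib_left sum.If_cases Int_def)
  finally show ?thesis using tight T_eq by (simp add: cost_def)
qed

lemma rk_UN_pairs:
  assumes "\<And>W. W \<in> \<Q> \<Longrightarrow> cl (P \<union> S W) = cl (P \<union> pairs N W)" "\<J> \<subseteq> \<Q>"
  shows "cl (P \<union> (\<Union>W\<in>\<J>. S W)) = cl (P \<union> pairs N (\<Union>\<J>))"
proof
  have *: "S W \<inter> V \<times> V \<subseteq> cl (P \<union> pairs N W)" "pairs N W \<inter> V \<times> V \<subseteq> cl (P \<union> S W)" if "W \<in> \<J>" for W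
    using assms(1)[of W] that assms(2) cl_incl[of "P \<union> S W"] cl_incl[of "P \<union> pairs N W"] by blast+
  show "cl (P \<union> (\<Union>W\<in>\<J>. S W)) \<subseteq> cl (P \<union> pairs N (\<Union>\<J>))"
  proof (rule cl_least[OF equiv_cl])
    have "cl (P \<union> pairs N W) \<subseteq> cl (P \<union> pairs N (\<Union>\<J>))" if "W \<in> \<J>" for W
      by (rule cl_mono) (use that in \<open>auto simp: pairs_UN\<close>)
    then show "(P \<union> (\<Union>W\<in>\<J>. S W)) \<inter> V \<times> V \<subseteq> cl (P \<union> pairs N (\<Union>\<J>))"
      using *(1) cl_incl[of "P \<union> pairs N (\<Union>\<J>)"] by blast
  qed
  show "cl (P \<union> pairs N (\<Union>\<J>)) \<subseteq> cl (P \<union> (\<Union>W\<in>\<J>. S W))"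
  proof (rule cl_least[OF equiv_cl])
    have "cl (P \<union> S W) \<subseteq> cl (P \<union> (\<Union>W\<in>\<J>. S W))" if "W \<in> \<J>" for W
      by (rule cl_mono) (use that in blast)
    then show "(P \<union> pairs N (\<Union>\<J>)) \<inter> V \<times> V \<subseteq> cl (P \<union> (\<Union>W\<in>\<J>. S W))"
      using *(2) cl_incl[of "P \<union> (\<Union>W\<in>\<J>. S W)"] unfolding pairs_UN by blast
  qed
qed

lemma Union_parts: "\<Union>\<Q> = Q"
  using part partition_onD1 by metis

text \<open>
  Robustness of the coarsening that keeps the parts in \<open>\<J>\<close> and joins all others gives the hypothesis
  of Rado's selection principle in the construction of the target sizes.
\<close>

lemma Hall_condition:
  assumes \<J>: "\<J> \<subseteq> odd_parts"
  shows "rk R0 + T + card \<J> \<le>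
    rk (R0 \<union> (\<Union>W\<in>\<J>. PU W)) + (\<Sum>W\<in>\<J>. r W) + rk (P \<union> pairs N (\<Union>(\<Q> - \<J>)))"
proof -
  let ?R = "R0 \<union> (\<Union>W\<in>\<J>. PU W)" and ?X = "\<Union>(\<Q> - \<J>)"
  \<comment> \<open>Removing \<open>{}\<close> matters when \<open>\<J>\<close> is all of
    \<open>\<Q>\<close> and nothing is left to join.\<close>
  let ?\<R> = "\<J> \<union> ({?X} - {{}})"
  have J: "\<J> \<subseteq> \<Q>" "finite \<J>" using \<J> finite_subset[OF _ finite_parts, of \<J>] by auto
  have disj: "A \<inter> B = {}" if "A \<in> \<Q>" "B \<in> \<Q>" "A \<noteq> B" for A B
    using that partition_onD2[OF part] unfolding disjoint_def by blast
  have X: "?X \<inter> A = {}" if A: "A \<in> \<J>" for A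
  proof -
    have "B \<inter> A = {}" if "B \<in> \<Q> - \<J>" for B using disj[of B A] that A J by blast
    then show ?thesis by blast
  qed
  have part': "partition_on Q ?\<R>"
  proof (rule partition_onI)
    have "\<Union>?\<R> = \<Union>\<J> \<union> ?X" by auto
    also have "\<dots> = \<Union>\<Q>" using J by blast
    finally show "\<Union>?\<R> = Q" using Union_parts by simp
    show "disjnt A B" if "A \<in> ?\<R>" "B \<in> ?\<R>" "A \<noteq> B" for A B
      using that X disj[of A B] J unfolding disjnt_def by fast
    show "{} \<notin> ?\<R>" using J part_ne by blast
  qed
  have PX: "cl P \<subseteq> cl (P \<union> pairs N ?X)" by (rule cl_mono) blast
  have "P \<subseteq> cl P" using P_V cl_inclI by blast
  then have RP: "?R \<subseteq> cl P" using P_ge by blast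
  have "cl P \<subseteq> cl (R0 \<union> pairs N Q)" using P_le by (rule cl_minimal)
  then have "?R \<subseteq> cl (R0 \<union> pairs N Q)" using RP by blast
  then have "2 * rk R0 + inc R0 (pairs N Q) \<le> 2 * cost N ?R ?\<R>"
    using robust part' unfolding robust_def by blast
  then have 1: "rk R0 + T \<le> 2 * cost N ?R ?\<R>" using T_eq by simp
  have "(\<Sum>W\<in>?\<R>. inc ?R (pairs N W) div 2) = (\<Sum>W\<in>\<J>. inc ?R (pairs N W) div 2) + inc ?R (pairs N ?X) div 2"
  proof (cases "?X = {}")
    case True
    have "inc ?R (pairs N ?X) = 0" unfolding True by (simp add: pairs_def inc_def)
    moreover have "?\<R> = \<J>" unfolding True by simp
    ultimately show ?thesis by (simp only:)
  next
    case False
    then have "?X \<notin> \<J>" using X by blast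
    from sum.insert[OF J(2) this, of "\<lambda>W. inc ?R (pairs N W) div 2"]
    have "(\<Sum>W\<in>insert ?X \<J>. inc ?R (pairs N W) div 2) = (\<Sum>W\<in>\<J>. inc ?R (pairs N W) div 2) + inc ?R (pairs N ?X) div 2"
      by (simp only: add.commute)
    moreover have "?\<R> = insert ?X \<J>" using False by blast
    ultimately show ?thesis by (simp only:)
  qed
  then have 2: "2 * cost N ?R ?\<R> = 2 * rk ?R + (\<Sum>W\<in>\<J>. 2 * (inc ?R (pairs N W) div 2)) + 2 * (inc ?R (pairs N ?X) div 2)"
    by (simp add: cost_def sum_distrib_left)
  \<comment> \<open>Rounding loses one unit in each odd part of \<open>\<J>\<close>; these units
    make up the term \<open>card \<J>\<close>.\<close>
  have "2 * (inc ?R (pairs N W) div 2) + 1 \<le> r W" if W: "W \<in> \<J>" for W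
  proof -
    have WQ: "W \<in> \<Q>" and o: "odd (r W)" using W \<J> by auto
    have UV: "U W \<subseteq> V" by (rule U_V[OF WQ])
    have RV: "?R \<subseteq> V \<times> V" using RP cl_sub by blast
    have "inc ?R (pairs N W) \<le> inc (PU W) (pairs N W)"
      by (rule inc_antimono) (use cl_inclI[OF RV] W in blast)
    also have "\<dots> = r W"
      by (rule inc_local[OF UV pairs_sub_square, symmetric])
    finally have le: "inc ?R (pairs N W) \<le> r W" .
    obtain h where h: "r W = 2 * h + 1" using o by (rule oddE)
    have "inc ?R (pairs N W) div 2 \<le> r W div 2" using le by (rule div_le_mono)
    then show ?thesis using h by simp
  qed
  then have "(\<Sum>W\<in>\<J>. 2 * (inc ?R (pairs N W) div 2) + 1) \<le> (\<Sum>W\<in>\<J>. r W)" by (rule sum_mono)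
  then have 3: "(\<Sum>W\<in>\<J>. 2 * (inc ?R (pairs N W) div 2)) + card \<J> \<le> (\<Sum>W\<in>\<J>. r W)"
    by (simp only: sum.distrib card_eq_sum)
  have "rk (?R \<union> pairs N ?X) \<le> rk (cl (P \<union> pairs N ?X))"
  proof (rule rk_mono)
    have "pairs N ?X \<subseteq> V \<times> V"
    proof -
      have "?X \<subseteq> Q" using Union_parts by blast
      then show ?thesis using pairs_mono pairs_Q_V by blast
    qed
    then show "?R \<union> pairs N ?X \<subseteq> cl (P \<union> pairs N ?X)"
      using RP PX cl_incl[of "P \<union> pairs N ?X"] by blast
  qed
  then have "rk ?R + inc ?R (pairs N ?X) \<le> rk (P \<union> pairs N ?X)" by (simp add: rk_cl rk_inc)
  then show ?thesis using 1 2 3 by linarith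
qed

text \<open>\<open>s W\<close> is the rank that \<open>W\<close> has to supply, and
  \<open>Z W\<close> is a provisional set of pairs that supplies it. An odd part becomes even by
  taking over a pair of \<open>PU W\<close> or by dropping a pair of a basis. The two sums say that
  no rank is wasted, measured from \<open>R0\<close> and from \<open>P\<close>.\<close>

lemma target_sizes:
  obtains Z s where
    "\<And>W. W \<in> \<Q> \<Longrightarrow> Z W \<subseteq> U W \<times> U W \<and> finite (Z W) \<and> card (Z W) \<le> s W"
    "\<And>W. W \<in> \<Q> \<Longrightarrow> even (s W) \<and> (s W = r W \<or> s W + 1 = r W \<or> s W = r W + 1)"
    "rk R0 + (\<Sum>W\<in>\<Q>. s W) = T" "rk P + (\<Sum>W\<in>\<Q>. min (s W) (r W)) = T"
    "rk (R0 \<union> (\<Union>W\<in>\<Q>. Z W)) = T"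
proof -
  let ?O = odd_parts
  have "\<forall>W. \<exists>Y\<subseteq>pairs N W. finite Y \<and> card Y = r W \<and> cl (P \<union> Y) = cl (P \<union> pairs N W)"
    using rk_basis by blast
  then obtain S where S: "\<And>W. S W \<subseteq> pairs N W" "\<And>W. finite (S W)" "\<And>W. card (S W) = r W"
    "\<And>W. cl (P \<union> S W) = cl (P \<union> pairs N W)" by metis
  \<comment> \<open>The tag keeps apart equal pairs that occur in the bases of several
    parts.\<close>
  define L where "L = (SIGMA W:\<Q>. S W)"
  have finL: "finite L" using finite_parts S(2) by (simp add: L_def)
  \<comment> \<open>Choosing an \<open>Inl\<close> drops that element of the basis of
    \<open>W\<close>; choosing an \<open>Inr\<close> takes over a pair of
    \<open>PU W\<close>.\<close>
  define A where "A W = (\<lambda>e. Inl (W, e)) ` S W \<union> Inr ` PU W" for W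
  define el where "el F = {y \<in> L. Inl y \<in> F}" for F :: "('p set \<times> 'v \<times> 'v + 'v \<times> 'v) set"
  define er where "er F = {e. Inr e \<in> F}" for F :: "('p set \<times> 'v \<times> 'v + 'v \<times> 'v) set"
  \<comment> \<open>The rank of the pairs taken over, in the contraction by \<open>R0\<close>, plus
    the rank of the dropped elements in the dual of the contraction by \<open>P\<close> on
    \<open>L\<close>. The dual rank has the usual form: cardinality, plus rank of the complement,
    minus total rank.\<close>
  define f where "f F = int (rk (R0 \<union> er F)) - int (rk R0) + int (card (el F)) +
    int (rk (P \<union> snd ` (L - el F))) - int T" for F
  have sndL: "snd ` (L - Sigma \<J> S) = (\<Union>W\<in>\<Q> - \<J>. S W)" for \<J> by (force simp: L_def)
  have rkL: "rk (P \<union> (\<Union>W\<in>\<Q> - \<J>. S W)) = rk (P \<union> pairs N (\<Union>(\<Q> - \<J>)))" for \<J>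
    by (rule rk_cong[OF rk_UN_pairs]) (use S(4) in auto)
  have rkL0: "rk (P \<union> snd ` L) = T"
    using sndL[of "{}"] rkL[of "{}"] rk_cong[OF cl_P_pairs] Union_parts by simp
  have le_L: "finite (el F)" "el F \<subseteq> L" for F using finL by (auto simp: el_def)
  have "\<exists>x. (\<forall>W\<in>?O. x W \<in> A W) \<and> int (card ?O) \<le> f (x ` ?O)"
  proof (rule Rado_selection)
    show "finite ?O" using finite_parts by simp
    show "finite (A W)" if "W \<in> ?O" for W
    proof -
      have "U W \<subseteq> V" using that U_V by auto
      then have "finite (U W)" using finite_V finite_subset by blast
      then have "finite (PU W)" by simp
      then show ?thesis using S(2) by (simp add: A_def)
    qed
    show "f F \<le> f G" if FG: "F \<subseteq> G" for F G
    proof -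
      have "rk (R0 \<union> er F) \<le> rk (R0 \<union> er G)" by (rule rk_mono) (use FG in \<open>auto simp: er_def\<close>)
      moreover have sub: "el F \<subseteq> el G" using FG by (auto simp: el_def)
      have "rk (P \<union> snd ` (L - el F)) \<le> rk (P \<union> snd ` (L - el G)) + card (el G - el F)"
      proof -
        have eq: "P \<union> snd ` (L - el F) = (P \<union> snd ` (L - el G)) \<union> snd ` (el G - el F)"
          using sub le_L by blast
        have "inc (P \<union> snd ` (L - el G)) (snd ` (el G - el F)) \<le> card (snd ` (el G - el F))"
          by (rule inc_le_card) (use le_L in auto)
        also have "\<dots> \<le> card (el G - el F)" by (rule card_image_le) (use le_L in auto)
        finally show ?thesis unfolding eq rk_inc by simp
      qed
      moreover have "card (el F) + card (el G - el F) = card (el G)"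
        using card_Diff_subset[OF le_L(1) sub] card_mono[OF le_L(1) sub] by simp
      ultimately show ?thesis unfolding f_def by linarith
    qed
    show "f (F \<union> G) + f (F \<inter> G) \<le> f F + f G" for F G
    proof -
      have "rk (R0 \<union> er (F \<union> G)) + rk (R0 \<union> er (F \<inter> G)) \<le> rk (R0 \<union> er F) + rk (R0 \<union> er G)"
      proof -
        have "R0 \<union> er (F \<union> G) = (R0 \<union> er F) \<union> (R0 \<union> er G)" by (auto simp: er_def)
        then show ?thesis
          using rk_Un_Int[of "R0 \<union> er (F \<inter> G)" "R0 \<union> er F" "R0 \<union> er G"] by (auto simp: er_def)
      qed
      moreover have "rk (P \<union> snd ` (L - el (F \<inter> G))) + rk (P \<union> snd ` (L - el (F \<union> G)))
          \<le> rk (P \<union> snd ` (L - el F)) + rk (P \<union> snd ` (L - el G))"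
      proof -
        have "P \<union> snd ` (L - el (F \<inter> G)) = (P \<union> snd ` (L - el F)) \<union> (P \<union> snd ` (L - el G))"
          by (auto simp: el_def)
        moreover have "P \<union> snd ` (L - el (F \<union> G)) \<subseteq> P \<union> snd ` (L - el F)"
          "P \<union> snd ` (L - el (F \<union> G)) \<subseteq> P \<union> snd ` (L - el G)" by (auto simp: el_def)
        ultimately show ?thesis using rk_Un_Int by presburger
      qed
      moreover have "card (el (F \<union> G)) + card (el (F \<inter> G)) = card (el F) + card (el G)"
      proof -
        have "el (F \<union> G) = el F \<union> el G" "el (F \<inter> G) = el F \<inter> el G" by (auto simp: el_def)
        then show ?thesis using card_Un_Int[OF le_L(1) le_L(1), of F G] by simp
      qed
      ultimately show ?thesis unfolding f_def by linarith
    qed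
    show "f {} \<le> 0" using rkL0 by (simp add: f_def el_def er_def)
    show "int (card \<J>) \<le> f (\<Union>(A ` \<J>))" if \<J>: "\<J> \<subseteq> ?O" for \<J>
    proof -
      have J: "\<J> \<subseteq> \<Q>" "finite \<J>" using \<J> finite_subset[OF _ finite_parts, of \<J>] by auto
      have "el (\<Union>(A ` \<J>)) = Sigma \<J> S" using J by (auto simp: el_def A_def L_def)
      moreover have "card (Sigma \<J> S) = (\<Sum>W\<in>\<J>. r W)"
        using J(2) S(2) S(3) by (simp add: card_SigmaI)
      moreover have "er (\<Union>(A ` \<J>)) = (\<Union>W\<in>\<J>. PU W)" by (auto simp: er_def A_def)
      ultimately have "f (\<Union>(A ` \<J>)) = int (rk (R0 \<union> (\<Union>W\<in>\<J>. PU W))) - int (rk R0) +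
          int (\<Sum>W\<in>\<J>. r W) + int (rk (P \<union> pairs N (\<Union>(\<Q> - \<J>)))) - int T"
        unfolding f_def by (simp only: sndL rkL)
      then show ?thesis using Hall_condition[OF \<J>] by linarith
    qed
  qed
  then obtain x where xA: "\<And>W. W \<in> ?O \<Longrightarrow> x W \<in> A W" and fx: "int (card ?O) \<le> f (x ` ?O)" by blast
  define Fu where "Fu = {W \<in> ?O. \<exists>e. x W = Inr e}"
  define Cu where "Cu = {W \<in> ?O. \<exists>e. x W = Inl e}"
  have FC: "?O = Fu \<union> Cu" "Fu \<inter> Cu = {}"
  proof -
    have "W \<in> Fu \<union> Cu" if "W \<in> ?O" for W using that by (cases "x W") (auto simp: Fu_def Cu_def)
    then show "?O = Fu \<union> Cu" unfolding Fu_def Cu_def by blast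
    show "Fu \<inter> Cu = {}" unfolding Fu_def Cu_def by auto
  qed
  have fin: "finite Fu" "finite Cu" using finite_parts unfolding Fu_def Cu_def by auto
  have cO: "card ?O = card Fu + card Cu" using FC fin card_Un_disjoint by metis
  let ?F = "er (x ` ?O)" and ?C = "el (x ` ?O)"
  have Fim: "?F \<subseteq> (\<lambda>W. projr (x W)) ` Fu"
  proof
    fix e assume "e \<in> ?F"
    then obtain W where "W \<in> ?O" "Inr e = x W" unfolding er_def by blast
    then show "e \<in> (\<lambda>W. projr (x W)) ` Fu"
      by (intro image_eqI[of _ _ W]) (simp_all add: Fu_def flip: \<open>Inr e = x W\<close>)
  qed
  have finF: "finite ?F" by (rule finite_subset[OF Fim]) (use fin in simp)
  have cF: "card ?F \<le> card Fu"
    using card_mono[OF _ Fim] card_image_le[OF fin(1), of "\<lambda>W. projr (x W)"] fin by simp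
  have "?C \<subseteq> (\<lambda>W. projl (x W)) ` Cu"
  proof
    fix y assume "y \<in> ?C"
    then obtain W where W: "W \<in> ?O" "x W = Inl y" unfolding el_def by force
    then have "W \<in> Cu" unfolding Cu_def by blast
    then show "y \<in> (\<lambda>W. projl (x W)) ` Cu" using W(2) by (intro image_eqI[of _ _ W]) simp_all
  qed
  then have cC: "card ?C \<le> card Cu"
    using card_mono[of "(\<lambda>W. projl (x W)) ` Cu" ?C] card_image_le[OF fin(2), of "\<lambda>W. projl (x W)"] fin by simp
  have "?F \<subseteq> cl P"
  proof
    fix e assume "e \<in> ?F"
    then obtain W where W: "W \<in> ?O" "Inr e = x W" unfolding er_def by blast
    then have "Inr e \<in> A W" using xA[of W] by simp
    then show "e \<in> cl P" by (auto simp: A_def)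
  qed
  moreover have "P \<subseteq> cl P" using P_V cl_inclI by blast
  ultimately have FP: "R0 \<union> ?F \<subseteq> cl P" using P_ge by blast
  have f1: "rk (R0 \<union> ?F) \<le> rk R0 + card Fu" using inc_le_card[OF finF, of R0] cF by (simp add: rk_inc)
  have f2: "rk (P \<union> snd ` (L - ?C)) \<le> T"
    unfolding rkL0[symmetric] by (rule rk_mono) blast
  have "int (card Fu) + int (card Cu) \<le> f (x ` ?O)" using fx cO by simp
  \<comment> \<open>The value \<open>card ?O\<close> is the largest that so many choices allow. It
    forces the pairs taken over to be independent over \<open>R0\<close>, and the basis elements
    kept to span everything together with \<open>P\<close>.\<close>
  then have e1: "rk (R0 \<union> ?F) = rk R0 + card Fu" and e2: "card ?C = card Cu"
    and e3: "rk (P \<union> snd ` (L - ?C)) = T"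
    using f1 f2 cC unfolding f_def by linarith+
  have "card L = (\<Sum>W\<in>\<Q>. r W)" unfolding L_def using finite_parts S(2,3) by (simp add: card_SigmaI)
  then have cL: "card (L - ?C) + card Cu = (\<Sum>W\<in>\<Q>. r W)"
    using card_Diff_subset[OF le_L(1) le_L(2)] card_mono[OF finL le_L(2), of "x ` ?O"] e2 by simp
  have "T \<le> rk P + card (L - ?C)"
  proof -
    have "inc P (snd ` (L - ?C)) \<le> card (snd ` (L - ?C))" by (rule inc_le_card) (use finL in simp)
    also have "\<dots> \<le> card (L - ?C)" by (rule card_image_le) (use finL in simp)
    finally show ?thesis using e3 by (simp add: rk_inc)
  qed
  moreover have "rk (R0 \<union> ?F) \<le> rk P" using rk_mono[OF FP] by (simp add: rk_cl)
  \<comment> \<open>The kept elements must make up the rank missing from \<open>P\<close>, which by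
    \<open>sum_r\<close> bounds \<open>rk P\<close> from above. Hence \<open>R0\<close> and the
    pairs taken over already span \<open>P\<close>, and \<open>P\<close> can be discarded.\<close>
  ultimately have k: "rk P = rk R0 + card Fu" using e1 cL sum_r cO by linarith
  have "R0 \<union> ?F \<subseteq> V \<times> V" using FP cl_sub by blast
  then have clF: "cl P = cl (R0 \<union> ?F)" using cl_eq_of_rk_le[OF FP] k e1 by simp
  have rkZ: "rk (R0 \<union> ?F \<union> snd ` (L - ?C)) = T"
    using e3 rk_cong[OF cl_cl_Un[of P]] rk_cong[OF cl_cl_Un[of "R0 \<union> ?F"]] clF by metis
  define Z where "Z W = {e \<in> S W. \<not> (W \<in> ?O \<and> x W = Inl (W, e))} \<union> {e. W \<in> ?O \<and> x W = Inr e}" for W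
  define s where "s W = (if W \<in> Fu then r W + 1 else if W \<in> Cu then r W - 1 else r W)" for W
  have xC: "\<exists>e\<in>S W. x W = Inl (W, e)" if "W \<in> Cu" for W
    using that xA[of W] unfolding Cu_def A_def by auto
  have xF: "\<exists>e\<in>PU W. x W = Inr e" if "W \<in> Fu" for W
    using that xA[of W] unfolding Fu_def A_def by auto
  have ZUN: "(\<Union>W\<in>\<Q>. Z W) = ?F \<union> snd ` (L - ?C)"
  proof
    show "(\<Union>W\<in>\<Q>. Z W) \<subseteq> ?F \<union> snd ` (L - ?C)"
    proof
      fix e assume "e \<in> (\<Union>W\<in>\<Q>. Z W)"
      then obtain W where W: "W \<in> \<Q>" "e \<in> Z W" by blast
      show "e \<in> ?F \<union> snd ` (L - ?C)"
      proof (cases "W \<in> ?O \<and> x W = Inr e")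
        case True
        then have "Inr e \<in> x ` ?O" by (metis (no_types, lifting) imageI)
        then show ?thesis by (simp add: er_def)
      next
        case False
        then have e: "e \<in> S W" "\<not> (W \<in> ?O \<and> x W = Inl (W, e))" using W by (auto simp: Z_def)
        have "Inl (W, e) \<notin> x ` ?O"
        proof
          assume "Inl (W, e) \<in> x ` ?O"
          then obtain W' where W': "W' \<in> ?O" "x W' = Inl (W, e)" by auto
          then have "W' \<in> Cu" by (simp add: Cu_def)
          then have "W' = W" using xC[of W'] W'(2) by auto
          then show False using e W' by simp
        qed
        then have "(W, e) \<in> L - ?C" using e W by (simp add: L_def el_def)
        then show ?thesis by force
      qed
    qed
    show "?F \<union> snd ` (L - ?C) \<subseteq> (\<Union>W\<in>\<Q>. Z W)"
    proof
      fix e assume "e \<in> ?F \<union> snd ` (L - ?C)"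
      then consider "Inr e \<in> x ` ?O" | W where "(W, e) \<in> L - ?C" by (force simp: er_def)
      then show "e \<in> (\<Union>W\<in>\<Q>. Z W)"
      proof cases
        case 1
        then obtain W where "W \<in> ?O" "x W = Inr e" by (metis (no_types, lifting) imageE)
        then have "W \<in> \<Q>" "e \<in> Z W" by (auto simp: Z_def)
        then show ?thesis by blast
      next
        case 2
        then have "W \<in> \<Q>" "e \<in> S W" "Inl (W, e) \<notin> x ` ?O" by (auto simp: L_def el_def)
        moreover from this(3) have "\<not> (W \<in> ?O \<and> x W = Inl (W, e))" by (metis (no_types, lifting) imageI)
        ultimately have "e \<in> Z W" by (simp add: Z_def)
        then show ?thesis using \<open>W \<in> \<Q>\<close> by blast
      qed
    qed
  qed
  show ?thesis
  proof (rule that[of Z s])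
    fix W assume W: "W \<in> \<Q>"
    have rpos: "0 < r W" if "W \<in> Cu" using that odd_pos unfolding Cu_def by auto
    have sub: "S W \<subseteq> U W \<times> U W" using S(1) pairs_sub_square by blast
    consider "W \<in> Fu" | "W \<in> Cu" | "W \<notin> ?O" using FC by blast
    then show "Z W \<subseteq> U W \<times> U W \<and> finite (Z W) \<and> card (Z W) \<le> s W"
    proof cases
      case 1
      then obtain e where e: "e \<in> PU W" "x W = Inr e" using xF by blast
      then have "Z W = insert e (S W)" using 1 FC by (auto simp: Z_def)
      moreover have "card (insert e (S W)) \<le> r W + 1" using card_insert_le_m1[of "r W + 1" "S W" e] S(3) by simp
      ultimately show ?thesis using 1 e sub S(2) by (simp add: s_def)
    next
      case 2
      then obtain e where e: "e \<in> S W" "x W = Inl (W, e)" using xC by blast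
      then have "Z W = S W - {e}" using 2 FC by (auto simp: Z_def)
      moreover have "card (S W - {e}) = r W - 1" using e S(2,3) by simp
      moreover have "W \<notin> Fu" using 2 FC by blast
      ultimately show ?thesis using 2 sub S(2) by (auto simp: s_def)
    next
      case 3
      then have "Z W = S W" "W \<notin> Fu" "W \<notin> Cu" using FC by (auto simp: Z_def)
      then show ?thesis using sub S(2,3) by (simp add: s_def)
    qed
    have od: "odd (r W)" if "W \<in> Fu \<or> W \<in> Cu" using that FC by auto
    have ev: "even (r W)" if "W \<notin> Fu" "W \<notin> Cu" using that FC(1) W by auto
    show "even (s W) \<and> (s W = r W \<or> s W + 1 = r W \<or> s W = r W + 1)"
      using od ev rpos by (auto simp: s_def)
  next
    have FQ: "Fu \<subseteq> \<Q>" "Cu \<subseteq> \<Q>" unfolding Fu_def Cu_def by auto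
    have rpos: "0 < r W" if "W \<in> Cu" for W using that odd_pos unfolding Cu_def by auto
    have "(\<Sum>W\<in>\<Q>. s W) + (\<Sum>W\<in>\<Q>. if W \<in> Cu then 1 else 0) = (\<Sum>W\<in>\<Q>. r W) + (\<Sum>W\<in>\<Q>. if W \<in> Fu then 1 else 0)"
      unfolding sum.distrib[symmetric]
      by (rule sum.cong) (use FC rpos in \<open>auto simp: s_def\<close>)
    moreover have "(\<Sum>W\<in>\<Q>. min (s W) (r W)) + (\<Sum>W\<in>\<Q>. if W \<in> Cu then 1 else 0) = (\<Sum>W\<in>\<Q>. r W)"
      unfolding sum.distrib[symmetric]
      by (rule sum.cong) (use FC rpos in \<open>auto simp: s_def\<close>)
    moreover have "(\<Sum>W\<in>\<Q>. if W \<in> Cu then 1 else 0) = card Cu" "(\<Sum>W\<in>\<Q>. if W \<in> Fu then 1 else 0) = card Fu"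
      using FQ finite_parts by (simp_all add: sum.If_cases Int_absorb1)
    ultimately show "rk R0 + (\<Sum>W\<in>\<Q>. s W) = T" "rk P + (\<Sum>W\<in>\<Q>. min (s W) (r W)) = T"
      using k sum_r cO by linarith+
    show "rk (R0 \<union> (\<Union>W\<in>\<Q>. Z W)) = T" using rkZ ZUN by (simp add: Un_assoc)
  qed
qed

text \<open>The sums leave no slack. Without the set of \<open>W\<close> the others together with
  \<open>R0\<close> have rank exactly \<open>T - s W\<close>, and \<open>T - min (s W) (r W)\<close>
  once \<open>P\<close> is added. Comparing these ranks locates the trace of their closure on
  \<open>U W\<close>: it contains \<open>PU W\<close> if \<open>s W \<le> r W\<close>, and otherwise
  lies in it and is one unit smaller. These are the cases of \<open>local_solution\<close>.\<close>

lemma replace_by_pairs: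
  assumes s: "\<And>W. W \<in> \<Q> \<Longrightarrow> even (s W) \<and> (s W = r W \<or> s W + 1 = r W \<or> s W = r W + 1)"
    and sum_s: "rk R0 + (\<Sum>W\<in>\<Q>. s W) = T" and sum_min: "rk P + (\<Sum>W\<in>\<Q>. min (s W) (r W)) = T"
    and W: "W \<in> \<Q>"
    and Y: "\<And>X. X \<in> \<Q> \<Longrightarrow> Y X \<subseteq> U X \<times> U X" "\<And>X A. X \<in> \<Q> \<Longrightarrow> inc A (Y X) \<le> s X"
    and span: "rk (R0 \<union> (\<Union>X\<in>\<Q>. Y X)) = T"
  obtains M where "M \<subseteq> W" "2 * card M = s W" "rk (R0 \<union> (\<Union>X\<in>\<Q>. (Y(W := pairs N M)) X)) = T"
proof -
  let ?U2 = "U W \<times> U W"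
  let ?Y = "\<Union>X\<in>\<Q> - {W}. Y X"
  let ?D = "R0 \<union> ?Y"
  have UV: "U W \<subseteq> V" by (rule U_V[OF W])
  have "(\<Union>X\<in>\<Q>. Y X) = ?Y \<union> Y W" using W by blast
  then have DW: "rk (?D \<union> Y W) = T" using span by (simp add: Un_assoc)
  have finr: "finite (\<Q> - {W})" using finite_parts by simp
  have sums: "(\<Sum>X\<in>\<Q>. s X) = s W + (\<Sum>X\<in>\<Q> - {W}. s X)"
    "(\<Sum>X\<in>\<Q>. min (s X) (r X)) = min (s W) (r W) + (\<Sum>X\<in>\<Q> - {W}. min (s X) (r X))"
    using W finite_parts by (simp_all add: sum.remove)
  have incr: "inc A (Y X) \<le> r X" if "X \<in> \<Q>" "P \<subseteq> cl A" for X A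
  proof -
    have "inc A (Y X) \<le> inc A (U X \<times> U X)" by (rule inc_mono) (use Y(1) that in blast)
    also have "\<dots> \<le> inc P (U X \<times> U X)" by (rule inc_antimono[OF that(2)])
    finally show ?thesis using inc_square[OF that(1)] by simp
  qed
  have PclA: "P \<subseteq> cl A" if "P \<subseteq> A" for A
    using that P_V cl_mono[OF that] cl_inclI[OF P_V] by blast
  have "inc R0 ?Y \<le> (\<Sum>X\<in>\<Q> - {W}. s X)" by (rule inc_UN_le[OF finr]) (use Y(2) in blast)
  then have "rk ?D + s W \<le> T" using sum_s sums(1) rk_inc[of R0 ?Y] by linarith
  moreover have "T \<le> rk ?D + s W" using DW Y(2)[OF W, of ?D] rk_inc[of ?D "Y W"] by linarith
  ultimately have rkD: "rk ?D + s W = T" by simp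
  have "inc P ?Y \<le> (\<Sum>X\<in>\<Q> - {W}. min (s X) (r X))"
  proof (rule inc_UN_le[OF finr])
    fix X B assume "X \<in> \<Q> - {W}" "P \<subseteq> B"
    then show "inc B (Y X) \<le> min (s X) (r X)" using Y(2)[of X B] incr[of X B] PclA by simp
  qed
  moreover have "P \<union> ?D = P \<union> ?Y" using P_ge by blast
  ultimately have "rk (P \<union> ?D) + min (s W) (r W) \<le> T" using sum_min sums(2) rk_inc[of P ?Y] by simp
  moreover have "T \<le> rk (P \<union> ?D) + min (s W) (r W)"
  proof -
    have "T \<le> rk (P \<union> ?D \<union> Y W)" unfolding DW[symmetric] by (rule rk_mono) blast
    moreover have "inc (P \<union> ?D) (Y W) \<le> min (s W) (r W)" using Y(2)[OF W] incr[OF W PclA] by simp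
    ultimately show ?thesis using rk_inc[of "P \<union> ?D" "Y W"] by linarith
  qed
  ultimately have rkPD: "rk (P \<union> ?D) + min (s W) (r W) = T" by simp
  have R0T: "R0 \<subseteq> cl (R0 \<union> pairs N Q)" using P_ge P_le by blast
  have YT: "Y X \<subseteq> cl (R0 \<union> pairs N Q)" if "X \<in> \<Q>" for X
    using Y(1)[OF that] square_global[OF that] by blast
  have upT: "rk A \<le> T" if "A \<subseteq> cl (R0 \<union> pairs N Q)" for A
    using rk_mono[OF that] by (simp add: rk_cl)
  have DT: "?D \<subseteq> cl (R0 \<union> pairs N Q)" using R0T YT by blast
  have rkDU: "rk (A \<union> ?U2) = T" if "?D \<subseteq> A" "A \<subseteq> cl (R0 \<union> pairs N Q)" for A
  proof (rule antisym)
    show "rk (A \<union> ?U2) \<le> T" by (rule upT) (use that square_global[OF W] in blast)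
    show "T \<le> rk (A \<union> ?U2)" unfolding DW[symmetric] by (rule rk_mono) (use that Y(1)[OF W] in blast)
  qed
  let ?B = "cl ?D \<inter> ?U2"
  have BU: "?B \<subseteq> ?U2" by blast
  have local: "rk ?U2 = rk (cl A \<inter> ?U2) + inc A ?U2" for A
  proof -
    have "cl A \<inter> ?U2 \<union> ?U2 = ?U2" by blast
    then show ?thesis using inc_local[OF UV subset_refl, of A] rk_inc[of "cl A \<inter> ?U2" ?U2] by simp
  qed
  have "inc ?D ?U2 = s W" using rkDU[OF subset_refl DT] rkD rk_inc[of ?D ?U2] by linarith
  then have rkB: "rk ?U2 = rk ?B + s W" using local[of ?D] by simp
  have rkPU: "rk ?U2 = rk (PU W) + r W" by (rule rk_square[OF W])
  have ev: "even (rk ?U2 - rk ?B)" using rkB s[OF W] by simp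
  have "PU W \<subseteq> ?B \<and> rk ?B \<le> rk (PU W) + 1 \<or> ?B \<subseteq> PU W \<and> rk ?B + 1 = rk (PU W)"
  proof (cases "s W \<le> r W")
    case True
    then have "rk (?D \<union> P) = rk ?D" using rkPD rkD by (simp add: Un_commute)
    then have "P \<subseteq> cl ?D" using cl_eqI_rk P_V by blast
    then have "cl P \<subseteq> cl ?D" by (rule cl_minimal)
    then have "PU W \<subseteq> ?B" by blast
    moreover have "rk ?B \<le> rk (PU W) + 1" using rkB rkPU s[OF W] True by linarith
    ultimately show ?thesis by blast
  next
    case False
    then have sr: "s W = r W + 1" using s[OF W] by linarith
    let ?E = "P \<union> ?D"
    have "?E \<subseteq> cl (R0 \<union> pairs N Q)" using P_le DT by blast
    from rkDU[OF _ this] have "rk (?E \<union> ?U2) = T" by simp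
    then have "inc ?E ?U2 = r W" using rkPD sr rk_inc[of ?E ?U2] by simp
    then have eq: "rk (cl ?E \<inter> ?U2) = rk (PU W)" using local[of ?E] rkPU by simp
    have "cl P \<subseteq> cl ?E" by (rule cl_mono) blast
    then have sub: "PU W \<subseteq> cl ?E \<inter> ?U2" by blast
    have EV: "cl ?E \<inter> ?U2 \<subseteq> V \<times> V" using cl_sub by blast
    \<comment> \<open>The ranks agree, so adding \<open>?D\<close> to \<open>P\<close> creates
      nothing new on \<open>U W\<close>; therefore the trace of \<open>cl ?D\<close> lies in
      \<open>PU W\<close>.\<close>
    have "cl (cl ?E \<inter> ?U2) = cl (PU W)"
    proof (rule cl_eq_of_rk_le)
      show "PU W \<subseteq> cl (cl ?E \<inter> ?U2)" using sub cl_inclI[OF EV] by blast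
      show "PU W \<subseteq> V \<times> V" using sub EV by blast
    qed (use eq in simp)
    moreover have "cl (PU W) \<subseteq> cl (cl P)" by (rule cl_mono) blast
    moreover have "cl ?D \<subseteq> cl ?E" by (rule cl_mono) blast
    ultimately have "?B \<subseteq> PU W" using cl_inclI[OF EV] unfolding cl_idem by blast
    moreover have "rk ?B + 1 = rk (PU W)" using rkB rkPU sr by linarith
    ultimately show ?thesis by blast
  qed
  from local_solution[OF W BU ev this] obtain M where M: "M \<subseteq> W" "2 * card M + rk ?B = rk ?U2"
    "?U2 \<subseteq> cl (?B \<union> pairs N M)" by blast
  have "rk (?D \<union> pairs N M) = T"
  proof (rule antisym)
    show "rk (?D \<union> pairs N M) \<le> T"
    proof (rule upT)
      have "pairs N M \<subseteq> ?U2" using pairs_mono[OF M(1), of N] pairs_sub_square[of N W] by blast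
      then show "?D \<union> pairs N M \<subseteq> cl (R0 \<union> pairs N Q)" using DT square_global[OF W] by blast
    qed
    have "cl (?B \<union> pairs N M) \<subseteq> cl (cl ?D \<union> pairs N M)" by (rule cl_mono) blast
    then have "?U2 \<subseteq> cl (?D \<union> pairs N M)" using M(3) unfolding cl_cl_Un by blast
    then have "Y W \<subseteq> cl (?D \<union> pairs N M)" using Y(1)[OF W] by blast
    then have "cl (?D \<union> pairs N M \<union> Y W) = cl (?D \<union> pairs N M)" by (intro cl_Un_absorb) blast
    then have "rk (?D \<union> pairs N M \<union> Y W) = rk (?D \<union> pairs N M)" by (rule rk_cong)
    moreover have "T \<le> rk (?D \<union> pairs N M \<union> Y W)" unfolding DW[symmetric] by (rule rk_mono) blast
    ultimately show "T \<le> rk (?D \<union> pairs N M)" by simp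
  qed
  moreover have "(\<Union>X\<in>\<Q>. (Y(W := pairs N M)) X) = ?Y \<union> pairs N M"
    using W by (auto split: if_splits)
  ultimately have "rk (R0 \<union> (\<Union>X\<in>\<Q>. (Y(W := pairs N M)) X)) = T" by (simp only: Un_assoc)
  moreover have "2 * card M = s W" using M(2) rkB by simp
  ultimately show ?thesis using that M(1) by blast
qed

text \<open>The provisional sets are exchanged for cliques part by part while the total rank is
  kept. At the end the even targets bound the number of points from above and the rank 2 of a clique
  bounds it from below, by the same number.\<close>

lemma solvable_of_tight: "solvable N R0 Q"
proof -
  obtain Z s where
    Z: "\<And>W. W \<in> \<Q> \<Longrightarrow> Z W \<subseteq> U W \<times> U W \<and> finite (Z W) \<and> card (Z W) \<le> s W" and
    s: "\<And>W. W \<in> \<Q> \<Longrightarrow> even (s W) \<and> (s W = r W \<or> s W + 1 = r W \<or> s W = r W + 1)" and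
    sums: "rk R0 + (\<Sum>W\<in>\<Q>. s W) = T" "rk P + (\<Sum>W\<in>\<Q>. min (s W) (r W)) = T" and
    span: "rk (R0 \<union> (\<Union>W\<in>\<Q>. Z W)) = T"
    using target_sizes by blast
  have "\<exists>Y. (\<forall>W\<in>\<Q>. Y W \<subseteq> U W \<times> U W \<and> (\<forall>A. inc A (Y W) \<le> s W)) \<and>
      (\<forall>W\<in>\<D>. \<exists>M\<subseteq>W. Y W = pairs N M \<and> 2 * card M = s W) \<and> rk (R0 \<union> (\<Union>W\<in>\<Q>. Y W)) = T"
    if "finite \<D>" "\<D> \<subseteq> \<Q>" for \<D>
    using that
  proof (induction \<D> rule: finite_induct)
    case empty
    have "inc A (Z W) \<le> s W" if "W \<in> \<Q>" for A W
      using inc_le_card[of "Z W" A] Z[OF that] by linarith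
    then show ?case using Z span by (intro exI[of _ Z]) auto
  next
    case (insert W \<D>)
    then have W: "W \<in> \<Q>" by blast
    have "\<D> \<subseteq> \<Q>" using insert.prems by blast
    from insert.IH[OF this] obtain Y
      where Y0: "\<forall>X\<in>\<Q>. Y X \<subseteq> U X \<times> U X \<and> (\<forall>A. inc A (Y X) \<le> s X)"
        and Y3: "\<forall>X\<in>\<D>. \<exists>M\<subseteq>X. Y X = pairs N M \<and> 2 * card M = s X"
        and Y4: "rk (R0 \<union> (\<Union>X\<in>\<Q>. Y X)) = T" by (elim exE conjE)
    have Y: "X \<in> \<Q> \<Longrightarrow> Y X \<subseteq> U X \<times> U X" "X \<in> \<Q> \<Longrightarrow> inc A (Y X) \<le> s X" for X A
      using Y0 by blast+
    obtain M where M: "M \<subseteq> W" "2 * card M = s W" "rk (R0 \<union> (\<Union>X\<in>\<Q>. (Y(W := pairs N M)) X)) = T"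
      using replace_by_pairs[OF s sums W Y Y4] by blast
    have MQ: "M \<subseteq> Q" using M(1) part_sub[OF W] by (rule subset_trans)
    then have "N p \<subseteq> V \<and> card (N p) \<le> 3" if "p \<in> M" for p using that N_V N_card by blast
    then have "inc A (pairs N M) \<le> s W" for A
      using inc_pairs_le[OF finite_subset[OF MQ finite_Q], of N A] M(2) by simp
    moreover have "pairs N M \<subseteq> U W \<times> U W"
      using pairs_mono[OF M(1), of N] pairs_sub_square[of N W] by blast
    ultimately have "\<forall>X\<in>\<Q>. (Y(W := pairs N M)) X \<subseteq> U X \<times> U X \<and> (\<forall>A. inc A ((Y(W := pairs N M)) X) \<le> s X)"
      using Y(1,2) by simp
    moreover have "\<forall>X\<in>insert W \<D>. \<exists>M'\<subseteq>X. (Y(W := pairs N M)) X = pairs N M' \<and> 2 * card M' = s X"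
    proof
      fix X assume X: "X \<in> insert W \<D>"
      show "\<exists>M'\<subseteq>X. (Y(W := pairs N M)) X = pairs N M' \<and> 2 * card M' = s X"
      proof (cases "X = W")
        case True
        then show ?thesis using M(1,2) by auto
      next
        case False
        then show ?thesis using X Y3 by simp
      qed
    qed
    ultimately show ?case using M(3) by blast
  qed
  from this[OF finite_parts subset_refl] obtain Y where
    Y: "\<And>W. W \<in> \<Q> \<Longrightarrow> \<exists>M\<subseteq>W. Y W = pairs N M \<and> 2 * card M = s W"
    and rkY: "rk (R0 \<union> (\<Union>W\<in>\<Q>. Y W)) = T" by blast
  then obtain m where m: "\<And>W. W \<in> \<Q> \<Longrightarrow> m W \<subseteq> W" "\<And>W. W \<in> \<Q> \<Longrightarrow> Y W = pairs N (m W)"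
    "\<And>W. W \<in> \<Q> \<Longrightarrow> 2 * card (m W) = s W" by metis
  let ?M = "\<Union>W\<in>\<Q>. m W"
  have "?M \<subseteq> \<Union>\<Q>" using m(1) by blast
  then have MQ: "?M \<subseteq> Q" using Union_parts by simp
  have pM: "(\<Union>W\<in>\<Q>. Y W) = pairs N ?M" using m(2) by (auto simp: pairs_def)
  have "2 * card ?M \<le> 2 * (\<Sum>W\<in>\<Q>. card (m W))"
    using card_UN_le[OF finite_parts, of m] by simp
  also have "\<dots> = (\<Sum>W\<in>\<Q>. s W)" using m(3) by (simp add: sum_distrib_left)
  finally have up: "2 * card ?M \<le> inc R0 (pairs N Q)" using sums(1) T_eq by simp
  have "N p \<subseteq> V \<and> card (N p) \<le> 3" if "p \<in> ?M" for p using that MQ N_V N_card by blast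
  then have "inc R0 (pairs N ?M) \<le> 2 * card ?M" by (rule inc_pairs_le[OF finite_subset[OF MQ finite_Q]])
  moreover have rkM: "rk (R0 \<union> pairs N ?M) = T" using rkY pM by simp
  ultimately have "2 * card ?M = inc R0 (pairs N Q)"
    using up T_eq rk_inc[of R0 "pairs N ?M"] by linarith
  moreover have "cl (R0 \<union> pairs N ?M) = cl (R0 \<union> pairs N Q)"
  proof (rule cl_eq_of_rk_le[symmetric])
    have "pairs N ?M \<subseteq> pairs N Q" by (rule pairs_mono[OF MQ])
    then show "R0 \<union> pairs N ?M \<subseteq> cl (R0 \<union> pairs N Q)" "R0 \<union> pairs N ?M \<subseteq> V \<times> V"
      using R0_V pairs_Q_V cl_inclI[of "R0 \<union> pairs N Q"] by blast+
  qed (use rkM in simp)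
  ultimately show ?thesis unfolding solvable_def using MQ by blast
qed

end

section \<open>Sufficiency in the min-max theorem\<close>

context relation_rank begin

text \<open>If deleting \<open>p\<close> breaks the inequality, restoring the part
  \<open>{p}\<close> repairs it although it adds at most 1 to the cost. So the violating pair misses
  by exactly one unit and becomes tight when \<open>{p}\<close> is restored.\<close>

theorem robust_imp_solvable:
  fixes N :: "'p \<Rightarrow> 'v set"
  assumes "finite Q" "\<And>p. p \<in> Q \<Longrightarrow> N p \<subseteq> V" "\<And>p. p \<in> Q \<Longrightarrow> card (N p) \<le> 3"
    and "R0 \<subseteq> V \<times> V" "robust N R0 Q"
  shows "solvable N R0 Q"
  using assms
proof (induction "card Q" arbitrary: Q R0 rule: less_induct)
  case less
  note finQ = less.prems(1) and N_V = less.prems(2) and N_card = less.prems(3)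
    and R0_V = less.prems(4) and rob = less.prems(5)
  let ?\<rho> = "inc R0 (pairs N Q)"
  have even: "even ?\<rho>" using rob by (simp add: robust_def)
  have pQV: "pairs N Q \<subseteq> V \<times> V" using N_V by (auto simp: pairs_def)
  have IH: "solvable N B W" if "W \<subseteq> Q" "card W < card Q" "B \<subseteq> V \<times> V" "robust N B W" for W B
    using less.hyps[OF that(2) _ _ _ that(3,4)] that(1) finQ finite_subset N_V N_card by blast
  show ?case
  proof (cases "\<exists>p\<in>Q. \<forall>R \<W>. R0 \<subseteq> R \<longrightarrow> R \<subseteq> cl (R0 \<union> pairs N (Q - {p})) \<longrightarrow>
      partition_on (Q - {p}) \<W> \<longrightarrow> 2 * rk R0 + ?\<rho> \<le> 2 * cost N R \<W>")
    case True
    then obtain p where p: "p \<in> Q" and del: "\<And>R \<W>. R0 \<subseteq> R \<Longrightarrow> R \<subseteq> cl (R0 \<union> pairs N (Q - {p})) \<Longrightarrow>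
      partition_on (Q - {p}) \<W> \<Longrightarrow> 2 * rk R0 + ?\<rho> \<le> 2 * cost N R \<W>" by blast
    let ?Q = "Q - {p}"
    have R0cl: "R0 \<subseteq> cl (R0 \<union> pairs N ?Q)"
      using R0_V cl_inclI[OF R0_V] cl_mono[of R0 "R0 \<union> pairs N ?Q"] by blast
    have le: "inc R0 (pairs N ?Q) \<le> ?\<rho>" by (intro inc_mono pairs_mono) blast
    \<comment> \<open>The required value is still that of \<open>Q\<close>. The trivial partition
      over \<open>R0\<close> therefore shows that deleting \<open>p\<close> loses no rank.\<close>
    have "?\<rho> \<le> 2 * (inc R0 (pairs N ?Q) div 2)"
    proof (cases "?Q = {}")
      case True
      have "partition_on ?Q {}" unfolding True by (simp add: partition_on_empty)
      from del[OF subset_refl R0cl this] show ?thesis by (simp add: cost_def)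
    next
      case False
      then show ?thesis
        using del[OF subset_refl R0cl partition_on_space[OF False]] by (simp add: cost_def)
    qed
    then have eq: "inc R0 (pairs N ?Q) = ?\<rho>" using le by linarith
    have "robust N R0 ?Q" unfolding robust_def eq using even del by blast
    moreover have "card ?Q < card Q" using p finQ by (metis card_Diff1_less)
    ultimately have "solvable N R0 ?Q" using IH R0_V by blast
    then obtain M where M: "M \<subseteq> ?Q" "2 * card M = ?\<rho>" "cl (R0 \<union> pairs N M) = cl (R0 \<union> pairs N ?Q)"
      unfolding solvable_def eq by blast
    have "cl (R0 \<union> pairs N ?Q) = cl (R0 \<union> pairs N Q)"
    proof (rule cl_eq_of_rk_le[symmetric])
      have "pairs N ?Q \<subseteq> pairs N Q" by (rule pairs_mono) blast
      then show "R0 \<union> pairs N ?Q \<subseteq> cl (R0 \<union> pairs N Q)" "R0 \<union> pairs N ?Q \<subseteq> V \<times> V"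
        using R0_V pQV cl_inclI[of "R0 \<union> pairs N Q"] by blast+
      show "rk (R0 \<union> pairs N Q) \<le> rk (R0 \<union> pairs N ?Q)" using eq by (simp add: rk_inc)
    qed
    then show ?thesis unfolding solvable_def using M by blast
  next
    case False
    show ?thesis
    proof (cases "Q = {}")
      case True
      then show ?thesis by (auto simp: solvable_def pairs_def inc_def)
    next
      case ne: False
      then obtain p where p: "p \<in> Q" by blast
      let ?Q = "Q - {p}"
      obtain R \<W> where R: "R0 \<subseteq> R" "R \<subseteq> cl (R0 \<union> pairs N ?Q)" "partition_on ?Q \<W>"
        and lt: "2 * cost N R \<W> < 2 * rk R0 + ?\<rho>" using False p by (meson not_le)
      have fW: "finite \<W>" using R(3) finQ by (metis finite_Diff finite_UnionD partition_onD1)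
      have clsub: "cl (R0 \<union> pairs N ?Q) \<subseteq> cl (R0 \<union> pairs N Q)"
        by (intro cl_mono Un_mono pairs_mono) auto
      have RQ: "R \<subseteq> cl (R0 \<union> pairs N Q)" using R(2) clsub by blast
      have pW: "{p} \<notin> \<W>" using partition_onD1[OF R(3)] by blast
      have pt: "partition_on Q (insert {p} \<W>)"
      proof -
        have "disjnt {p} (\<Union>\<W>)" unfolding partition_onD1[OF R(3), symmetric] by simp
        then show ?thesis using partition_on_insert[of "{p}" \<W> Q] R(3) p by simp
      qed
      have c: "cost N R (insert {p} \<W>) = cost N R \<W> + inc R (pairs N {p}) div 2"
        using fW pW by (simp add: cost_def)
      have i2: "inc R (pairs N {p}) \<le> 2" using inc_pairs_le[of "{p}" N R] N_V[OF p] N_card[OF p] by simp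
      have le: "2 * rk R0 + ?\<rho> \<le> 2 * cost N R (insert {p} \<W>)"
        using rob R(1) RQ pt unfolding robust_def by blast
      have tight: "2 * cost N R (insert {p} \<W>) = 2 * rk R0 + ?\<rho>"
        and ip: "inc R (pairs N {p}) = 2"
      proof -
        obtain h where h: "?\<rho> = 2 * h" using even by blast
        have 1: "cost N R \<W> < rk R0 + h" using lt h by simp
        have 2: "rk R0 + h \<le> cost N R \<W> + inc R (pairs N {p}) div 2" using le c h by simp
        have "1 \<le> inc R (pairs N {p}) div 2" using 1 2 by linarith
        then show 3: "inc R (pairs N {p}) = 2" using i2 by linarith
        show "2 * cost N R (insert {p} \<W>) = 2 * rk R0 + ?\<rho>" using 1 2 3 c h by simp
      qed
      \<comment> \<open>For \<open>Q = {p}\<close> the tight partition has a single part, and the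
        point \<open>p\<close> itself is the solution.\<close>
      show ?thesis
      proof (cases "?Q = {}")
        case True
        then have Q: "Q = {p}" using p by blast
        have "2 \<le> ?\<rho>"
        proof -
          have "inc R (pairs N {p}) \<le> inc R0 (pairs N {p})"
          proof (rule inc_antimono)
            have "R \<subseteq> V \<times> V" using RQ cl_sub by blast
            then show "R0 \<subseteq> cl R" using R(1) cl_inclI by blast
          qed
          then show ?thesis using ip Q by simp
        qed
        moreover have "?\<rho> \<le> 2" using inc_pairs_le[of "{p}" N R0] N_V[OF p] N_card[OF p] Q by simp
        ultimately show ?thesis unfolding solvable_def using Q by (intro exI[of _ "{p}"]) simp
      next
        case neQ: False
        have "\<W> \<noteq> {}" using partition_onD1[OF R(3)] neQ by blast
        then have card2: "2 \<le> card (insert {p} \<W>)"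
          using fW pW by (simp add: Suc_leI card_gt_0_iff)
        define good where "good = (\<lambda>(R, \<W>). R0 \<subseteq> R \<and> R \<subseteq> cl (R0 \<union> pairs N Q) \<and>
          partition_on Q \<W> \<and> 2 \<le> card \<W> \<and> 2 * cost N R \<W> = 2 * rk R0 + ?\<rho>)"
        \<comment> \<open>A partition of \<open>Q\<close> has at most \<open>card (Pow Q)\<close>
          parts, so \<open>\<mu>\<close> encodes the lexicographic order by rank and number of
          parts.\<close>
        define \<mu> where "\<mu> = (\<lambda>(R, \<W>). rk R * (card (Pow Q) + 1) + card (\<W> :: 'p set set))"
        have good0: "good (R, insert {p} \<W>)" using R(1) RQ pt card2 tight by (simp add: good_def)
        have card_le: "card \<W> \<le> card (Pow Q)" if "partition_on Q \<W>" for \<W>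
          by (rule card_mono) (use finQ partition_onD1[OF that] in auto)
        have "\<exists>x. good x \<and> (\<forall>y. good y \<longrightarrow> \<mu> y \<le> \<mu> x)"
        proof (rule Lattices_Big.ex_has_greatest_nat[where P = good and f = \<mu>
              and b = "card V * (card (Pow Q) + 1) + card (Pow Q) + 1", OF good0], intro allI impI)
          fix x assume "good x"
          then obtain R' \<W>' where x: "x = (R', \<W>')" "partition_on Q \<W>'" by (cases x) (auto simp: good_def)
          have "rk R' \<le> card V" using rk_eq[of R'] by linarith
          then have "rk R' * (card (Pow Q) + 1) \<le> card V * (card (Pow Q) + 1)" by (rule mult_le_mono1)
          moreover have "\<mu> x = rk R' * (card (Pow Q) + 1) + card \<W>'" by (simp add: \<mu>_def x(1))
          ultimately show "\<mu> x < card V * (card (Pow Q) + 1) + card (Pow Q) + 1"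
            using card_le[OF x(2)] by linarith
        qed
        then obtain P \<P> where g: "good (P, \<P>)" and mx: "\<And>R' \<W>'. good (R', \<W>') \<Longrightarrow> \<mu> (R', \<W>') \<le> \<mu> (P, \<P>)"
          by (metis surj_pair)
        have "tight_partition V N Q R0 P \<P>"
        proof (unfold_locales)
          show "2 \<le> card \<P>" "partition_on Q \<P>" "R0 \<subseteq> P" "P \<subseteq> cl (R0 \<union> pairs N Q)"
            "2 * cost N P \<P> = 2 * rk R0 + ?\<rho>"
            using g by (simp_all add: good_def)
          show "rk R' < rk P \<or> rk R' = rk P \<and> card \<W>' \<le> card \<P>"
            if "R0 \<subseteq> R'" "R' \<subseteq> cl (R0 \<union> pairs N Q)" "partition_on Q \<W>'" "2 \<le> card \<W>'"
              "2 * cost N R' \<W>' = 2 * rk R0 + ?\<rho>" for R' \<W>'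
          proof -
            have "\<mu> (R', \<W>') \<le> \<mu> (P, \<P>)" by (rule mx) (use that in \<open>simp add: good_def\<close>)
            then have le: "rk R' * (card (Pow Q) + 1) + card \<W>' \<le> rk P * (card (Pow Q) + 1) + card \<P>"
              unfolding \<mu>_def by (simp only: split_conv)
            have cP: "card \<P> \<le> card (Pow Q)" using card_le g by (simp add: good_def)
            have "\<not> rk P < rk R'"
            proof
              assume "rk P < rk R'"
              then have "(rk P + 1) * (card (Pow Q) + 1) \<le> rk R' * (card (Pow Q) + 1)" by (intro mult_le_mono1) simp
              then have "rk P * (card (Pow Q) + 1) + card (Pow Q) + 1 \<le> rk R' * (card (Pow Q) + 1)" by simp
              moreover have "y \<le> x + a \<Longrightarrow> a \<le> b \<Longrightarrow> \<not> x + b + 1 \<le> y" for x y a b :: nat by simp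
              ultimately show False using add_leD1[OF le] cP by blast
            qed
            then show ?thesis using le by (metis add_le_cancel_left linorder_neqE_nat)
          qed
          show "solvable N B W" if "W \<subseteq> Q" "card W < card Q" "B \<subseteq> V \<times> V" "robust N B W" for W B
            by (rule IH[OF that])
        qed (use finQ N_V N_card R0_V rob in auto)
        then show ?thesis by (rule tight_partition.solvable_of_tight)
      qed
    qed
  qed
qed

text \<open>Splitting a disconnected part splits its increment additively, and rounding down keeps
  the cost from growing. So a partition with the largest number of parts among those of bounded cost
  has only connected parts.\<close>

lemma connected_refinement:
  assumes Q: "finite Q" "\<And>p. p \<in> Q \<Longrightarrow> N p \<subseteq> V" and part: "partition_on Q \<Q>"
  shows "\<exists>\<W>. partition_on Q \<W> \<and> cost N R \<W> \<le> cost N R \<Q> \<and>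
    (\<forall>W\<in>\<W>. \<Union>(N ` W) \<times> \<Union>(N ` W) \<subseteq> cl (R \<union> pairs N W))"
proof -
  let ?P = "\<lambda>\<W>. partition_on Q \<W> \<and> cost N R \<W> \<le> cost N R \<Q>"
  have fin: "finite \<W>" and card_le: "card \<W> \<le> card (Pow Q)" if "partition_on Q \<W>" for \<W>
  proof -
    have sub: "\<W> \<subseteq> Pow Q" using partition_onD1[OF that] by blast
    show "finite \<W>" using sub Q(1) by (meson finite_Pow_iff finite_subset)
    show "card \<W> \<le> card (Pow Q)" using sub Q(1) by (intro card_mono) auto
  qed
  have "\<exists>\<W>. ?P \<W> \<and> (\<forall>\<W>'. ?P \<W>' \<longrightarrow> card \<W>' \<le> card \<W>)"
    by (rule Lattices_Big.ex_has_greatest_nat[where b = "card (Pow Q) + 1" and k = \<Q>])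
      (use part card_le in \<open>auto simp: less_Suc_eq_le\<close>)
  then obtain \<W> where \<W>: "partition_on Q \<W>" "cost N R \<W> \<le> cost N R \<Q>"
    and mx: "\<And>\<W>'. partition_on Q \<W>' \<Longrightarrow> cost N R \<W>' \<le> cost N R \<Q> \<Longrightarrow> card \<W>' \<le> card \<W>" by blast
  have "\<Union>(N ` W) \<times> \<Union>(N ` W) \<subseteq> cl (R \<union> pairs N W)" if W: "W \<in> \<W>" for W
  proof (rule ccontr)
    assume dis: "\<not> ?thesis"
    have "W \<subseteq> Q" using partition_onD1[OF \<W>(1)] W by blast
    then have NV: "N p \<subseteq> V" if "p \<in> W" for p using that Q(2) by blast
    obtain W1 W2 where s: "W1 \<noteq> {}" "W2 \<noteq> {}" "W1 \<inter> W2 = {}" "W1 \<union> W2 = W"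
      "inc R (pairs N W) = inc R (pairs N W1) + inc R (pairs N W2)"
      using disconnected_split[OF NV dis] by blast
    have W12: "W1 \<noteq> W2" using s by blast
    have "partition_on W {W1, W2}" using s(1-4) unfolding partition_on_def disjoint_def by blast
    note ref = partition_on_refine[OF \<W>(1) W this]
    let ?\<R> = "\<W> - {W} \<union> {W1, W2}"
    have fW: "finite \<W>" by (rule fin[OF \<W>(1)])
    have "cost N R ?\<R> = rk R + ((\<Sum>X\<in>\<W> - {W}. inc R (pairs N X) div 2) + (inc R (pairs N W1) div 2 + inc R (pairs N W2) div 2))"
    proof -
      have "(\<Sum>X\<in>?\<R>. inc R (pairs N X) div 2) = (\<Sum>X\<in>\<W> - {W}. inc R (pairs N X) div 2) + (\<Sum>X\<in>{W1, W2}. inc R (pairs N X) div 2)"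
        by (rule sum.union_disjoint) (use fW ref(2) in simp_all)
      then show ?thesis using W12 by (simp add: cost_def)
    qed
    also have "\<dots> \<le> rk R + ((\<Sum>X\<in>\<W> - {W}. inc R (pairs N X) div 2) + inc R (pairs N W) div 2)"
      using s(5) by simp
    also have "\<dots> = cost N R \<W>" using fW W by (simp add: cost_def sum.remove[of \<W> W])
    finally have "card ?\<R> \<le> card \<W>" using mx[OF ref(1)] \<W>(2) by simp
    moreover have "card ?\<R> = card (\<W> - {W}) + 2"
      using card_Un_disjoint[of "\<W> - {W}" "{W1, W2}"] ref(2) fW W12 by simp
    moreover have "card (\<W> - {W}) + 1 = card \<W>" using W fW by (metis Suc_eq_plus1 card_Suc_Diff1)
    ultimately show False by simp
  qed
  then show ?thesis using \<W> by blast
qed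

end

section \<open>Spanning hypertrees of small linear cubic hypergraphs\<close>

locale linear_cubic_hypergraph = relation_rank V
  for V :: "'v set" +
  fixes N :: "'p \<Rightarrow> 'v set" and Q :: "'p set"
  assumes finite_Q: "finite Q" and card_Q: "card Q = card V"
    and N_V: "\<And>p. p \<in> Q \<Longrightarrow> N p \<subseteq> V" and N_card: "\<And>p. p \<in> Q \<Longrightarrow> card (N p) = 3"
    and degree: "\<And>x. x \<in> V \<Longrightarrow> card {p \<in> Q. x \<in> N p} = 3"
    and linear: "\<And>p q. p \<in> Q \<Longrightarrow> q \<in> Q \<Longrightarrow> p \<noteq> q \<Longrightarrow> card (N p \<inter> N q) \<le> 1"
    and connected: "cl (pairs N Q) = V \<times> V"
    and odd_V: "odd (card V)" and V_ge: "7 \<le> card V" and V_le: "card V \<le> 19"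
begin

abbreviation deg :: "'p set \<Rightarrow> 'v \<Rightarrow> nat" where
  "deg W x \<equiv> card {p \<in> W. x \<in> N p}"

lemma finite_N: "p \<in> Q \<Longrightarrow> finite (N p)"
  using N_V finite_V finite_subset by blast

lemma deg_le: "W \<subseteq> Q \<Longrightarrow> x \<in> V \<Longrightarrow> deg W x \<le> 3"
  using card_mono[of "{p \<in> Q. x \<in> N p}" "{p \<in> W. x \<in> N p}"] finite_Q degree[of x] by auto

lemma deg_eq_3D:
  assumes "W \<subseteq> Q" "x \<in> V" "deg W x = 3"
  shows "{p \<in> W. x \<in> N p} = {p \<in> Q. x \<in> N p}"
  using assms degree[of x] finite_Q by (intro card_subset_eq) auto

text \<open>By linearity the hyperedges at \<open>x\<close> meet only in \<open>x\<close>. In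
  particular a vertex of degree 3 has six neighbours, which bounds the size of its group from
  below.\<close>

lemma card_neighbours:
  assumes W: "W \<subseteq> Q" and x: "x \<in> V"
  shows "card (\<Union>(N ` {p \<in> W. x \<in> N p}) - {x}) = 2 * deg W x"
proof -
  let ?I = "{p \<in> W. x \<in> N p}"
  have fin: "finite ?I" by (rule finite_subset[OF _ finite_Q]) (use W in blast)
  have "\<Union>(N ` ?I) - {x} = (\<Union>p\<in>?I. N p - {x})" by blast
  also have "card \<dots> = (\<Sum>p\<in>?I. card (N p - {x}))"
  proof (rule card_UN_disjoint[OF fin])
    show "\<forall>p\<in>?I. finite (N p - {x})" using W finite_N by auto
    show "\<forall>p\<in>?I. \<forall>q\<in>?I. p \<noteq> q \<longrightarrow> (N p - {x}) \<inter> (N q - {x}) = {}"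
    proof (intro ballI impI)
      fix p q assume pq: "p \<in> ?I" "q \<in> ?I" "p \<noteq> q"
      show "(N p - {x}) \<inter> (N q - {x}) = {}"
      proof (rule ccontr)
        assume "\<not> ?thesis"
        then obtain y where y: "y \<noteq> x" "y \<in> N p" "y \<in> N q" by blast
        have "finite (N p \<inter> N q)" using pq W finite_N by auto
        then have "card {x, y} \<le> card (N p \<inter> N q)" using pq y by (intro card_mono) auto
        moreover have "card (N p \<inter> N q) \<le> 1" using pq W by (intro linear) auto
        ultimately show False using y by simp
      qed
    qed
  qed
  also have "\<dots> = (\<Sum>p\<in>?I. 2)"
  proof (rule sum.cong[OF refl])
    fix p assume "p \<in> ?I"
    then show "card (N p - {x}) = 2" using N_card[of p] finite_N[of p] W by (auto simp: card_Diff_singleton)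
  qed
  finally show ?thesis by simp
qed

lemma sum_flags:
  fixes g :: "'p \<Rightarrow> 'v \<Rightarrow> 'c :: comm_monoid_add"
  assumes W: "W \<subseteq> Q" and X: "finite X" "\<And>p. p \<in> W \<Longrightarrow> N p \<subseteq> X"
  shows "(\<Sum>p\<in>W. \<Sum>x\<in>N p. g p x) = (\<Sum>x\<in>X. \<Sum>p\<in>{p \<in> W. x \<in> N p}. g p x)"
proof -
  have fW: "finite W" using W finite_Q finite_subset by blast
  have "(\<Sum>p\<in>W. \<Sum>x\<in>N p. g p x) = (\<Sum>p\<in>W. \<Sum>x\<in>{x \<in> X. x \<in> N p}. g p x)"
    by (rule sum.cong[OF refl], rule sum.cong) (use X(2) in auto)
  also have "\<dots> = (\<Sum>x\<in>X. \<Sum>p\<in>{p \<in> W. x \<in> N p}. g p x)"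
    by (rule sum.swap_restrict[OF fW X(1)])
  finally show ?thesis .
qed

lemma sum_deg:
  assumes W: "W \<subseteq> Q"
  shows "(\<Sum>x\<in>\<Union>(N ` W). deg W x) = 3 * card W"
proof -
  have "\<Union>(N ` W) \<subseteq> V" using W N_V by blast
  then have fU: "finite (\<Union>(N ` W))" using finite_V finite_subset by blast
  have "(\<Sum>x\<in>\<Union>(N ` W). \<Sum>p\<in>{p \<in> W. x \<in> N p}. 1) = (\<Sum>p\<in>W. \<Sum>x\<in>N p. 1::nat)"
    by (rule sum_flags[OF W fU, symmetric]) blast
  also have "\<dots> = (\<Sum>p\<in>W. 3)" by (rule sum.cong) (use W N_card in auto)
  finally show ?thesis by simp
qed

text \<open>Full degree leaves no hyperedge that joins a vertex of \<open>W\<close> to the outside,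
  so connectedness leaves no outside.\<close>

lemma closed_imp_all:
  assumes W: "W \<subseteq> Q" "W \<noteq> {}" and full: "\<And>x. x \<in> \<Union>(N ` W) \<Longrightarrow> deg W x = 3"
  shows "\<Union>(N ` W) = V"
proof
  let ?U = "\<Union>(N ` W)"
  show UV: "?U \<subseteq> V" using W N_V by blast
  have mem: "p \<in> W" if "p \<in> Q" "x \<in> N p" "x \<in> ?U" for p x
  proof -
    have "{p \<in> W. x \<in> N p} = {p \<in> Q. x \<in> N p}" using that UV by (intro deg_eq_3D W full) auto
    then show ?thesis using that by blast
  qed
  have "equiv V (?U \<times> ?U \<union> (V - ?U) \<times> (V - ?U))"
    using UV by (auto simp: equiv_def refl_on_def sym_def trans_def)
  moreover have "pairs N Q \<inter> V \<times> V \<subseteq> ?U \<times> ?U \<union> (V - ?U) \<times> (V - ?U)"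
    using mem unfolding pairs_def by blast
  ultimately have sub: "V \<times> V \<subseteq> ?U \<times> ?U \<union> (V - ?U) \<times> (V - ?U)"
    using cl_least unfolding connected[symmetric] by blast
  obtain p where p: "p \<in> W" using W by blast
  then have "card (N p) = 3" using W N_card by blast
  then obtain x where "x \<in> N p" by fastforce
  then have "x \<in> ?U" "x \<in> V" using p UV by blast+
  then show "V \<subseteq> ?U" using sub by blast
qed

section \<open>A weighting of the flags\<close>

definition class_card :: "('v \<times> 'v) set \<Rightarrow> 'v \<Rightarrow> nat" where
  "class_card R x = card (cl R `` {x})"

text \<open>
  The bonus moves weight, within a class of two vertices of a common edge \<open>p\<close>, from the two flags
  of \<open>p\<close> to the other four flags. Without it the bound on the weight of a group fails for the
  group \<open>{p}\<close>.
\<close>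

definition bonus :: "('v \<times> 'v) set \<Rightarrow> 'p \<Rightarrow> 'v \<Rightarrow> real" where
  "bonus R p x =
    (if class_card R x = 2 \<and> (\<exists>q\<in>Q. cl R `` {x} \<subseteq> N q)
     then if cl R `` {x} \<subseteq> N p then -2 else 1 else 0)"

text \<open>14 is a third of 42: over the three flags at each vertex of a class the quotients add up
  to 42 for the whole class, and the bonus cancels at each vertex.\<close>

definition weight :: "('v \<times> 'v) set \<Rightarrow> 'p \<Rightarrow> 'v \<Rightarrow> real" where
  "weight R p x = 14 / real (class_card R x) + bonus R p x"

lemma finite_class: "finite (cl R `` {x})"
proof -
  have "cl R `` {x} \<subseteq> V" using cl_sub by blast
  then show ?thesis using finite_V finite_subset by blast
qed

lemma class_card_pos: "x \<in> V \<Longrightarrow> 0 < class_card R x"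
  using finite_class[of R x] cl_refl[of x R] by (auto simp: class_card_def card_gt_0_iff)

lemma class_card_1: "x \<in> V \<Longrightarrow> class_card R x = 1 \<Longrightarrow> cl R `` {x} = {x}"
  using cl_refl[of x R] by (metis ImageI card_1_singletonE class_card_def singletonD singletonI)

text \<open>Linearity makes the hyperedge containing a two-element class unique, so the three flags
  at \<open>x\<close> receive -2, 1 and 1.\<close>

lemma sum_bonus:
  assumes x: "x \<in> V"
  shows "(\<Sum>p\<in>{p \<in> Q. x \<in> N p}. bonus R p x) = 0"
proof (cases "class_card R x = 2 \<and> (\<exists>q\<in>Q. cl R `` {x} \<subseteq> N q)")
  case False
  then show ?thesis by (auto simp: bonus_def intro!: sum.neutral)
next
  case True
  then obtain q where q: "q \<in> Q" "cl R `` {x} \<subseteq> N q" and c2: "card (cl R `` {x}) = 2"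
    by (auto simp: class_card_def)
  have uniq: "p = q" if "p \<in> Q" "cl R `` {x} \<subseteq> N p" for p
  proof (rule ccontr)
    assume "p \<noteq> q"
    then have "card (N p \<inter> N q) \<le> 1" using linear that q by blast
    moreover have "card (cl R `` {x}) \<le> card (N p \<inter> N q)"
      using that q finite_N by (intro card_mono) auto
    ultimately show False using c2 by simp
  qed
  let ?I = "{p \<in> Q. x \<in> N p}"
  have xq: "x \<in> N q" using q cl_refl[OF x] by blast
  have "(\<Sum>p\<in>?I. bonus R p x) = (\<Sum>p\<in>?I. if p = q then -2 else 1)"
  proof (rule sum.cong[OF refl])
    fix p assume "p \<in> ?I"
    then have "cl R `` {x} \<subseteq> N p \<longleftrightarrow> p = q" using uniq q by blast
    then show "bonus R p x = (if p = q then -2 else 1)" using True by (simp add: bonus_def)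
  qed
  also have "\<dots> = -2 + (\<Sum>p\<in>?I - {q}. 1)"
  proof -
    have "(\<Sum>p\<in>?I - {q}. if p = q then -2 else 1 :: real) = (\<Sum>p\<in>?I - {q}. 1)"
      by (rule sum.cong) auto
    then show ?thesis using sum.remove[of ?I q "\<lambda>p. if p = q then -2 else 1 :: real"] q xq finite_Q by simp
  qed
  also have "\<dots> = 0" using q xq finite_Q degree[OF x] by (simp add: card_Diff_singleton)
  finally show ?thesis .
qed

lemma sum_weight_at:
  assumes x: "x \<in> V"
  shows "(\<Sum>p\<in>{p \<in> Q. x \<in> N p}. weight R p x) = 42 / real (class_card R x)"
  using sum_bonus[OF x] degree[OF x] by (simp add: weight_def sum.distrib)

lemma sum_weight:
  "(\<Sum>p\<in>Q. \<Sum>x\<in>N p. weight R p x) = 42 * real (card (V // cl R))"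
proof -
  have "(\<Sum>p\<in>Q. \<Sum>x\<in>N p. weight R p x) = (\<Sum>x\<in>V. 42 / real (class_card R x))"
    using sum_flags[OF subset_refl finite_V N_V, of "weight R"] sum_weight_at by simp
  also have "\<dots> = (\<Sum>C\<in>V // cl R. \<Sum>x\<in>C. 42 / real (class_card R x))"
  proof -
    have "V = \<Union>(V // cl R)" using Union_quotient[OF equiv_cl] by blast
    moreover have "\<forall>C\<in>V // cl R. finite C" using finite_class by (auto simp: quotient_def)
    moreover have "\<forall>C\<in>V // cl R. \<forall>D\<in>V // cl R. C \<noteq> D \<longrightarrow> C \<inter> D = {}"
      using quotient_disj[OF equiv_cl] by blast
    ultimately show ?thesis using sum.Union_disjoint[of "V // cl R" "\<lambda>x. 42 / real (class_card R x)"] by simp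
  qed
  also have "\<dots> = (\<Sum>C\<in>V // cl R. 42)"
  proof (rule sum.cong[OF refl])
    fix C assume C: "C \<in> V // cl R"
    then obtain y where y: "y \<in> V" "C = cl R `` {y}" by (auto simp: quotient_def)
    have "cl R `` {x} = C" if "x \<in> C" for x
      using that y equiv_class_eq[OF equiv_cl] by blast
    then have "(\<Sum>x\<in>C. 42 / real (class_card R x)) = (\<Sum>x\<in>C. 42 / real (card C))"
      by (intro sum.cong) (auto simp: class_card_def)
    also have "\<dots> = 42" using class_card_pos[OF y(1), of R] y(2) by (simp add: class_card_def)
    finally show "(\<Sum>x\<in>C. 42 / real (class_card R x)) = 42" .
  qed
  finally show ?thesis by simp
qed

text \<open>The extreme case is 14 / 2 + 1, a class of two vertices with positive bonus.\<close>

lemma weight_le_8: "2 \<le> class_card R x \<Longrightarrow> weight R p x \<le> 8"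
proof -
  assume c: "2 \<le> class_card R x"
  then have "14 / real (class_card R x) \<le> 14 / 2" by (intro divide_left_mono) auto
  then show ?thesis by (auto simp: weight_def bonus_def)
qed

text \<open>The right-hand side amounts to 8 per flag. Flags in larger classes weigh at most 8. A
  flag at a singleton class weighs 14, an excess of 6 and so of at most 18 per vertex, whereas each
  singleton class subtracts 21 on the left. Thus every vertex of \<open>B\<close> yields a surplus
  of 3 and every flag missing at \<open>B\<close>, counted by \<open>d\<close>, another 6. Only
  small groups need care.\<close>

lemma group_bound:
  fixes R :: "('v \<times> 'v) set"
  assumes W: "W \<subseteq> Q" "W \<noteq> {}"
  defines "b \<equiv> card ((\<lambda>x. cl R `` {x}) ` \<Union>(N ` W))"
  shows "21 * (1 + (if even b then 1 else 0) - real b) + (\<Sum>p\<in>W. \<Sum>x\<in>N p. weight R p x) \<le> 24 * real (card W)"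
proof -
  let ?U = "\<Union>(N ` W)" and ?k = "\<lambda>x. cl R `` {x}"
  let ?w = "\<lambda>x. \<Sum>p\<in>{p \<in> W. x \<in> N p}. weight R p x"
  define B where "B = {x \<in> ?U. class_card R x = 1}"
  define C where "C = ?U - B"
  define \<beta> \<alpha> f1 f2 w where "\<beta> = card B" and "\<alpha> = card (?k ` C)" and "f1 = (\<Sum>x\<in>B. deg W x)"
    and "f2 = (\<Sum>x\<in>C. deg W x)" and "w = (\<Sum>x\<in>C. ?w x)"
  have UV: "?U \<subseteq> V" using W N_V by blast
  then have fU: "finite ?U" using finite_V finite_subset by blast
  have BC: "?U = B \<union> C" "B \<inter> C = {}" "B \<subseteq> ?U" "C \<subseteq> ?U" by (auto simp: B_def C_def)
  have fB: "finite B" and fC: "finite C" using fU BC finite_subset by blast+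
  have fW: "finite W" using W finite_Q finite_subset by blast
  have kB: "?k x = {x}" if "x \<in> B" for x using that UV class_card_1 by (auto simp: B_def)
  have cC: "2 \<le> class_card R x" if "x \<in> C" for x
  proof -
    have "class_card R x \<noteq> 1" "x \<in> V" using that UV by (auto simp: B_def C_def)
    then show ?thesis using class_card_pos[of x R] by simp
  qed
  have b: "b = \<beta> + \<alpha>"
  proof -
    have "card (?k ` B) = \<beta>"
      unfolding \<beta>_def using kB by (intro card_image inj_onI) (metis singleton_inject)
    moreover have "?k ` B \<inter> ?k ` C = {}"
    proof (rule ccontr)
      assume "\<not> ?thesis"
      then obtain x y where xy: "x \<in> B" "y \<in> C" "?k x = ?k y" by blast
      have "class_card R y = card {x}" unfolding class_card_def xy(3)[symmetric] kB[OF xy(1)] ..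
      then show False using cC[OF xy(2)] by simp
    qed
    ultimately show ?thesis unfolding b_def \<alpha>_def BC(1) image_Un
      using fB fC by (subst card_Un_disjoint) auto
  qed
  have f12: "f1 + f2 = 3 * card W"
    using sum_deg[OF W(1)] unfolding f1_def f2_def BC(1) using fB fC BC(2) by (simp add: sum.union_disjoint)
  have deg3: "deg W x \<le> 3" if "x \<in> ?U" for x using deg_le[OF W(1)] that UV by blast
  have degpos: "1 \<le> deg W x" if "x \<in> ?U" for x
  proof -
    have "{p \<in> W. x \<in> N p} \<noteq> {}" using that by blast
    then show ?thesis using fW by (simp add: Suc_leI card_gt_0_iff)
  qed
  have "f1 \<le> (\<Sum>x\<in>B. 3)" unfolding f1_def by (rule sum_mono) (use deg3 BC(3) in blast)
  then have "f1 \<le> 3 * \<beta>" by (simp add: \<beta>_def)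
  then obtain d where d: "f1 + d = 3 * \<beta>" by (metis le_add_diff_inverse)
  have C_f2: "card C \<le> f2"
  proof -
    have "(\<Sum>x\<in>C. 1) \<le> f2" unfolding f2_def by (rule sum_mono) (use degpos BC(4) in blast)
    then show ?thesis by simp
  qed
  have nb: "2 * deg W x \<le> (\<beta> - 1) + card C" if x: "x \<in> B" for x
  proof -
    have "x \<in> V" using x BC(3,4) UV by blast
    from card_neighbours[OF W(1) this]
    have "2 * deg W x = card (\<Union>(N ` {p \<in> W. x \<in> N p}) - {x})" by simp
    also have "\<dots> \<le> card ((B - {x}) \<union> C)"
      by (rule card_mono) (use fB fC BC(1) in auto)
    also have "\<dots> \<le> card (B - {x}) + card C" by (rule card_Un_le)
    also have "card (B - {x}) = \<beta> - 1" using x fB by (simp add: \<beta>_def)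
    finally show ?thesis .
  qed
  have full: "\<exists>x\<in>B. deg W x = 3" if "d < \<beta>"
  proof (rule ccontr)
    assume no: "\<not> ?thesis"
    have "deg W x \<le> 2" if "x \<in> B" for x
      using deg3[of x] no that BC(3) by (metis One_nat_def Suc_1 le_SucE numeral_3_eq_3 subsetD)
    then have "f1 \<le> (\<Sum>x\<in>B. 2)" unfolding f1_def by (rule sum_mono)
    then show False using d that by (simp add: \<beta>_def)
  qed
  have deg_full: "deg W x = 3" if "d = 0" "x \<in> B" for x
  proof (rule sum_mono_inv[of "deg W" B "\<lambda>_. 3" x])
    show "(\<Sum>x\<in>B. deg W x) = (\<Sum>x\<in>B. 3)" using d that(1) by (simp add: f1_def \<beta>_def)
    show "deg W y \<le> 3" if "y \<in> B" for y using deg3 BC(3) that by blast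
  qed (use that fB in auto)
  have wB: "?w x = 14 * real (deg W x)" if "x \<in> B" for x
  proof -
    have "weight R p x = 14" for p using that by (simp add: B_def weight_def bonus_def)
    then show ?thesis by simp
  qed
  have "(\<Sum>p\<in>W. \<Sum>x\<in>N p. weight R p x) = (\<Sum>x\<in>?U. ?w x)"
    by (rule sum_flags[OF W(1) fU]) blast
  also have "\<dots> = (\<Sum>x\<in>B. ?w x) + w"
    unfolding w_def BC(1) by (rule sum.union_disjoint[OF fB fC BC(2)])
  also have "(\<Sum>x\<in>B. ?w x) = 14 * real f1"
    using wB by (simp add: f1_def sum_distrib_left)
  finally have total: "(\<Sum>p\<in>W. \<Sum>x\<in>N p. weight R p x) = 14 * real f1 + w" .
  have w8: "w \<le> 8 * real f2"
  proof -
    have "?w x \<le> 8 * real (deg W x)" if "x \<in> C" for x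
    proof -
      have "?w x \<le> (\<Sum>p\<in>{p \<in> W. x \<in> N p}. 8)" by (rule sum_mono) (rule weight_le_8[OF cC[OF that]])
      then show ?thesis by simp
    qed
    then have "w \<le> (\<Sum>x\<in>C. 8 * real (deg W x))" unfolding w_def by (rule sum_mono)
    then show ?thesis by (simp add: f2_def sum_distrib_left)
  qed
  let ?\<epsilon> = "if even b then 1 else 0 :: real"
  \<comment> \<open>What remains after this cancellation. The first bracket is positive only if no
    larger class is met, or exactly one is met and \<open>b\<close> is even.\<close>
  have key: "21 * (1 + ?\<epsilon> - real \<alpha>) + w \<le> 3 * real \<beta> + 6 * real d + 8 * real f2"
  proof -
    consider (none) "\<alpha> = 0" | (many) "2 \<le> \<alpha> \<or> \<alpha> = 1 \<and> odd b" | (one) "\<alpha> = 1" "even b" by linarith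
    then show ?thesis
    proof cases
      case many
      then have "1 + ?\<epsilon> - real \<alpha> \<le> 0" by auto
      then have "21 * (1 + ?\<epsilon> - real \<alpha>) \<le> 0" by simp
      moreover have "0 \<le> 3 * real \<beta> + 6 * real d" by simp
      ultimately show ?thesis using w8 by linarith
    next
      case none
      then have C0: "C = {}" using fC by (simp add: \<alpha>_def)
      then have z: "f2 = 0" "w = 0" by (simp_all add: f2_def w_def)
      have UB: "?U = B" using BC C0 by simp
      obtain p where p: "p \<in> W" using W by blast
      then have "card (N p) = 3" using W N_card by blast
      moreover have "card (N p) \<le> \<beta>" unfolding \<beta>_def by (rule card_mono[OF fB]) (use p UB in blast)
      ultimately have \<beta>3: "3 \<le> \<beta>" by simp
      have d3: "card W + (d div 3) = \<beta>" "3 dvd d" using d f12 z(1) by presburger+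
      \<comment> \<open>The claim divided by 3. If no flag is missing, the group is all of
        \<open>V\<close>, which is odd and has at least seven vertices; the Fano plane attains
        equality.\<close>
      have "7 * (1 + (if even b then 1 else 0)) \<le> \<beta> + 2 * d"
      proof (cases "d = 0")
        case True
        then have "?U = V" using closed_imp_all[OF W] deg_full UB by blast
        then have "\<beta> = card V" using UB by (simp add: \<beta>_def)
        then show ?thesis using odd_V V_ge b none by simp
      next
        case False
        then have "3 \<le> d" using d3(2) by (auto dest: dvd_imp_le)
        show ?thesis
        proof (cases "even b \<and> d = 3")
          case True
          then have "even \<beta>" using b none by simp
          moreover have "\<beta> \<noteq> 3" using \<open>even \<beta>\<close> by auto
          ultimately have "d < \<beta>" using \<beta>3 True by simp
          then obtain x where "x \<in> B" "deg W x = 3" using full by blast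
          then have "6 \<le> \<beta> - 1" using nb[of x] C0 by simp
          then have "8 \<le> \<beta>" using \<open>even \<beta>\<close> by presburger
          then show ?thesis using True by simp
        next
          case False
          then show ?thesis using \<open>3 \<le> d\<close> d3(2) \<beta>3 by presburger
        qed
      qed
      then have "real (7 * (1 + (if even b then 1 else 0))) \<le> real (\<beta> + 2 * d)" by (rule of_nat_mono)
      then show ?thesis using z none by (auto split: if_splits)
    next
      case one
      then have odd\<beta>: "odd \<beta>" using b by simp
      obtain K where K: "?k ` C = {K}" using one(1) unfolding \<alpha>_def by (rule card_1_singletonE)
      have kC: "?k x = K" if "x \<in> C" for x
      proof -
        have "?k x \<in> ?k ` C" using that by (rule imageI)
        then show ?thesis unfolding K by (rule singletonD)
      qed
      have CK: "C \<subseteq> K"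
      proof
        fix x assume x: "x \<in> C"
        then have "x \<in> ?k x" using UV BC(4) cl_refl by blast
        then show "x \<in> K" using kC[OF x] by simp
      qed
      have "C \<noteq> {}" using K by auto
      then obtain x1 where x0: "x1 \<in> C" by blast
      have finK: "finite K" using kC[OF x0] finite_class by blast
      have ccK: "class_card R x = card K" if "x \<in> C" for x using kC[OF that] by (simp add: class_card_def)
      have K2: "2 \<le> card K" using cC[OF x0] ccK[OF x0] by simp
      have CcK: "card C \<le> card K" by (rule card_mono[OF finK CK])
      have "21 + w \<le> 3 * real \<beta> + 6 * real d + 8 * real f2"
      proof (cases "7 \<le> \<beta> + 2 * d")
        case True
        then have "real 7 \<le> real (\<beta> + 2 * d)" by (rule of_nat_mono)
        then show ?thesis using w8 by simp
      next
        case small: False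
        have \<beta>1: "1 \<le> \<beta>" using odd\<beta> by (simp add: Suc_leI odd_pos)
        show ?thesis
        proof (cases "3 \<le> card K")
          case True
          \<comment> \<open>From class size 3 on there is no bonus and each flag saves at least 10 /
            3 against the bound 8. The integer inequality below is the claim multiplied by
            3.\<close>
          have "weight R p x \<le> 14 / 3" if "x \<in> C" for p x
          proof -
            have "14 / real (card K) \<le> 14 / 3" using True by (intro divide_left_mono) auto
            then show ?thesis using ccK[OF that] True by (simp add: weight_def bonus_def)
          qed
          then have "?w x \<le> (\<Sum>p\<in>{p \<in> W. x \<in> N p}. 14 / 3)" if "x \<in> C" for x
            using that by (intro sum_mono) blast
          then have "w \<le> (\<Sum>x\<in>C. \<Sum>p\<in>{p \<in> W. x \<in> N p}. 14 / 3)" unfolding w_def by (rule sum_mono)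
          then have w3: "w \<le> 14 / 3 * real f2" by (simp add: f2_def sum_divide_distrib sum_distrib_left mult.commute)
          have "21 * 3 \<le> 9 * \<beta> + 18 * d + 10 * f2"
          proof (cases "d < \<beta>")
            case True
            then obtain x where "x \<in> B" "deg W x = 3" using full by blast
            then have "7 \<le> \<beta> + f2" using nb[of x] C_f2 \<beta>1 by simp
            then show ?thesis using small by linarith
          next
            case False
            then have \<beta>: "\<beta> = 1" using small odd\<beta> \<beta>1 by presburger
            then obtain x where x: "B = {x}" unfolding \<beta>_def by (rule card_1_singletonE)
            then have "f1 = deg W x" by (simp add: f1_def)
            moreover have "x \<in> B" using x by simp
            ultimately have "2 * f1 \<le> f2" using nb[of x] C_f2 \<beta> by simp
            then show ?thesis using d \<beta> by linarith
          qed
          then have "real (21 * 3) \<le> real (9 * \<beta> + 18 * d + 10 * f2)" by (rule of_nat_mono)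
          then show ?thesis using w3 by simp
        next
          case False
          then have cK: "card K = 2" using K2 by simp
          then have C2: "card C \<le> 2" using CcK by simp
          show ?thesis
          proof (cases "d < \<beta>")
            case True
            then obtain x where x: "x \<in> B" "deg W x = 3" using full by blast
            then have "7 \<le> \<beta> + card C" using nb[of x] \<beta>1 by simp
            \<comment> \<open>The group turns out to be a Fano plane with two vertices identified.
              All flags of this pair are present, so the bonuses cancel, and the claim is the
              equality 21 + 42 = 15 + 48.\<close>
            then have \<beta>5: "\<beta> = 5" "d = 0" using C2 small odd\<beta> by presburger+
            then have "card C = 2" using \<open>7 \<le> \<beta> + card C\<close> C2 by simp
            note degB = deg_full[OF \<beta>5(2)]
            have degC: "deg W y = 3" if y: "y \<in> C" for y
            proof -
              have "B \<subseteq> \<Union>(N ` {p \<in> W. y \<in> N p}) - {y}"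
              proof
                fix z assume z: "z \<in> B"
                let ?Z = "\<Union>(N ` {p \<in> W. z \<in> N p}) - {z}"
                have zV: "z \<in> V" using z BC(3,4) UV by blast
                have Zsub: "?Z \<subseteq> (B - {z}) \<union> C" using BC(1) by blast
                have "card ?Z = 6" using card_neighbours[OF W(1) zV] degB[OF z] by simp
                moreover have "card ((B - {z}) \<union> C) = 6"
                proof -
                  have "card ((B - {z}) \<union> C) = card (B - {z}) + card C"
                    by (rule card_Un_disjoint) (use fB fC BC(2) in auto)
                  then show ?thesis using z fB \<beta>5(1) \<open>card C = 2\<close> by (simp add: \<beta>_def)
                qed
                ultimately have "?Z = (B - {z}) \<union> C"
                  using card_subset_eq[OF _ Zsub] fB fC by simp
                then have "y \<in> ?Z" using y by blast
                then obtain p where "p \<in> W" "z \<in> N p" "y \<in> N p" by blast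
                moreover have "z \<noteq> y" using z y BC(2) by blast
                ultimately show "z \<in> \<Union>(N ` {p \<in> W. y \<in> N p}) - {y}" by blast
              qed
              moreover have "finite (\<Union>(N ` {p \<in> W. y \<in> N p}) - {y})"
                by (rule finite_subset[OF _ fU]) blast
              ultimately have "\<beta> \<le> card (\<Union>(N ` {p \<in> W. y \<in> N p}) - {y})"
                unfolding \<beta>_def by (rule card_mono[rotated])
              also have "\<dots> = 2 * deg W y" by (rule card_neighbours[OF W(1)]) (use y BC(3,4) UV in blast)
              finally show ?thesis using deg3[of y] y BC(4) \<beta>5 by (simp add: subset_iff)
            qed
            have "?w y = 21" if y: "y \<in> C" for y
            proof -
              have yV: "y \<in> V" using y BC(3,4) UV by blast
              show ?thesis
                using sum_weight_at[OF yV, of R] deg_eq_3D[OF W(1) yV degC[OF y]] ccK[OF y] cK by simp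
            qed
            then have "w = 42" using \<open>card C = 2\<close> by (simp add: w_def)
            moreover have "f2 = 6" using degC \<open>card C = 2\<close> by (simp add: f2_def)
            ultimately show ?thesis using \<beta>5 by simp
          next
            case False
            \<comment> \<open>The group turns out to be one hyperedge with two of its vertices
              identified. This case fixes the bonus -2: the two flags weigh 5 each, and the claim is
              the equality 21 + 10 = 3 + 12 + 16.\<close>
            then have \<beta>: "\<beta> = 1" using small odd\<beta> \<beta>1 by presburger
            then obtain x where x: "B = {x}" unfolding \<beta>_def by (rule card_1_singletonE)
            then have f1x: "f1 = deg W x" by (simp add: f1_def)
            have "x \<in> B" using x by simp
            then have 2: "2 * f1 \<le> card C" using nb[of x] \<beta> f1x by simp
            moreover have "1 \<le> f1" unfolding f1x by (rule degpos[OF subsetD[OF BC(3) \<open>x \<in> B\<close>]])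
            ultimately have f1: "f1 = 1" using C2 by linarith
            then have d2: "d = 2" using d \<beta> by simp
            have "card C = 2" using 2 f1 C2 by simp
            then have CK2: "C = K" using card_subset_eq[OF finK CK] cK by simp
            have U3: "card ?U = 3" using BC(1) x \<open>card C = 2\<close> fC BC(2) by simp
            have NpU: "N p = ?U" if "p \<in> W" for p
              by (rule card_subset_eq[OF fU]) (use that W N_card U3 in auto)
            obtain p where p: "p \<in> W" using W by blast
            have "W = {p}"
            proof -
              have "q = p" if "q \<in> W" for q
              proof (rule ccontr)
                assume "q \<noteq> p"
                then have "card (N q \<inter> N p) \<le> 1" using linear W p that by blast
                then show False using NpU[OF that] NpU[OF p] U3 by simp
              qed
              then show ?thesis using p by blast
            qed
            then have f2: "f2 = 2" using f12 f1 by simp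
            have "weight R p y = 5" if y: "y \<in> C" for y
            proof -
              have "cl R `` {y} \<subseteq> N p" using y kC[OF y] CK2 BC(4) NpU[OF p] by blast
              moreover have "p \<in> Q" using p W by blast
              ultimately show ?thesis using ccK[OF y] cK by (auto simp: weight_def bonus_def)
            qed
            moreover have "{q \<in> W. y \<in> N q} = {p}" if "y \<in> C" for y
              using that BC(4) NpU[OF p] \<open>W = {p}\<close> by blast
            ultimately have "?w y = 5" if "y \<in> C" for y using that by simp
            then have "w = 10" using \<open>card C = 2\<close> by (simp add: w_def)
            then show ?thesis using \<beta> d2 f2 by simp
          qed
        qed
      qed
      then show ?thesis using one by simp
    qed
  qed
  have "real (f1 + f2) = real (3 * card W)" "real (f1 + d) = real (3 * \<beta>)" using f12 d by simp_all
  then show ?thesis using key unfolding total b by simp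
qed

lemma robust_points: "robust N {} Q"
proof -
  have "V \<noteq> {}" using V_ge by auto
  note rk0 = rk_empty and rkQ = rk_connected[OF connected this]
  have inc: "inc {} (pairs N Q) + 1 = card V" using rkQ rk0 rk_inc[of "{}" "pairs N Q"] by simp
  show ?thesis
    unfolding robust_def
  proof (intro conjI allI impI)
    show "even (inc {} (pairs N Q))" using inc odd_V by (metis Suc_eq_plus1 even_Suc)
    fix R \<Q> assume part: "partition_on Q \<Q>"
    obtain \<W> where \<W>: "partition_on Q \<W>" "cost N R \<W> \<le> cost N R \<Q>"
      "\<And>W. W \<in> \<W> \<Longrightarrow> \<Union>(N ` W) \<times> \<Union>(N ` W) \<subseteq> cl (R \<union> pairs N W)"
      using connected_refinement[of Q N \<Q> R, OF finite_Q N_V part] by blast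
    define b where "b W = card ((\<lambda>x. cl R `` {x}) ` \<Union>(N ` W))" for W
    define \<epsilon> where "\<epsilon> W = (if even (b W) then 1 else 0 :: nat)" for W
    have fin: "finite \<W>" using \<W>(1) finite_Q by (metis finite_UnionD partition_onD1)
    have sub: "W \<subseteq> Q" "W \<noteq> {}" if "W \<in> \<W>" for W
      using that partition_onD1[OF \<W>(1)] partition_onD3[OF \<W>(1)] by blast+
    \<comment> \<open>A connected part that meets \<open>b W\<close> classes has increment
      \<open>b W - 1\<close>; \<open>\<epsilon> W\<close> is the unit lost by rounding when this
      number is odd.\<close>
    have half: "2 * (inc R (pairs N W) div 2) + 1 + \<epsilon> W = b W" if W: "W \<in> \<W>" for W
    proof -
      let ?U = "\<Union>(N ` W)"
      have UV: "?U \<subseteq> V" using sub(1)[OF W] N_V by blast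
      obtain p where p: "p \<in> W" using sub(2)[OF W] by blast
      then have "card (N p) = 3" using N_card sub(1)[OF W] by blast
      then have Une: "?U \<noteq> {}" using p by fastforce
      have "cl (R \<union> pairs N W) = cl (R \<union> ?U \<times> ?U)"
      proof
        show "cl (R \<union> pairs N W) \<subseteq> cl (R \<union> ?U \<times> ?U)"
          by (rule cl_mono) (use pairs_sub_square[of N W] in blast)
        show "cl (R \<union> ?U \<times> ?U) \<subseteq> cl (R \<union> pairs N W)"
          by (rule cl_least[OF equiv_cl]) (use \<W>(3)[OF W] cl_incl[of "R \<union> pairs N W"] in blast)
      qed
      then have "rk (R \<union> pairs N W) + 1 = rk R + b W"
        using rk_cong rk_Un_square[OF UV Une, of R] unfolding b_def by metis
      then have "inc R (pairs N W) + 1 = b W" using rk_inc[of R "pairs N W"] by simp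
      then show ?thesis unfolding \<epsilon>_def by presburger
    qed
    let ?n = "card V" and ?N = "card (V // cl R)"
    have "(\<Sum>W\<in>\<W>. 21 * (1 + real (\<epsilon> W) - real (b W)) + (\<Sum>p\<in>W. \<Sum>x\<in>N p. weight R p x)) \<le> (\<Sum>W\<in>\<W>. 24 * real (card W))"
    proof (rule sum_mono)
      fix W assume "W \<in> \<W>"
      from group_bound[OF sub[OF this], of R]
      show "21 * (1 + real (\<epsilon> W) - real (b W)) + (\<Sum>p\<in>W. \<Sum>x\<in>N p. weight R p x) \<le> 24 * real (card W)"
        unfolding \<epsilon>_def b_def by (simp split: if_splits)
    qed
    moreover have "(\<Sum>W\<in>\<W>. \<Sum>p\<in>W. \<Sum>x\<in>N p. weight R p x) = 42 * real ?N"
    proof -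
      have "(\<Sum>W\<in>\<W>. \<Sum>p\<in>W. \<Sum>x\<in>N p. weight R p x) = (\<Sum>p\<in>\<Union>\<W>. \<Sum>x\<in>N p. weight R p x)"
        using sum.Union_disjoint[of \<W> "\<lambda>p. \<Sum>x\<in>N p. weight R p x"] sub(1) finite_Q finite_subset
          partition_onD2[OF \<W>(1)] unfolding disjoint_def by (metis comp_apply)
      then show ?thesis using sum_weight[of R] partition_onD1[OF \<W>(1)] by simp
    qed
    moreover have "(\<Sum>W\<in>\<W>. real (card W)) = real ?n"
    proof -
      have "(\<Sum>W\<in>\<W>. card W) = card (\<Union>\<W>)"
        by (rule card_Union_disjoint[symmetric])
          (use partition_onD2[OF \<W>(1)] finite_subset[OF sub(1) finite_Q] in auto)
      then show ?thesis using card_Q partition_onD1[OF \<W>(1)] by (metis of_nat_sum)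
    qed
    ultimately have "21 * (\<Sum>W\<in>\<W>. 1 + real (\<epsilon> W) - real (b W)) + 42 * real ?N \<le> 24 * real ?n"
      by (simp only: sum.distrib flip: sum_distrib_left)
    moreover have "(\<Sum>W\<in>\<W>. 1 + real (\<epsilon> W) - real (b W)) = (\<Sum>W\<in>\<W>. - 2 * real (inc R (pairs N W) div 2))"
    proof (rule sum.cong[OF refl])
      fix W assume "W \<in> \<W>"
      then have "real (2 * (inc R (pairs N W) div 2) + 1 + \<epsilon> W) = real (b W)" using half by simp
      then show "1 + real (\<epsilon> W) - real (b W) = - 2 * real (inc R (pairs N W) div 2)" by simp
    qed
    ultimately have 1: "42 * real ?N \<le> 24 * real ?n + 42 * real (\<Sum>W\<in>\<W>. inc R (pairs N W) div 2)"
      by (simp add: sum_negf sum_distrib_left)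
    have "real (rk R) + real ?N = real ?n" using rk_eq[of R] by (metis of_nat_add)
    then have "18 * real ?n \<le> 42 * real (cost N R \<W>)" using 1 by (simp add: cost_def)
    then have "18 * ?n \<le> 42 * cost N R \<W>" by linarith
    then have c: "18 * ?n \<le> 42 * cost N R \<Q>" using \<W>(2) by linarith
    \<comment> \<open>By parity a violation gives \<open>2 * cost N R \<Q> \<le> card V - 3\<close>.
      Then \<open>18 * card V \<le> 21 * (card V - 3)\<close>, that is,
      \<open>21 \<le> card V\<close>.\<close>
    have "inc {} (pairs N Q) \<le> 2 * cost N R \<Q>"
    proof (rule ccontr)
      assume "\<not> ?thesis"
      then have "2 * cost N R \<Q> + 2 \<le> inc {} (pairs N Q)" using inc odd_V by presburger
      then show False using c inc V_le by linarith
    qed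
    then show "2 * rk {} + inc {} (pairs N Q) \<le> 2 * cost N R \<Q>" using rk0 by simp
  qed
qed

text \<open>The last equation expresses acyclicity: every point of \<open>M\<close> adds rank 2, in
  whatever order the points are added.\<close>

theorem spanning_hypertree:
  obtains M where "M \<subseteq> Q" "2 * card M + 1 = card V" "cl (pairs N M) = V \<times> V"
    "inc {} (pairs N M) = 2 * card M"
proof -
  have "solvable N {} Q"
    by (rule robust_imp_solvable[OF finite_Q N_V _ _ robust_points]) (use N_card in auto)
  then obtain M where M: "M \<subseteq> Q" "2 * card M = inc {} (pairs N Q)" "cl (pairs N M) = V \<times> V"
    unfolding solvable_def using connected by auto
  have "inc {} (pairs N M) = inc {} (pairs N Q)"
    unfolding inc_def using rk_cong[of "pairs N M" "pairs N Q"] M(3) connected by simp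
  moreover have "V \<noteq> {}" using V_ge by auto
  note rk_connected[OF connected this] rk_empty
  ultimately have "2 * card M + 1 = card V" "inc {} (pairs N M) = 2 * card M"
    using M(2) by (simp_all add: inc_def)
  then show ?thesis using that M by blast
qed

end

section \<open>Orbits and three-cycles\<close>

lemma orbit_subset_closed:
  assumes "x \<in> A" "\<And>v. v \<in> A \<Longrightarrow> f v \<in> A"
  shows "orbit f x \<subseteq> A"
proof
  fix y assume "y \<in> orbit f x"
  then show "y \<in> A" by induction (use assms in auto)
qed

lemma permutes_self_in_orbit: "finite S \<Longrightarrow> f permutes S \<Longrightarrow> x \<in> orbit f x"
  by (rule permutation_self_in_orbit) (auto simp: permutation_permutes)

lemma permutes_orbit_sym: "finite S \<Longrightarrow> f permutes S \<Longrightarrow> y \<in> orbit f x \<Longrightarrow> x \<in> orbit f y"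
  using orbit_swap permutes_self_in_orbit by metis

lemma permutes_transpose_comp:
  "f permutes S \<Longrightarrow> a \<in> S \<Longrightarrow> b \<in> S \<Longrightarrow> (transpose a b \<circ> f) permutes S"
  by (intro permutes_compose permutes_swap_id)

text \<open>Composition on the left redirects the step that enters \<open>b\<close> to
  \<open>a\<close>, and conversely. The orbit of \<open>b\<close> is followed unchanged until it
  would return to \<open>b\<close>; there the walk passes to \<open>a\<close>.\<close>

lemma orbit_transpose_merge_at:
  assumes f: "finite S" "f permutes S" and ab: "a \<in> S" "b \<in> S" "a \<notin> orbit f b"
  shows "orbit f b \<subseteq> orbit (transpose a b \<circ> f) b" "a \<in> orbit (transpose a b \<circ> f) b"
proof -
  let ?g = "transpose a b \<circ> f"
  have g: "?g permutes S" by (rule permutes_transpose_comp[OF f(2) ab(1,2)])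
  have "v = b \<or> v \<in> orbit ?g b" if "v \<in> orbit f b" for v
    using that
  proof induction
    case base
    have "f b \<noteq> a" using ab(3) orbit.base by metis
    then show ?case by (cases "f b = b") (auto simp: transpose_def intro: orbit_eqI(1))
  next
    case (step v)
    have "f v \<noteq> a" using ab(3) orbit.step[OF step.hyps] by metis
    then have "f v = b \<or> ?g v = f v" by (auto simp: transpose_def)
    moreover have "?g v \<in> orbit ?g b" using step.IH by (metis orbit.base orbit.step)
    ultimately show ?case by metis
  qed
  then show 1: "orbit f b \<subseteq> orbit ?g b" using permutes_self_in_orbit[OF f(1) g] by blast
  have "b \<in> orbit f b" by (rule permutes_self_in_orbit[OF f])
  then obtain u where u: "u = b \<or> u \<in> orbit f b" "f u = b" using orbit.cases[of b f b] by metis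
  then have "u \<in> orbit ?g b" using 1 permutes_self_in_orbit[OF f(1) g] by blast
  then have "?g u \<in> orbit ?g b" by (rule orbit.step)
  then show "a \<in> orbit ?g b" using u(2) by simp
qed

lemma orbit_transpose_merge:
  assumes f: "finite S" "f permutes S" and ab: "a \<in> S" "b \<in> S" "a \<notin> orbit f b"
  shows "orbit f x \<subseteq> orbit (transpose a b \<circ> f) x"
proof -
  let ?g = "transpose a b \<circ> f"
  have g: "?g permutes S" by (rule permutes_transpose_comp[OF f(2) ab(1,2)])
  note sym = permutes_orbit_sym[OF f] and sym_g = permutes_orbit_sym[OF f(1) g]
  have ba: "b \<notin> orbit f a" using ab(3) sym by blast
  have eq: "orbit f x = orbit f y" if "x \<in> orbit f y" for x y
  proof
    show "orbit f x \<subseteq> orbit f y" by (rule subsetI) (rule orbit_trans[OF _ that])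
    show "orbit f y \<subseteq> orbit f x" by (rule subsetI) (rule orbit_trans[OF _ sym[OF that]])
  qed
  have *: "orbit f x \<subseteq> orbit ?g x" if x: "x \<in> orbit f c" and c: "orbit f c \<subseteq> orbit ?g c" for c
  proof -
    have "x \<in> orbit ?g c" using x c by blast
    then have "c \<in> orbit ?g x" by (rule sym_g)
    then have "orbit ?g c \<subseteq> orbit ?g x" by (intro subsetI) (rule orbit_trans)
    then show ?thesis using eq[OF x] c by simp
  qed
  show ?thesis
  proof (cases "x \<in> orbit f b \<or> x \<in> orbit f a")
    case True
    have "orbit f a \<subseteq> orbit ?g a"
      using orbit_transpose_merge_at(1)[OF f ab(2,1) ba] by (simp add: transpose_commute)
    then show ?thesis using True * orbit_transpose_merge_at(1)[OF f ab] by blast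
  next
    case False
    have same: "?g v = f v" if "v = x \<or> v \<in> orbit f x" for v
    proof -
      have "f v \<in> orbit f x" using that orbit.base orbit.step by metis
      then have "f v \<noteq> a" "f v \<noteq> b" using False sym by blast+
      then show ?thesis by (simp add: transpose_def)
    qed
    show ?thesis
    proof
      fix v assume "v \<in> orbit f x"
      then show "v \<in> orbit ?g x"
      proof induction
        case base
        then show ?case using same[of x] orbit.base[of ?g x] by metis
      next
        case (step v)
        then show ?case using same[of v] orbit.step[of v ?g x] by metis
      qed
    qed
  qed
qed

lemma orbit_transpose_upper:
  assumes "finite S" "f permutes S"
  shows "orbit (transpose a b \<circ> f) a \<subseteq> orbit f a \<union> orbit f b"
proof (rule orbit_subset_closed)
  have self: "a \<in> orbit f a" "b \<in> orbit f b" using permutes_self_in_orbit[OF assms] by auto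
  then show "a \<in> orbit f a \<union> orbit f b" by simp
  fix v assume "v \<in> orbit f a \<union> orbit f b"
  then have "f v \<in> orbit f a \<union> orbit f b" using orbit.step by fast
  then show "(transpose a b \<circ> f) v \<in> orbit f a \<union> orbit f b" using self by (auto simp: transpose_def)
qed

text \<open>On a common cycle the same redirection cuts: the walk from \<open>b\<close> is sent back
  to \<open>b\<close> at the moment when it would first reach \<open>c\<close>.\<close>

lemma orbit_transpose_split:
  assumes f: "finite S" "f permutes S" and bc: "b \<in> S" "c \<in> S" "b \<noteq> c" "c \<in> orbit f b"
  shows "orbit f b \<subseteq> orbit (transpose b c \<circ> f) b \<union> orbit (transpose b c \<circ> f) c"
    and "c \<notin> orbit (transpose b c \<circ> f) b"
proof -
  let ?g = "transpose b c \<circ> f"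
  have g: "?g permutes S" by (rule permutes_transpose_comp[OF f(2) bc(1,2)])
  have self: "x \<in> orbit ?g x" for x by (rule permutes_self_in_orbit[OF f(1) g])
  have stepg: "f v \<in> orbit ?g b \<union> orbit ?g c" if "v \<in> orbit ?g b \<union> orbit ?g c" for v
  proof (cases "f v = b \<or> f v = c")
    case True
    then show ?thesis using self by auto
  next
    case False
    then have eq: "?g v = f v" by (simp add: transpose_def)
    have "?g v \<in> orbit ?g b \<union> orbit ?g c" using that orbit.step[of v ?g] by blast
    then show ?thesis unfolding eq .
  qed
  show "orbit f b \<subseteq> orbit ?g b \<union> orbit ?g c"
    by (rule orbit_subset_closed) (use self stepg in blast)+
  obtain n where n: "0 < n" "(f ^^ n) b = c" "\<And>m. 0 < m \<Longrightarrow> m < n \<Longrightarrow> (f ^^ m) b \<noteq> c"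
  proof -
    have ex: "\<exists>n. 0 < n \<and> (f ^^ n) b = c" using bc(4) by (auto simp: orbit_altdef)
    define n where "n = (LEAST n. 0 < n \<and> (f ^^ n) b = c)"
    have "0 < n \<and> (f ^^ n) b = c" unfolding n_def using ex by (rule LeastI_ex)
    moreover have "(f ^^ m) b \<noteq> c" if "0 < m" "m < n" for m
      using not_less_Least[of m "\<lambda>n. 0 < n \<and> (f ^^ n) b = c"] that unfolding n_def by blast
    ultimately show ?thesis using that by blast
  qed
  have nb: "(f ^^ m) b \<noteq> b" if "0 < m" "m < n" for m
  proof
    assume eq: "(f ^^ m) b = b"
    have "(f ^^ (n - m + m)) b = (f ^^ (n - m)) ((f ^^ m) b)" by (simp only: funpow_add comp_apply)
    then have "(f ^^ n) b = (f ^^ (n - m)) ((f ^^ m) b)" using that by simp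
    then have "(f ^^ (n - m)) b = c" using eq n(2) by simp
    then show False using n(3)[of "n - m"] that by simp
  qed
  let ?O = "(\<lambda>m. (f ^^ m) b) ` {..<n}"
  have "orbit ?g b \<subseteq> ?O"
  proof (rule orbit_subset_closed)
    show "b \<in> ?O" using n(1) by (intro image_eqI[of _ _ 0]) auto
    fix v assume "v \<in> ?O"
    then obtain m where m: "m < n" "v = (f ^^ m) b" by blast
    show "?g v \<in> ?O"
    proof (cases "Suc m = n")
      case True
      then have "f v = c" using n(2) m by auto
      then have "?g v = (f ^^ 0) b" by simp
      then show ?thesis using n(1) by blast
    next
      case False
      then have lt: "Suc m < n" using m by simp
      have fv: "f v = (f ^^ Suc m) b" using m by simp
      then have "f v \<noteq> b" "f v \<noteq> c" using nb[OF _ lt] n(3)[OF _ lt] by auto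
      then have "?g v = (f ^^ Suc m) b" using fv by (simp add: transpose_def)
      then show ?thesis using lt by blast
    qed
  qed
  moreover have "c \<notin> ?O"
  proof
    assume "c \<in> ?O"
    then obtain m where "m < n" "c = (f ^^ m) b" by blast
    then show False using n(3)[of m] bc(3) by (cases "m = 0") auto
  qed
  ultimately show "c \<notin> orbit ?g b" by blast
qed

text \<open>The cycle is written as a product of transpositions so that merging and splitting of
  orbits can be followed one transposition at a time.\<close>

definition three_cycle :: "'a \<Rightarrow> 'a \<Rightarrow> 'a \<Rightarrow> 'a \<Rightarrow> 'a" where
  "three_cycle a b c = transpose a b \<circ> transpose b c"

lemma three_cycle_simps:
  assumes "distinct [a, b, c]"
  shows "three_cycle a b c a = b" "three_cycle a b c b = c" "three_cycle a b c c = a"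
    "x \<noteq> a \<Longrightarrow> x \<noteq> b \<Longrightarrow> x \<noteq> c \<Longrightarrow> three_cycle a b c x = x"
  using assms by (auto simp: three_cycle_def transpose_def)

lemma three_cycle_permutes:
  "f permutes S \<Longrightarrow> a \<in> S \<Longrightarrow> b \<in> S \<Longrightarrow> c \<in> S \<Longrightarrow> (three_cycle a b c \<circ> f) permutes S"
  unfolding three_cycle_def o_assoc[symmetric] by (intro permutes_transpose_comp)

text \<open>Joining the orbits of \<open>b\<close> and \<open>c\<close> does not reach the orbit of
  \<open>a\<close>, so the second transposition merges again.\<close>

lemma three_cycle_merge:
  assumes f: "finite S" "f permutes S" and abc: "a \<in> S" "b \<in> S" "c \<in> S"
    and diff: "b \<notin> orbit f c" "a \<notin> orbit f b" "a \<notin> orbit f c"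
  defines "g \<equiv> three_cycle a b c \<circ> f"
  shows "orbit f x \<subseteq> orbit g x" "b \<in> orbit g a" "c \<in> orbit g a"
proof -
  let ?h = "transpose b c \<circ> f"
  have h: "?h permutes S" by (rule permutes_transpose_comp[OF f(2) abc(2,3)])
  have g: "g = transpose a b \<circ> ?h" by (simp add: g_def three_cycle_def o_assoc)
  have gp: "g permutes S" unfolding g by (rule permutes_transpose_comp[OF h abc(1,2)])
  have ah: "a \<notin> orbit ?h b" using orbit_transpose_upper[OF f, of b c] diff by blast
  have 1: "orbit ?h y \<subseteq> orbit g y" for y unfolding g by (rule orbit_transpose_merge[OF f(1) h abc(1,2) ah])
  show "orbit f x \<subseteq> orbit g x"
    using orbit_transpose_merge[OF f abc(2,3) diff(1), of x] 1[of x] by blast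
  have "a \<in> orbit g b" unfolding g by (rule orbit_transpose_merge_at(2)[OF f(1) h abc(1,2) ah])
  then show ba: "b \<in> orbit g a" by (rule permutes_orbit_sym[OF f(1) gp])
  have "b \<in> orbit ?h c" by (rule orbit_transpose_merge_at(2)[OF f abc(2,3) diff(1)])
  then have "b \<in> orbit g c" using 1 by blast
  then have "c \<in> orbit g b" by (rule permutes_orbit_sym[OF f(1) gp])
  then show "c \<in> orbit g a" using ba by (rule orbit_trans)
qed

text \<open>The transposition of \<open>b\<close> and \<open>c\<close> cuts the orbit into two, one
  through \<open>b\<close> and one through \<open>c\<close>. As \<open>a\<close> lies on exactly one
  of them, exchanging \<open>a\<close> with the one of \<open>b\<close> and \<open>c\<close> on the
  other joins both again. The two possibilities are the two directions of the three-cycle.\<close>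

lemma three_cycle_single_orbit:
  assumes f: "finite S" "f permutes S" and abc: "a \<in> S" "b \<in> S" "c \<in> S" "distinct [a, b, c]"
    and single: "\<And>x y. x \<in> S \<Longrightarrow> y \<in> S \<Longrightarrow> x \<in> orbit f y"
  shows "(\<forall>x\<in>S. \<forall>y\<in>S. x \<in> orbit (three_cycle a b c \<circ> f) y) \<or>
    (\<forall>x\<in>S. \<forall>y\<in>S. x \<in> orbit (three_cycle a c b \<circ> f) y)"
proof -
  let ?h = "transpose b c \<circ> f"
  have h: "?h permutes S" by (rule permutes_transpose_comp[OF f(2) abc(2,3)])
  have bc: "b \<noteq> c" "c \<in> orbit f b" using abc single by auto
  have split: "orbit f b \<subseteq> orbit ?h b \<union> orbit ?h c" "c \<notin> orbit ?h b"
    using orbit_transpose_split[OF f abc(2,3) bc] by auto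
  have split': "b \<notin> orbit ?h c" using split(2) permutes_orbit_sym[OF f(1) h] by blast
  have S: "S \<subseteq> orbit ?h b \<union> orbit ?h c" using split(1) single abc by blast
  have merge: "\<forall>x\<in>S. \<forall>y\<in>S. x \<in> orbit (transpose a d \<circ> ?h) y"
    if d: "d \<in> S" "a \<notin> orbit ?h d" "a \<in> orbit ?h e" "S \<subseteq> orbit ?h d \<union> orbit ?h e" for d e
  proof -
    let ?g = "transpose a d \<circ> ?h"
    have gp: "?g permutes S" by (rule permutes_transpose_comp[OF h abc(1) d(1)])
    have mono: "orbit ?h y \<subseteq> orbit ?g y" for y by (rule orbit_transpose_merge[OF f(1) h abc(1) d(1,2)])
    have ad: "a \<in> orbit ?g d" by (rule orbit_transpose_merge_at(2)[OF f(1) h abc(1) d(1,2)])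
    have "x \<in> orbit ?g d" if "x \<in> S" for x
    proof (cases "x \<in> orbit ?h d")
      case True
      then show ?thesis using mono by blast
    next
      case False
      then have "x \<in> orbit ?g e" using d(4) that mono by blast
      moreover have "e \<in> orbit ?g a" using d(3) mono permutes_orbit_sym[OF f(1) gp] by blast
      ultimately show ?thesis using ad by (metis orbit_trans)
    qed
    then show ?thesis using permutes_orbit_sym[OF f(1) gp] by (metis orbit_trans)
  qed
  have "a \<in> orbit ?h b \<or> a \<in> orbit ?h c" using S abc(1) by blast
  then show ?thesis
  proof
    assume a: "a \<in> orbit ?h b"
    then have "a \<notin> orbit ?h c"
      using split(2) permutes_orbit_sym[OF f(1) h] by (metis orbit_trans)
    from merge[OF abc(3) this a] S have "\<forall>x\<in>S. \<forall>y\<in>S. x \<in> orbit (transpose a c \<circ> ?h) y" by blast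
    moreover have "transpose a c \<circ> ?h = three_cycle a c b \<circ> f"
      by (simp add: three_cycle_def o_assoc transpose_commute)
    ultimately show ?thesis by simp
  next
    assume a: "a \<in> orbit ?h c"
    then have "a \<notin> orbit ?h b"
      using split' permutes_orbit_sym[OF f(1) h] by (metis orbit_trans)
    from merge[OF abc(2) this a S] have "\<forall>x\<in>S. \<forall>y\<in>S. x \<in> orbit (transpose a b \<circ> ?h) y" .
    moreover have "transpose a b \<circ> ?h = three_cycle a b c \<circ> f"
      by (simp add: three_cycle_def o_assoc)
    ultimately show ?thesis by simp
  qed
qed

section \<open>Blocks and flags of a configuration\<close>

lemma parcs_mk_symmetric:
  "parcs (mk_symmetric (with_proj G)) = parcs G \<union> (parcs G)\<inverse>"
  by (auto simp: mk_symmetric_def)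

lemma connected_iff:
  "connected (with_proj G) \<longleftrightarrow> pverts G \<noteq> {} \<and>
    (\<forall>u\<in>pverts G. \<forall>v\<in>pverts G. (u, v) \<in> rtrancl_on (pverts G) (parcs G \<union> (parcs G)\<inverse>))"
proof -
  have "pverts (mk_symmetric (with_proj G)) = pverts G" by (simp add: mk_symmetric_def)
  then show ?thesis
    by (simp add: connected_def strongly_connected_def reachable_def parcs_mk_symmetric)
qed

context symmetric_configuration begin

definition blocks_at :: "'a \<Rightarrow> 'a set set" where
  "blocks_at p = {b \<in> \<B>. p \<in> b}"

lemma block_unique:
  assumes "b \<in> \<B>" "b' \<in> \<B>" "p \<in> b" "q \<in> b" "p \<in> b'" "q \<in> b'" "p \<noteq> q"
  shows "b = b'"
proof -
  have "card {b \<in> \<B>. p \<in> b \<and> q \<in> b} \<le> 1"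
    using assms block_subset by (intro at_most_one_block) auto
  moreover have "finite {b \<in> \<B>. p \<in> b \<and> q \<in> b}" using finite_blocks by simp
  ultimately show ?thesis using assms card_le_Suc0_iff_eq by fastforce
qed

lemma levi_path_induct:
  assumes "(u, w) \<in> rtrancl_on (pverts (levi_graph V \<B>)) (parcs (levi_graph V \<B>) \<union> (parcs (levi_graph V \<B>))\<inverse>)"
    and "P u"
    and "\<And>p b. p \<in> V \<Longrightarrow> b \<in> \<B> \<Longrightarrow> p \<in> b \<Longrightarrow> P (Inl p) \<Longrightarrow> P (Inr b)"
    and "\<And>p b. p \<in> V \<Longrightarrow> b \<in> \<B> \<Longrightarrow> p \<in> b \<Longrightarrow> P (Inr b) \<Longrightarrow> P (Inl p)"
  shows "P w"
  using assms(1)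
proof (induction rule: rtrancl_on_induct)
  case base
  show ?case by (rule assms(2))
next
  case (step y z)
  then show ?case using assms(3,4) by (auto simp: levi_graph_def)
qed

lemma associated_graph_connected:
  assumes "connected_configuration V \<B>"
  shows "connected (with_proj (associated_graph V \<B>))"
proof -
  let ?K = "associated_graph V \<B>"
  let ?R = "rtrancl_on (pverts ?K) (parcs ?K \<union> (parcs ?K)\<inverse>)"
  have levi: "pverts (levi_graph V \<B>) \<noteq> {}"
    "\<And>u w. u \<in> pverts (levi_graph V \<B>) \<Longrightarrow> w \<in> pverts (levi_graph V \<B>) \<Longrightarrow>
      (u, w) \<in> rtrancl_on (pverts (levi_graph V \<B>)) (parcs (levi_graph V \<B>) \<union> (parcs (levi_graph V \<B>))\<inverse>)"
    using assms unfolding connected_configuration_def connected_iff by blast+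
  have verts: "pverts ?K = V" by (simp add: associated_graph_def)
  have "(p, q) \<in> ?R" if pq: "p \<in> V" "q \<in> V" for p q
  proof -
    \<comment> \<open>At a block vertex the invariant speaks of all points of the block, since any
      two of them are adjacent in \<open>?K\<close>.\<close>
    define P where "P u = (case u of Inl q \<Rightarrow> (p, q) \<in> ?R | Inr b \<Rightarrow> \<forall>q\<in>b. (p, q) \<in> ?R)" for u :: "'a + 'a set"
    have "(Inl p, Inl q) \<in> rtrancl_on (pverts (levi_graph V \<B>)) (parcs (levi_graph V \<B>) \<union> (parcs (levi_graph V \<B>))\<inverse>)"
      using pq by (intro levi) (auto simp: levi_graph_def)
    then have "P (Inl q)"
    proof (rule levi_path_induct)
      show "P (Inl p)" using pq verts by (simp add: P_def)
      show "P (Inr b)" if "s \<in> V" "b \<in> \<B>" "s \<in> b" "P (Inl s)" for s b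
        unfolding P_def sum.case
      proof
        fix t assume t: "t \<in> b"
        have ps: "(p, s) \<in> ?R" using that by (simp add: P_def)
        show "(p, t) \<in> ?R"
        proof (cases "t = s")
          case False
          then have "(s, t) \<in> parcs ?K" "t \<in> V"
            using that t block_subset by (auto simp: associated_graph_def)
          then show ?thesis using ps verts by (intro rtrancl_on_into_rtrancl_on[OF ps]) auto
        qed (use ps in simp)
      qed
      show "P (Inl s)" if "s \<in> V" "b \<in> \<B>" "s \<in> b" "P (Inr b)" for s b
        using that by (simp add: P_def)
    qed
    then show ?thesis by (simp add: P_def)
  qed
  moreover have "V \<noteq> {}"
  proof
    assume "V = {}"
    then have "b = {}" if "b \<in> \<B>" for b using block_subset[OF that] by simp
    then have "\<B> = {}" using block_size by fastforce
    then show False using levi(1) \<open>V = {}\<close> by (simp add: levi_graph_def)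
  qed
  ultimately show ?thesis unfolding connected_iff verts by blast
qed

text \<open>This is the dual configuration: point degree becomes edge size, block size becomes
  vertex degree, and linearity is self-dual.\<close>

lemma linear_cubic_hypergraph_blocks:
  assumes conn: "connected_configuration V \<B>" and v: "odd v" "7 \<le> v" "v \<le> 19"
  shows "linear_cubic_hypergraph \<B> blocks_at V"
proof -
  interpret R: relation_rank \<B> by unfold_locales (rule finite_blocks)
  show ?thesis
  proof unfold_locales
    show "card V = card \<B>" using card_points card_blocks by simp
    show "blocks_at p \<subseteq> \<B>" for p by (auto simp: blocks_at_def)
    show "card (blocks_at p) = 3" if "p \<in> V" for p using point_degree[OF that] by (simp add: blocks_at_def)
    show "card {p \<in> V. b \<in> blocks_at p} = 3" if "b \<in> \<B>" for b
    proof -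
      have "{p \<in> V. b \<in> blocks_at p} = b" using that block_subset by (auto simp: blocks_at_def)
      then show ?thesis using block_size[OF that] by simp
    qed
    show "card (blocks_at p \<inter> blocks_at q) \<le> 1" if "p \<in> V" "q \<in> V" "p \<noteq> q" for p q
    proof -
      have "blocks_at p \<inter> blocks_at q = {b \<in> \<B>. p \<in> b \<and> q \<in> b}" by (auto simp: blocks_at_def)
      then show ?thesis using at_most_one_block[OF that] by simp
    qed
    show "odd (card \<B>)" "7 \<le> card \<B>" "card \<B> \<le> 19" using v card_blocks by simp_all
    show "R.cl (pairs blocks_at V) = \<B> \<times> \<B>"
    proof
      show "R.cl (pairs blocks_at V) \<subseteq> \<B> \<times> \<B>" by (rule R.cl_sub)
      show "\<B> \<times> \<B> \<subseteq> R.cl (pairs blocks_at V)"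
      proof clarify
        fix b b' assume b: "b \<in> \<B>" "b' \<in> \<B>"
        let ?C = "R.cl (pairs blocks_at V)"
        define P where "P u = (case u of Inl p \<Rightarrow> \<forall>c\<in>blocks_at p. (b, c) \<in> ?C | Inr c \<Rightarrow> (b, c) \<in> ?C)"
          for u :: "'a + 'a set"
        have "(Inr b, Inr b') \<in> rtrancl_on (pverts (levi_graph V \<B>)) (parcs (levi_graph V \<B>) \<union> (parcs (levi_graph V \<B>))\<inverse>)"
          using conn b unfolding connected_configuration_def connected_iff by (auto simp: levi_graph_def)
        then have "P (Inr b')"
        proof (rule levi_path_induct)
          show "P (Inr b)" using b R.cl_refl by (simp add: P_def)
          show "P (Inr c)" if "p \<in> V" "c \<in> \<B>" "p \<in> c" "P (Inl p)" for p c
            using that by (simp add: P_def blocks_at_def)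
          show "P (Inl p)" if "p \<in> V" "c \<in> \<B>" "p \<in> c" "P (Inr c)" for p c
            unfolding P_def sum.case
          proof
            fix d assume d: "d \<in> blocks_at p"
            then have "(c, d) \<in> pairs blocks_at V \<inter> \<B> \<times> \<B>" using that by (auto simp: pairs_def blocks_at_def)
            then have "(c, d) \<in> ?C" using R.cl_incl by blast
            moreover have "(b, c) \<in> ?C" using that by (simp add: P_def)
            ultimately show "(b, d) \<in> ?C" using R.cl_trans by blast
          qed
        qed
        then show "(b, b') \<in> ?C" by (simp add: P_def)
      qed
    qed
  qed (rule finite_points)
qed

end

lemma cyclic_on_card_3:
  assumes cyc: "cyclic_on f A" and A: "card A = 3" and x: "x \<in> A"
  shows "f x \<in> A" "f x \<noteq> x" "f (f x) \<noteq> x" "f (f (f x)) = x" "A = {x, f x, f (f x)}"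
proof -
  have orb: "orbit f y = A" if "y \<in> A" for y using cyc that by (simp add: cyclic_on_alldef)
  have fA: "f y \<in> A" if "y \<in> A" for y using orb[OF that] orbit.base by metis
  have 1: "f y \<noteq> y" if y: "y \<in> A" for y
  proof
    assume "f y = y"
    then have "orbit f y \<subseteq> {y}" by (intro orbit_subset_closed) auto
    then have "card A \<le> card {y}" using orb[OF y] by (intro card_mono) auto
    then show False using A by simp
  qed
  have 2: "f (f y) \<noteq> y" if y: "y \<in> A" for y
  proof
    assume "f (f y) = y"
    then have "orbit f y \<subseteq> {y, f y}" by (intro orbit_subset_closed) auto
    then have "card A \<le> card {y, f y}" using orb[OF y] by (intro card_mono) auto
    then show False using A 1[OF y] by simp
  qed
  show "f x \<in> A" "f x \<noteq> x" "f (f x) \<noteq> x" using fA 1 2 x by blast+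
  have "card {x, f x, f (f x)} = 3" using 1[OF x] 2[OF x] 1[OF fA[OF x]] by auto
  moreover have "{x, f x, f (f x)} \<subseteq> A" using fA x by blast
  moreover have "finite A" using A card.infinite by fastforce
  ultimately show AA: "A = {x, f x, f (f x)}" using card_subset_eq A by metis
  have "f (f (f x)) \<in> A" using fA x by blast
  then show "f (f (f x)) = x"
    using AA 1[OF fA[OF fA[OF x]]] 2[OF fA[OF x]] by auto
qed

section \<open>Flags and partial rotations\<close>

locale oriented_configuration = symmetric_configuration v V \<B>
  for v :: nat and V :: "'a set" and \<B> :: "'a set set" +
  fixes \<sigma> :: "'a set \<Rightarrow> 'a \<Rightarrow> 'a"
  assumes orientation: "triple_orientation \<B> \<sigma>"
    and connected_levi: "connected_configuration V \<B>"
    and odd_v: "odd v" and v_ge: "7 \<le> v" and v_le: "v \<le> 19"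
begin

sublocale H: linear_cubic_hypergraph \<B> blocks_at V
  by (rule linear_cubic_hypergraph_blocks[OF connected_levi odd_v v_ge v_le])

text \<open>In a cyclic order of three elements the predecessor is the second successor.\<close>

definition pre :: "'a set \<Rightarrow> 'a \<Rightarrow> 'a" where
  "pre b x = \<sigma> b (\<sigma> b x)"

lemma cyclic_block: "b \<in> \<B> \<Longrightarrow> cyclic_on (\<sigma> b) b"
  using orientation by (simp add: triple_orientation_def)

lemma block_cycle:
  assumes "b \<in> \<B>" "x \<in> b"
  shows "\<sigma> b x \<in> b" "pre b x \<in> b" "\<sigma> b x \<noteq> x" "pre b x \<noteq> x" "pre b x \<noteq> \<sigma> b x"
    "\<sigma> b (pre b x) = x" "pre b (\<sigma> b x) = x" "b = {x, \<sigma> b x, pre b x}"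
proof -
  note c = cyclic_on_card_3[OF cyclic_block[OF assms(1)] block_size[OF assms(1)]]
  show 1: "\<sigma> b x \<in> b" by (rule c(1)[OF assms(2)])
  show "pre b x \<in> b" unfolding pre_def by (rule c(1)[OF 1])
  show "\<sigma> b x \<noteq> x" "pre b x \<noteq> x" "\<sigma> b (pre b x) = x" "pre b (\<sigma> b x) = x" "b = {x, \<sigma> b x, pre b x}"
    unfolding pre_def by (rule c[OF assms(2)])+
  show "pre b x \<noteq> \<sigma> b x" unfolding pre_def by (rule c(2)[OF 1])
qed

definition flags :: "('a \<times> 'a set) set" where
  "flags = {(p, b). b \<in> \<B> \<and> p \<in> b}"

text \<open>A flag \<open>(x, b)\<close> stands for the arc \<open>(x, pre b x)\<close> of the block
  triangle traversed backwards, and \<open>turn\<close> steps to the next such arc. Fixing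
  everything else makes it a permutation.\<close>

definition turn :: "'a \<times> 'a set \<Rightarrow> 'a \<times> 'a set" where
  "turn u = (if u \<in> flags then (pre (snd u) (fst u), snd u) else u)"

lemma finite_flags: "finite flags"
proof -
  have "flags \<subseteq> V \<times> \<B>" using block_subset by (auto simp: flags_def)
  then show ?thesis using finite_points finite_blocks by (metis finite_SigmaI finite_subset)
qed

lemma turn_permutes: "turn permutes flags"
proof (rule bij_imp_permutes)
  have "inj_on turn flags"
  proof (rule inj_onI)
    fix u w assume u: "u \<in> flags" and w: "w \<in> flags" and eq: "turn u = turn w"
    obtain x b where u': "u = (x, b)" "b \<in> \<B>" "x \<in> b" using u by (auto simp: flags_def)
    obtain y c where w': "w = (y, c)" "c \<in> \<B>" "y \<in> c" using w by (auto simp: flags_def)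
    have "pre b x = pre c y" and bc: "b = c" using eq u w u'(1) w'(1) by (auto simp: turn_def)
    then have "\<sigma> b (pre b x) = \<sigma> c (pre c y)" by simp
    then have "x = y" unfolding block_cycle(6)[OF u'(2,3)] block_cycle(6)[OF w'(2,3)] .
    then show "u = w" using u'(1) w'(1) bc by simp
  qed
  moreover have "turn ` flags \<subseteq> flags" by (auto simp: turn_def flags_def block_cycle)
  ultimately show "bij_betw turn flags flags"
    by (simp add: bij_betw_def endo_inj_surj finite_flags)
  show "turn u = u" if "u \<notin> flags" for u using that by (simp add: turn_def)
qed

text \<open>Only the points of \<open>Y\<close> have received a rotation. At any other point
  \<open>\<pi>\<close> is the identity and the walk \<open>\<pi> \<circ> turn\<close> stays in its
  block, as if the blocks were not yet glued together there.\<close>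

definition partial_rotation :: "'a set \<Rightarrow> ('a \<times> 'a set \<Rightarrow> 'a \<times> 'a set) \<Rightarrow> bool" where
  "partial_rotation Y \<pi> \<longleftrightarrow> \<pi> permutes flags \<and>
     (\<forall>u. fst u \<notin> Y \<longrightarrow> \<pi> u = u) \<and>
     (\<forall>p\<in>Y. \<exists>b1 b2 b3. distinct [b1, b2, b3] \<and> blocks_at p = {b1, b2, b3} \<and>
        \<pi> (p, b1) = (p, b2) \<and> \<pi> (p, b2) = (p, b3) \<and> \<pi> (p, b3) = (p, b1))"

lemma partial_rotationE:
  assumes rot: "partial_rotation Y \<pi>" and p: "p \<in> Y"
  obtains b1 b2 b3 where "distinct [b1, b2, b3]" "blocks_at p = {b1, b2, b3}"
    "\<pi> (p, b1) = (p, b2)" "\<pi> (p, b2) = (p, b3)" "\<pi> (p, b3) = (p, b1)"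
proof -
  from rot have "\<forall>p\<in>Y. \<exists>b1 b2 b3. distinct [b1, b2, b3] \<and> blocks_at p = {b1, b2, b3} \<and>
      \<pi> (p, b1) = (p, b2) \<and> \<pi> (p, b2) = (p, b3) \<and> \<pi> (p, b3) = (p, b1)"
    unfolding partial_rotation_def by (elim conjE)
  from bspec[OF this p] show ?thesis by (elim exE conjE) (rule that)
qed

lemma partial_rotation_other: "partial_rotation Y \<pi> \<Longrightarrow> fst u \<notin> Y \<Longrightarrow> \<pi> u = u"
  unfolding partial_rotation_def by (elim conjE allE[of _ u] impE)

lemma partial_rotation_permutes: "partial_rotation Y \<pi> \<Longrightarrow> \<pi> permutes flags"
  by (simp add: partial_rotation_def)

lemma partial_rotation_empty: "partial_rotation {} id"
  by (simp add: partial_rotation_def permutes_id)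

lemma three_blocks:
  assumes "p \<in> V"
  obtains b1 b2 b3 where "distinct [b1, b2, b3]" "blocks_at p = {b1, b2, b3}"
    "(p, b1) \<in> flags" "(p, b2) \<in> flags" "(p, b3) \<in> flags"
proof -
  have "card (blocks_at p) = 3" by (rule H.N_card[OF assms])
  then obtain b1 b2 b3 where b: "blocks_at p = {b1, b2, b3}" "b1 \<noteq> b2" "b1 \<noteq> b3" "b2 \<noteq> b3"
    by (auto simp: card_3_iff)
  have "(p, b) \<in> flags" if "b \<in> blocks_at p" for b using that by (simp add: blocks_at_def flags_def)
  then show ?thesis using that b by auto
qed

lemma partial_rotation_insert:
  assumes rot: "partial_rotation Y \<pi>" and p: "p \<notin> Y"
    and b: "distinct [b1, b2, b3]" "blocks_at p = {b1, b2, b3}"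
      "(p, b1) \<in> flags" "(p, b2) \<in> flags" "(p, b3) \<in> flags"
  shows "partial_rotation (insert p Y) (three_cycle (p, b1) (p, b2) (p, b3) \<circ> \<pi>)"
proof -
  let ?t = "three_cycle (p, b1) (p, b2) (p, b3)"
  have d: "distinct [(p, b1), (p, b2), (p, b3)]" using b(1) by simp
  have other: "?t u = u" if "fst u \<noteq> p" for u
    by (rule three_cycle_simps(4)[OF d]) (use that in auto)
  have idp: "\<pi> (p, c) = (p, c)" for c by (rule partial_rotation_other[OF rot]) (use p in simp)
  show ?thesis
    unfolding partial_rotation_def
  proof (intro conjI allI impI ballI)
    show "(?t \<circ> \<pi>) permutes flags"
      by (rule three_cycle_permutes[OF partial_rotation_permutes[OF rot] b(3-5)])
    show "(?t \<circ> \<pi>) u = u" if "fst u \<notin> insert p Y" for u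
    proof -
      have "\<pi> u = u" using that partial_rotation_other[OF rot, of u] by simp
      then show ?thesis using that other[of u] by simp
    qed
    fix q assume q: "q \<in> insert p Y"
    show "\<exists>b1 b2 b3. distinct [b1, b2, b3] \<and> blocks_at q = {b1, b2, b3} \<and>
        (?t \<circ> \<pi>) (q, b1) = (q, b2) \<and> (?t \<circ> \<pi>) (q, b2) = (q, b3) \<and> (?t \<circ> \<pi>) (q, b3) = (q, b1)"
    proof (cases "q = p")
      case True
      show ?thesis unfolding True
      proof (intro exI conjI)
        show "distinct [b1, b2, b3]" "blocks_at p = {b1, b2, b3}" by fact+
        show "(?t \<circ> \<pi>) (p, b1) = (p, b2)" "(?t \<circ> \<pi>) (p, b2) = (p, b3)" "(?t \<circ> \<pi>) (p, b3) = (p, b1)"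
          unfolding comp_apply idp by (rule three_cycle_simps(1-3)[OF d])+
      qed
    next
      case False
      then have "q \<in> Y" using q by blast
      then obtain c1 c2 c3 where c: "distinct [c1, c2, c3]" "blocks_at q = {c1, c2, c3}"
        and cyc: "\<pi> (q, c1) = (q, c2)" "\<pi> (q, c2) = (q, c3)" "\<pi> (q, c3) = (q, c1)"
        using partial_rotationE[OF rot] by metis
      have t: "?t (q, e) = (q, e)" for e by (rule other) (use False in simp)
      show ?thesis
      proof (intro exI conjI)
        show "distinct [c1, c2, c3]" "blocks_at q = {c1, c2, c3}" by fact+
        show "(?t \<circ> \<pi>) (q, c1) = (q, c2)" "(?t \<circ> \<pi>) (q, c2) = (q, c3)" "(?t \<circ> \<pi>) (q, c3) = (q, c1)"
          unfolding comp_apply cyc by (rule t)+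
      qed
    qed
  qed
qed

lemma comp_turn_permutes: "partial_rotation Y \<pi> \<Longrightarrow> (\<pi> \<circ> turn) permutes flags"
  by (rule permutes_compose[OF turn_permutes partial_rotation_permutes])

text \<open>\<open>turn\<close> keeps the block, and \<open>\<pi>\<close> changes it only to a block
  at the same point of \<open>Y\<close>. Consequently flags whose blocks are not connected through
  \<open>Y\<close> lie on different orbits, as merging requires.\<close>

lemma orbit_upper:
  assumes rot: "partial_rotation Y \<pi>" and Y: "Y \<subseteq> V" and u: "u \<in> flags" and w: "w \<in> orbit (\<pi> \<circ> turn) u"
  shows "(snd u, snd w) \<in> H.cl (pairs blocks_at Y)"
proof -
  let ?C = "H.cl (pairs blocks_at Y)"
  let ?A = "{w \<in> flags. (snd u, snd w) \<in> ?C}"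
  have perm: "turn permutes flags" "\<pi> permutes flags" by (rule turn_permutes, rule partial_rotation_permutes[OF rot])
  have step: "(snd w, snd (\<pi> w)) \<in> ?C" if w: "w \<in> flags" for w
  proof -
    obtain p b where pb: "w = (p, b)" "b \<in> \<B>" using w by (auto simp: flags_def)
    show ?thesis
    proof (cases "p \<in> Y")
      case False
      then have "\<pi> w = w" using partial_rotation_other[OF rot, of w] pb(1) by simp
      then show ?thesis using pb H.cl_refl by simp
    next
      case True
      then obtain c1 c2 c3 where c: "blocks_at p = {c1, c2, c3}"
        "\<pi> (p, c1) = (p, c2)" "\<pi> (p, c2) = (p, c3)" "\<pi> (p, c3) = (p, c1)"
        using partial_rotationE[OF rot] by metis
      have "b \<in> blocks_at p" using w pb by (simp add: flags_def blocks_at_def)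
      then have "b \<in> {c1, c2, c3}" unfolding c(1) .
      then have "\<pi> (p, b) \<in> {(p, c1), (p, c2), (p, c3)}" using c(2-4) by (elim insertE emptyE) simp_all
      then have "snd (\<pi> w) \<in> blocks_at p" unfolding pb(1) c(1) by fastforce
      then have "(snd w, snd (\<pi> w)) \<in> pairs blocks_at Y"
        using \<open>b \<in> blocks_at p\<close> True pb(1) by (auto simp: pairs_def)
      moreover have "snd (\<pi> w) \<in> \<B>" using \<open>snd (\<pi> w) \<in> blocks_at p\<close> by (simp add: blocks_at_def)
      ultimately show ?thesis using H.cl_incl[of "pairs blocks_at Y"] pb by auto
    qed
  qed
  have "orbit (\<pi> \<circ> turn) u \<subseteq> ?A"
  proof (rule orbit_subset_closed)
    have "snd u \<in> \<B>" using u by (auto simp: flags_def)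
    then show "u \<in> ?A" using u H.cl_refl by simp
    fix w assume "w \<in> ?A"
    then have w: "w \<in> flags" "(snd u, snd w) \<in> ?C" by auto
    have tw: "turn w \<in> flags" using perm(1) w(1) by (simp add: permutes_in_image)
    moreover have "snd (turn w) = snd w" by (simp add: turn_def)
    ultimately have "(snd u, snd (\<pi> (turn w))) \<in> ?C" using step[OF tw] w(2) H.cl_trans by metis
    moreover have "\<pi> (turn w) \<in> flags" using perm(2) tw by (simp add: permutes_in_image)
    ultimately show "(\<pi> \<circ> turn) w \<in> ?A" by simp
  qed
  then show ?thesis using w by blast
qed

lemma orbit_turn:
  assumes "(p, b) \<in> flags" "(q, b) \<in> flags"
  shows "(q, b) \<in> orbit turn (p, b)"
proof -
  have b: "b \<in> \<B>" "p \<in> b" "q \<in> b" using assms by (auto simp: flags_def)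
  have "turn (p, b) = (pre b p, b)" using assms by (simp add: turn_def)
  then have 1: "(pre b p, b) \<in> orbit turn (p, b)" using orbit.base[of turn "(p, b)"] by simp
  have "pre b (pre b p) = \<sigma> b p" using block_cycle(6)[OF b(1,2)] by (simp add: pre_def)
  moreover have "(pre b p, b) \<in> flags" using b block_cycle by (simp add: flags_def)
  ultimately have "turn (pre b p, b) = (\<sigma> b p, b)" by (simp add: turn_def)
  then have 2: "(\<sigma> b p, b) \<in> orbit turn (p, b)" using orbit.step[OF 1] by simp
  have 3: "(p, b) \<in> orbit turn (p, b)"
    by (rule permutes_self_in_orbit[OF finite_flags turn_permutes])
  have "q \<in> {p, \<sigma> b p, pre b p}" using block_cycle(8)[OF b(1,2)] b(3) by blast
  then show ?thesis using 1 2 3 by auto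
qed

text \<open>Adding the points of a spanning hypertree one at a time merges three orbits each time.\<close>

lemma hypertree_orbits:
  assumes M: "M \<subseteq> V" "H.inc {} (pairs blocks_at M) = 2 * card M" and Y: "finite Y" "Y \<subseteq> M"
  shows "\<exists>\<pi>. partial_rotation Y \<pi> \<and> (\<forall>u. orbit turn u \<subseteq> orbit (\<pi> \<circ> turn) u) \<and>
    (\<forall>p\<in>Y. \<forall>b\<in>blocks_at p. \<forall>c\<in>blocks_at p. (p, c) \<in> orbit (\<pi> \<circ> turn) (p, b))"
  using Y
proof (induction Y rule: finite_induct)
  case empty
  show ?case
  proof (intro exI conjI)
    show "partial_rotation {} id" by (rule partial_rotation_empty)
  qed simp_all
next
  case (insert p Y)
  then obtain \<pi> where rot: "partial_rotation Y \<pi>"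
    and up: "\<And>u. orbit turn u \<subseteq> orbit (\<pi> \<circ> turn) u"
    and same: "\<And>q b c. q \<in> Y \<Longrightarrow> b \<in> blocks_at q \<Longrightarrow> c \<in> blocks_at q \<Longrightarrow> (q, c) \<in> orbit (\<pi> \<circ> turn) (q, b)"
    by (metis insert_subset)
  have pV: "p \<in> V" and YV: "Y \<subseteq> V" using insert.prems M(1) by auto
  obtain b1 b2 b3 where b: "distinct [b1, b2, b3]" "blocks_at p = {b1, b2, b3}"
    "(p, b1) \<in> flags" "(p, b2) \<in> flags" "(p, b3) \<in> flags" using three_blocks[OF pV] .
  \<comment> \<open>The increments of \<open>Y\<close>, of \<open>p\<close> and of the remaining
    points add up to \<open>2 * card M\<close>, with at most 2 per point. So \<open>p\<close>
    contributes its full 2, which means that its three blocks lie in different classes.\<close>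
  have inc2: "2 \<le> H.inc (pairs blocks_at Y) (blocks_at p \<times> blocks_at p)"
  proof -
    let ?Z = "M - insert p Y"
    have le: "H.inc A (pairs blocks_at W) \<le> 2 * card W" if "W \<subseteq> M" for A W
    proof -
      have "W \<subseteq> V" using that M(1) by blast
      then show ?thesis using H.inc_pairs_le[of W blocks_at A] H.N_V H.N_card finite_points finite_subset
        by (metis order_refl subsetD)
    qed
    have finM: "finite M" using M(1) finite_points finite_subset by blast
    have MY: "M = Y \<union> ({p} \<union> ?Z)" using insert.prems by blast
    have "card M = card Y + (1 + card ?Z)"
    proof -
      have "card ({p} \<union> ?Z) = 1 + card ?Z" using finM by simp
      moreover have "card (Y \<union> ({p} \<union> ?Z)) = card Y + card ({p} \<union> ?Z)"
        by (rule card_Un_disjoint) (use insert.hyps finM in auto)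
      ultimately show ?thesis using MY by metis
    qed
    moreover have "H.inc {} (pairs blocks_at M) = H.inc {} (pairs blocks_at Y) +
        (H.inc (pairs blocks_at Y) (pairs blocks_at {p}) + H.inc (pairs blocks_at Y \<union> pairs blocks_at {p}) (pairs blocks_at ?Z))"
      by (subst MY) (simp only: pairs_Un H.inc_Un Un_empty_left)
    moreover have "H.inc {} (pairs blocks_at Y) \<le> 2 * card Y" by (rule le) (use insert.prems in blast)
    moreover have "H.inc (pairs blocks_at Y \<union> pairs blocks_at {p}) (pairs blocks_at ?Z) \<le> 2 * card ?Z"
      by (rule le) blast
    moreover have "pairs blocks_at {p} = blocks_at p \<times> blocks_at p" by (simp add: pairs_def)
    ultimately show ?thesis using M(2) by simp
  qed
  let ?C = "H.cl (pairs blocks_at Y)"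
  have card3: "3 \<le> card ((\<lambda>x. ?C `` {x}) ` {b1, b2, b3})"
  proof -
    have "blocks_at p \<subseteq> \<B>" "blocks_at p \<noteq> {}" using b by (auto simp: blocks_at_def)
    from H.rk_Un_square[OF this, of "pairs blocks_at Y"]
    show ?thesis using inc2 unfolding H.rk_inc b(2) by simp
  qed
  have notC: "(c, d) \<notin> ?C" if "c \<in> {b1, b2, b3}" "d \<in> {b1, b2, b3}" "c \<noteq> d" for c d
  proof
    assume "(c, d) \<in> ?C"
    then have eq: "?C `` {c} = ?C `` {d}" by (rule equiv_class_eq[OF H.equiv_cl])
    have "(\<lambda>x. ?C `` {x}) ` {b1, b2, b3} = (\<lambda>x. ?C `` {x}) ` ({b1, b2, b3} - {c})"
    proof
      show "(\<lambda>x. ?C `` {x}) ` {b1, b2, b3} \<subseteq> (\<lambda>x. ?C `` {x}) ` ({b1, b2, b3} - {c})"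
      proof
        fix z assume "z \<in> (\<lambda>x. ?C `` {x}) ` {b1, b2, b3}"
        then obtain x where x: "x \<in> {b1, b2, b3}" "z = ?C `` {x}" by blast
        show "z \<in> (\<lambda>x. ?C `` {x}) ` ({b1, b2, b3} - {c})"
        proof (cases "x = c")
          case True
          then show ?thesis using x eq that by (intro image_eqI[of _ _ d]) auto
        next
          case False
          then show ?thesis using x by blast
        qed
      qed
    qed blast
    then have "3 \<le> card ({b1, b2, b3} - {c})"
      using card3 card_image_le[of "{b1, b2, b3} - {c}" "\<lambda>x. ?C `` {x}"] by simp
    moreover have "card ({b1, b2, b3} - {c}) < card {b1, b2, b3}"
      by (rule card_Diff1_less) (use that in auto)
    moreover have "card {b1, b2, b3} \<le> 3" by (simp add: card_insert_if)
    ultimately show False by simp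
  qed
  let ?f = "\<pi> \<circ> turn" and ?t = "three_cycle (p, b1) (p, b2) (p, b3)"
  have diff: "(p, c) \<notin> orbit ?f (p, d)" if cd: "c \<in> {b1, b2, b3}" "d \<in> {b1, b2, b3}" "c \<noteq> d" for c d
  proof
    assume "(p, c) \<in> orbit ?f (p, d)"
    moreover have "(p, d) \<in> flags" using cd b by auto
    ultimately have "(d, c) \<in> ?C" using orbit_upper[OF rot YV] by fastforce
    then show False using notC[of d c] cd by blast
  qed
  have d: "(p, b2) \<notin> orbit ?f (p, b3)" "(p, b1) \<notin> orbit ?f (p, b2)" "(p, b1) \<notin> orbit ?f (p, b3)"
    using diff b(1) by auto
  note merge = three_cycle_merge[OF finite_flags comp_turn_permutes[OF rot] b(3-5) d]
  have rot': "partial_rotation (insert p Y) (?t \<circ> \<pi>)"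
    by (rule partial_rotation_insert[OF rot insert.hyps(2) b])
  note perm' = comp_turn_permutes[OF rot', unfolded comp_assoc]
  note sym' = permutes_orbit_sym[OF finite_flags perm'] and self' = permutes_self_in_orbit[OF finite_flags perm']
  have star: "(p, c) \<in> orbit (?t \<circ> ?f) (p, b1)" if "c \<in> blocks_at p" for c
    using that[unfolded b(2)] by (elim insertE emptyE) (simp_all only: merge(2,3) self')
  have same': "(q, c) \<in> orbit (?t \<circ> ?f) (q, b)" if "q \<in> insert p Y" "b \<in> blocks_at q" "c \<in> blocks_at q" for q b c
  proof (cases "q = p")
    case True
    then have "(p, b1) \<in> orbit (?t \<circ> ?f) (p, b)" using star[of b] that(2) sym' by simp
    then show ?thesis using orbit_trans[OF star[of c]] that(3) True by simp
  next
    case False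
    then have "(q, c) \<in> orbit ?f (q, b)" using that by (intro same) auto
    then show ?thesis using merge(1) by blast
  qed
  have eq: "?t \<circ> \<pi> \<circ> turn = ?t \<circ> ?f" by (rule comp_assoc)
  show ?case
  proof (intro exI conjI)
    show "partial_rotation (insert p Y) (?t \<circ> \<pi>)" by (rule rot')
    show "\<forall>u. orbit turn u \<subseteq> orbit (?t \<circ> \<pi> \<circ> turn) u" unfolding eq using up merge(1) by blast
    show "\<forall>q\<in>insert p Y. \<forall>b\<in>blocks_at q. \<forall>c\<in>blocks_at q. (q, c) \<in> orbit (?t \<circ> \<pi> \<circ> turn) (q, b)"
      unfolding eq using same' by blast
  qed
qed

lemma single_orbit_rotation:
  "\<exists>\<pi>. partial_rotation V \<pi> \<and> (\<forall>u\<in>flags. \<forall>w\<in>flags. u \<in> orbit (\<pi> \<circ> turn) w)"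
proof -
  obtain M where M: "M \<subseteq> V" "2 * card M + 1 = card \<B>" "H.cl (pairs blocks_at M) = \<B> \<times> \<B>"
    "H.inc {} (pairs blocks_at M) = 2 * card M" by (rule H.spanning_hypertree)
  have finM: "finite M" using M(1) finite_points finite_subset by blast
  from hypertree_orbits[OF M(1,4) finM subset_refl] obtain \<pi> where
    rot: "partial_rotation M \<pi>" and up: "\<forall>u. orbit turn u \<subseteq> orbit (\<pi> \<circ> turn) u"
    and same: "\<forall>p\<in>M. \<forall>b\<in>blocks_at p. \<forall>c\<in>blocks_at p. (p, c) \<in> orbit (\<pi> \<circ> turn) (p, b)"
    by (elim exE conjE)
  let ?f = "\<pi> \<circ> turn"
  note perm = comp_turn_permutes[OF rot]
  note sym = permutes_orbit_sym[OF finite_flags perm]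
  \<comment> \<open>Pairs of blocks whose flags all share an orbit. This equivalence contains the
    cliques of \<open>M\<close>, hence their closure, which is everything.\<close>
  define S where "S = {(b, c). b \<in> \<B> \<and> c \<in> \<B> \<and> (\<forall>p\<in>b. \<forall>q\<in>c. (q, c) \<in> orbit ?f (p, b))}"
  have ne: "b \<noteq> {}" if "b \<in> \<B>" for b using block_size[OF that] by auto
  have within: "(q, b) \<in> orbit ?f (p, b)" if "b \<in> \<B>" "p \<in> b" "q \<in> b" for p q b
  proof -
    have "(q, b) \<in> orbit turn (p, b)" using that by (intro orbit_turn) (simp_all add: flags_def)
    then show ?thesis using up by blast
  qed
  have "equiv \<B> S"
  proof (rule equivI)
    show "S \<subseteq> \<B> \<times> \<B>" by (auto simp: S_def)
    show "refl_on \<B> S" using within by (auto simp: S_def refl_on_def)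
    show "sym S" using sym by (auto simp: S_def sym_def)
    show "trans S"
    proof (rule transI)
      fix a b c assume ab: "(a, b) \<in> S" and bc: "(b, c) \<in> S"
      then have "b \<in> \<B>" by (simp add: S_def)
      then obtain q where q: "q \<in> b" using ne by blast
      have "(r, c) \<in> orbit ?f (p, a)" if "p \<in> a" "r \<in> c" for p r
      proof (rule orbit_trans)
        show "(r, c) \<in> orbit ?f (q, b)" using bc q that by (simp add: S_def)
        show "(q, b) \<in> orbit ?f (p, a)" using ab q that by (simp add: S_def)
      qed
      then show "(a, c) \<in> S" using ab bc by (auto simp: S_def)
    qed
  qed
  moreover have "pairs blocks_at M \<inter> \<B> \<times> \<B> \<subseteq> S"
  proof
    fix e assume "e \<in> pairs blocks_at M \<inter> \<B> \<times> \<B>"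
    then obtain s b c where s: "e = (b, c)" "s \<in> M" "b \<in> blocks_at s" "c \<in> blocks_at s" by (auto simp: pairs_def)
    then have bc: "b \<in> \<B>" "c \<in> \<B>" "s \<in> b" "s \<in> c" by (auto simp: blocks_at_def)
    have "(q, c) \<in> orbit ?f (p, b)" if "p \<in> b" "q \<in> c" for p q
    proof -
      have "(s, c) \<in> orbit ?f (s, b)" using same s by blast
      from orbit_trans[OF orbit_trans[OF within[OF bc(2,4) that(2)] this] within[OF bc(1) that(1) bc(3)]]
      show ?thesis .
    qed
    then show "e \<in> S" using bc s(1) by (auto simp: S_def)
  qed
  ultimately have "\<B> \<times> \<B> \<subseteq> S" using H.cl_least unfolding M(3)[symmetric] by blast
  then have all: "u \<in> orbit ?f w" if "u \<in> flags" "w \<in> flags" for u w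
    using that by (auto simp: flags_def S_def)
  have "\<exists>\<pi>. partial_rotation (M \<union> Y) \<pi> \<and> (\<forall>u\<in>flags. \<forall>w\<in>flags. u \<in> orbit (\<pi> \<circ> turn) w)"
    if "finite Y" "Y \<subseteq> V - M" for Y
    using that
  proof (induction Y rule: finite_induct)
    case empty
    show ?case
    proof (intro exI conjI ballI)
      show "partial_rotation (M \<union> {}) \<pi>" using rot by simp
      show "u \<in> orbit (\<pi> \<circ> turn) w" if "u \<in> flags" "w \<in> flags" for u w by (rule all[OF that])
    qed
  next
    case (insert p Y)
    have "Y \<subseteq> V - M" using insert.prems by blast
    from insert.IH[OF this] obtain \<pi>' where rot': "partial_rotation (M \<union> Y) \<pi>'"
      and all': "\<forall>u\<in>flags. \<forall>w\<in>flags. u \<in> orbit (\<pi>' \<circ> turn) w"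
      by (elim exE conjE)
    have pV: "p \<in> V" and pY: "p \<notin> M \<union> Y" using insert by auto
    obtain b1 b2 b3 where b: "distinct [b1, b2, b3]" "blocks_at p = {b1, b2, b3}"
      "(p, b1) \<in> flags" "(p, b2) \<in> flags" "(p, b3) \<in> flags" using three_blocks[OF pV] .
    have b': "distinct [b1, b3, b2]" "blocks_at p = {b1, b3, b2}" using b by auto
    have d: "distinct [(p, b1), (p, b2), (p, b3)]" using b(1) by simp
    have r1: "partial_rotation (M \<union> insert p Y) (three_cycle (p, b1) (p, b2) (p, b3) \<circ> \<pi>')"
      using partial_rotation_insert[OF rot' pY b] by simp
    have r2: "partial_rotation (M \<union> insert p Y) (three_cycle (p, b1) (p, b3) (p, b2) \<circ> \<pi>')"
      using partial_rotation_insert[OF rot' pY b' b(3,5,4)] by simp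
    from three_cycle_single_orbit[OF finite_flags comp_turn_permutes[OF rot'] b(3-5) d all'[rule_format]]
    show ?case
    proof
      assume "\<forall>u\<in>flags. \<forall>w\<in>flags. u \<in> orbit (three_cycle (p, b1) (p, b2) (p, b3) \<circ> (\<pi>' \<circ> turn)) w"
      then show ?case using r1 unfolding comp_assoc[symmetric] by (intro exI conjI)
    next
      assume "\<forall>u\<in>flags. \<forall>w\<in>flags. u \<in> orbit (three_cycle (p, b1) (p, b3) (p, b2) \<circ> (\<pi>' \<circ> turn)) w"
      then show ?case using r2 unfolding comp_assoc[symmetric] by (intro exI conjI)
    qed
  qed
  from this[OF finite_Diff[OF finite_points] subset_refl] show ?thesis
    unfolding Un_Diff_cancel Un_absorb1[OF M(1)] .
qed

section \<open>The rotation system of an upper embedding\<close>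

abbreviation K :: "'a pair_pre_digraph" where "K \<equiv> associated_graph V \<B>"

text \<open>The two sets are going to be the arcs of the block faces and the arcs of the outer
  face.\<close>

lemma parcs_K: "parcs K = {(x, \<sigma> b x) | x b. (x, b) \<in> flags} \<union> {(x, pre b x) | x b. (x, b) \<in> flags}"
proof
  show "parcs K \<subseteq> {(x, \<sigma> b x) | x b. (x, b) \<in> flags} \<union> {(x, pre b x) | x b. (x, b) \<in> flags}"
  proof
    fix e assume "e \<in> parcs K"
    then obtain x y b where e: "e = (x, y)" "x \<noteq> y" "b \<in> \<B>" "x \<in> b" "y \<in> b"
      by (auto simp: associated_graph_def)
    have "y \<in> {x, \<sigma> b x, pre b x}" using e(5) unfolding block_cycle(8)[OF e(3,4), symmetric] .
    then have "y = \<sigma> b x \<or> y = pre b x" using e(2) by simp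
    then show "e \<in> {(x, \<sigma> b x) | x b. (x, b) \<in> flags} \<union> {(x, pre b x) | x b. (x, b) \<in> flags}"
      using e by (auto simp: flags_def)
  qed
  have "(x, \<sigma> b x) \<in> parcs K \<and> (x, pre b x) \<in> parcs K" if "(x, b) \<in> flags" for x b
  proof -
    have b: "b \<in> \<B>" "x \<in> b" using that by (auto simp: flags_def)
    note c = block_cycle[OF b]
    have "x \<in> V" "\<sigma> b x \<in> V" "pre b x \<in> V" using block_subset[OF b(1)] b(2) c(1,2) by blast+
    then show ?thesis using b c(1-4) by (auto simp: associated_graph_def)
  qed
  then show "{(x, \<sigma> b x) | x b. (x, b) \<in> flags} \<union> {(x, pre b x) | x b. (x, b) \<in> flags} \<subseteq> parcs K" by blast
qed

text \<open>Well defined on arcs by linearity.\<close>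

definition block_of :: "'a \<times> 'a \<Rightarrow> 'a set" where
  "block_of e = (THE b. b \<in> \<B> \<and> fst e \<in> b \<and> snd e \<in> b)"

lemma block_of_eq:
  assumes "b \<in> \<B>" "x \<in> b" "y \<in> b" "x \<noteq> y"
  shows "block_of (x, y) = b"
  unfolding block_of_def
proof (rule the_equality)
  show "b \<in> \<B> \<and> fst (x, y) \<in> b \<and> snd (x, y) \<in> b" using assms by simp
  fix c assume "c \<in> \<B> \<and> fst (x, y) \<in> c \<and> snd (x, y) \<in> c"
  then show "c = b" using assms block_unique[of c b x y] by simp
qed

text \<open>
  At a point \<open>x\<close> the two arcs of a block \<open>b\<close> are consecutive, and the second one is followed by the
  first arc of the block that comes after \<open>b\<close> in the rotation \<open>\<pi>\<close>.
\<close>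

definition rotation :: "('a \<times> 'a set \<Rightarrow> 'a \<times> 'a set) \<Rightarrow> 'a \<times> 'a \<Rightarrow> 'a \<times> 'a" where
  "rotation \<pi> e = (let x = fst e; b = block_of e in
     if snd e = \<sigma> b x then (x, pre (snd (\<pi> (x, b))) x) else (x, \<sigma> b x))"

lemma rotation_simps:
  assumes "(x, b) \<in> flags"
  shows "rotation \<pi> (x, \<sigma> b x) = (x, pre (snd (\<pi> (x, b))) x)"
    and "rotation \<pi> (x, pre b x) = (x, \<sigma> b x)"
proof -
  have b: "b \<in> \<B>" "x \<in> b" using assms by (auto simp: flags_def)
  note c = block_cycle[OF b]
  have "block_of (x, \<sigma> b x) = b" "block_of (x, pre b x) = b"
    by (rule block_of_eq[OF b c(1) c(3)[symmetric]], rule block_of_eq[OF b c(2) c(4)[symmetric]])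
  then show "rotation \<pi> (x, \<sigma> b x) = (x, pre (snd (\<pi> (x, b))) x)"
    "rotation \<pi> (x, pre b x) = (x, \<sigma> b x)"
    using c(5) by (simp_all add: rotation_def)
qed

context
  fixes \<pi> :: "'a \<times> 'a set \<Rightarrow> 'a \<times> 'a set"
  assumes rot: "partial_rotation V \<pi>"
    and single: "\<And>u w. u \<in> flags \<Longrightarrow> w \<in> flags \<Longrightarrow> u \<in> orbit (\<pi> \<circ> turn) w"
begin

lemma flag_V: "(x, b) \<in> flags \<Longrightarrow> x \<in> V"
  using block_subset by (auto simp: flags_def)

lemma fst_rotation: "(x, b) \<in> flags \<Longrightarrow> fst (\<pi> (x, b)) = x"
proof -
  assume xb: "(x, b) \<in> flags"
  obtain b1 b2 b3 where "blocks_at x = {b1, b2, b3}"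
    "\<pi> (x, b1) = (x, b2)" "\<pi> (x, b2) = (x, b3)" "\<pi> (x, b3) = (x, b1)"
    using partial_rotationE[OF rot flag_V[OF xb]] by metis
  moreover have "b \<in> blocks_at x" using xb by (simp add: flags_def blocks_at_def)
  ultimately show ?thesis by auto
qed

lemma rotation_flags: "u \<in> flags \<Longrightarrow> \<pi> u \<in> flags"
  using partial_rotation_permutes[OF rot] by (simp add: permutes_in_image)

text \<open>The six arcs are visited block by block, within each block from the \<open>pre\<close>
  arc to the \<open>\<sigma>\<close> arc; the cycle of \<open>\<pi>\<close> on the three blocks
  closes them up.\<close>

lemma cyclic_rotation:
  assumes x: "x \<in> V"
  shows "cyclic_on (rotation \<pi>) (out_arcs (with_proj K) x)"
proof -
  let ?\<rho> = "rotation \<pi>"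
  obtain b1 b2 b3 where b: "blocks_at x = {b1, b2, b3}"
    and \<pi>: "\<pi> (x, b1) = (x, b2)" "\<pi> (x, b2) = (x, b3)" "\<pi> (x, b3) = (x, b1)"
    using partial_rotationE[OF rot x] by metis
  have fl: "(x, c) \<in> flags \<longleftrightarrow> c \<in> {b1, b2, b3}" for c
    unfolding b[symmetric] by (auto simp: flags_def blocks_at_def)
  have f: "(x, b1) \<in> flags" "(x, b2) \<in> flags" "(x, b3) \<in> flags" using fl by auto
  have out: "out_arcs (with_proj K) x = {(x, \<sigma> b1 x), (x, pre b1 x), (x, \<sigma> b2 x), (x, pre b2 x), (x, \<sigma> b3 x), (x, pre b3 x)}"
  proof -
    have "out_arcs (with_proj K) x = {(x, \<sigma> c x) | c. (x, c) \<in> flags} \<union> {(x, pre c x) | c. (x, c) \<in> flags}"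
      unfolding out_arcs_def with_proj_simps parcs_K by auto
    then show ?thesis unfolding fl by auto
  qed
  note r = rotation_simps(2)[OF f(1), of \<pi>] rotation_simps(1)[OF f(1), of \<pi>, unfolded \<pi> snd_conv]
    rotation_simps(2)[OF f(2), of \<pi>] rotation_simps(1)[OF f(2), of \<pi>, unfolded \<pi> snd_conv]
    rotation_simps(2)[OF f(3), of \<pi>] rotation_simps(1)[OF f(3), of \<pi>, unfolded \<pi> snd_conv]
  let ?s = "(x, pre b1 x)"
  have 1: "(x, \<sigma> b1 x) \<in> orbit ?\<rho> ?s" using orbit.base[of ?\<rho> ?s] unfolding r .
  have 2: "(x, pre b2 x) \<in> orbit ?\<rho> ?s" using orbit.step[OF 1] unfolding r .
  have 3: "(x, \<sigma> b2 x) \<in> orbit ?\<rho> ?s" using orbit.step[OF 2] unfolding r .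
  have 4: "(x, pre b3 x) \<in> orbit ?\<rho> ?s" using orbit.step[OF 3] unfolding r .
  have 5: "(x, \<sigma> b3 x) \<in> orbit ?\<rho> ?s" using orbit.step[OF 4] unfolding r .
  have 6: "(x, pre b1 x) \<in> orbit ?\<rho> ?s" using orbit.step[OF 5] unfolding r .
  have "orbit ?\<rho> ?s \<subseteq> out_arcs (with_proj K) x"
    unfolding out by (rule orbit_subset_closed) (auto simp: r)
  moreover have "out_arcs (with_proj K) x \<subseteq> orbit ?\<rho> ?s" unfolding out using 1 2 3 4 5 6 by blast
  moreover have "?s \<in> out_arcs (with_proj K) x" unfolding out by blast
  ultimately show ?thesis unfolding cyclic_on_def by blast
qed

lemma embedding: "cellular_embedding K (rotation \<pi>)"
  unfolding cellular_embedding_def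
proof (intro conjI ballI impI)
  show "finite (pverts K)" using finite_points by (simp add: associated_graph_def)
  show "connected (with_proj K)" by (rule associated_graph_connected[OF connected_levi])
  show "cyclic_on (rotation \<pi>) (out_arcs (with_proj K) x)" if "x \<in> pverts K" for x
    using that by (intro cyclic_rotation) (simp add: associated_graph_def)
qed

section \<open>Faces of the rotation system\<close>

definition block_face :: "'a set \<Rightarrow> ('a \<times> 'a) set" where
  "block_face b = {(x, \<sigma> b x) | x. x \<in> b}"

definition outer_face :: "('a \<times> 'a) set" where
  "outer_face = {(x, pre b x) | x b. (x, b) \<in> flags}"

text \<open>Reversing \<open>(y, \<sigma> b y)\<close> gives the \<open>pre\<close> arc of
  \<open>b\<close> at \<open>\<sigma> b y\<close>, which the rotation sends to the
  \<open>\<sigma>\<close> arc of the same block.\<close>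

lemma orbit_block_face:
  assumes "(x, b) \<in> flags"
  shows "orbit (face_succ (rotation \<pi>)) (x, \<sigma> b x) = block_face b"
proof -
  let ?f = "face_succ (rotation \<pi>)"
  have b: "b \<in> \<B>" "x \<in> b" using assms by (auto simp: flags_def)
  have succ: "?f (y, \<sigma> b y) = (\<sigma> b y, \<sigma> b (\<sigma> b y))" if y: "y \<in> b" for y
  proof -
    have "(\<sigma> b y, b) \<in> flags" using b block_cycle(1)[OF b(1) y] by (simp add: flags_def)
    from rotation_simps(2)[OF this, of \<pi>] show ?thesis
      using block_cycle(7)[OF b(1) y] by (simp add: face_succ_def)
  qed
  have c: "\<sigma> b x \<in> b" "pre b x \<in> b" using block_cycle[OF b] by blast+
  have 1: "(\<sigma> b x, \<sigma> b (\<sigma> b x)) \<in> orbit ?f (x, \<sigma> b x)"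
    using orbit.base[of ?f "(x, \<sigma> b x)"] unfolding succ[OF b(2)] .
  have 2: "(pre b x, \<sigma> b (pre b x)) \<in> orbit ?f (x, \<sigma> b x)"
    using orbit.step[OF 1] unfolding succ[OF c(1)] pre_def .
  have 3: "(x, \<sigma> b x) \<in> orbit ?f (x, \<sigma> b x)"
    using orbit.step[OF 2] succ[OF c(2)] block_cycle(6)[OF b] by simp
  show ?thesis
  proof
    show "orbit ?f (x, \<sigma> b x) \<subseteq> block_face b"
    proof (rule orbit_subset_closed)
      show "(x, \<sigma> b x) \<in> block_face b" using b by (auto simp: block_face_def)
      fix e assume "e \<in> block_face b"
      then obtain y where "y \<in> b" "e = (y, \<sigma> b y)" by (auto simp: block_face_def)
      then show "?f e \<in> block_face b" using succ block_cycle(1)[OF b(1)] by (auto simp: block_face_def)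
    qed
    show "block_face b \<subseteq> orbit ?f (x, \<sigma> b x)"
    proof
      fix e assume "e \<in> block_face b"
      then obtain y where y: "y \<in> b" "e = (y, \<sigma> b y)" by (auto simp: block_face_def)
      have "y \<in> {x, \<sigma> b x, pre b x}" using y(1) unfolding block_cycle(8)[OF b, symmetric] .
      then consider "y = x" | "y = \<sigma> b x" | "y = pre b x" by blast
      then show "e \<in> orbit ?f (x, \<sigma> b x)" using 1 2 3 y(2) by cases simp_all
    qed
  qed
qed

text \<open>The map \<open>h\<close> carries \<open>\<pi> \<circ> turn\<close> on flags to face
  tracing: reversing the arc of \<open>u\<close> gives a \<open>\<sigma>\<close> arc at the point of
  \<open>turn u\<close>, from which the rotation passes to the block chosen by \<open>\<pi>\<close>.
  So the single orbit of flags becomes a single face.\<close>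

lemma orbit_outer_face:
  assumes "(x, b) \<in> flags"
  shows "orbit (face_succ (rotation \<pi>)) (x, pre b x) = outer_face"
proof -
  let ?f = "face_succ (rotation \<pi>)" and ?g = "\<pi> \<circ> turn"
  define h where "h u = (fst u, pre (snd u) (fst u))" for u
  have succ: "?f (h u) = h (?g u)" and g: "?g u \<in> flags" if u: "u \<in> flags" for u
  proof -
    obtain y c where yc: "u = (y, c)" "c \<in> \<B>" "y \<in> c" using u by (auto simp: flags_def)
    let ?z = "pre c y"
    have z: "(?z, c) \<in> flags" using block_cycle(2)[OF yc(2,3)] yc(2) by (simp add: flags_def)
    have t: "turn u = (?z, c)" using u yc(1) by (simp add: turn_def)
    show "?g u \<in> flags" using rotation_flags[OF z] t by simp
    have "?f (h u) = rotation \<pi> (?z, \<sigma> c ?z)"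
      using block_cycle(6)[OF yc(2,3)] yc(1) by (simp add: face_succ_def h_def)
    also have "\<dots> = (?z, pre (snd (\<pi> (?z, c))) ?z)" by (rule rotation_simps(1)[OF z])
    also have "\<dots> = h (?g u)" using fst_rotation[OF z] t by (simp add: h_def)
    finally show "?f (h u) = h (?g u)" .
  qed
  have outer: "outer_face = h ` flags" unfolding outer_face_def h_def by force
  have "orbit ?f (h (x, b)) \<subseteq> h ` flags"
    by (rule orbit_subset_closed) (use assms succ g in auto)
  moreover have "h w \<in> orbit ?f (h (x, b))" if "w \<in> orbit ?g (x, b)" for w
  proof -
    have "w \<in> flags \<and> h w \<in> orbit ?f (h (x, b))"
      using that
    proof induction
      case base
      show ?case using g[OF assms] succ[OF assms] orbit.base[of ?f "h (x, b)"] by simp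
    next
      case (step w)
      then have w: "w \<in> flags" "h w \<in> orbit ?f (h (x, b))" by blast+
      show ?case using g[OF w(1)] succ[OF w(1)] orbit.step[OF w(2)] by simp
    qed
    then show ?thesis by blast
  qed
  then have "h ` flags \<subseteq> orbit ?f (h (x, b))" using single assms by blast
  ultimately show ?thesis unfolding outer by (simp add: h_def)
qed

lemma flags_nonempty: "flags \<noteq> {}"
proof -
  have "V \<noteq> {}" using card_points v_ge by auto
  then obtain p where "p \<in> V" by blast
  then show ?thesis using three_blocks by blast
qed

lemma faces_eq: "faces K (rotation \<pi>) = insert outer_face (block_face ` \<B>)"
proof
  show "faces K (rotation \<pi>) \<subseteq> insert outer_face (block_face ` \<B>)"
    unfolding faces_def parcs_K using orbit_block_face orbit_outer_face by (auto simp: flags_def)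
  have "outer_face \<in> faces K (rotation \<pi>)"
  proof -
    obtain x b where xb: "(x, b) \<in> flags" using flags_nonempty by fast
    then have "(x, pre b x) \<in> parcs K" unfolding parcs_K by blast
    then show ?thesis unfolding faces_def using orbit_outer_face[OF xb] by blast
  qed
  moreover have "block_face b \<in> faces K (rotation \<pi>)" if b: "b \<in> \<B>" for b
  proof -
    have "b \<noteq> {}" using block_size[OF b] by auto
    then obtain x where xb: "(x, b) \<in> flags" using b by (auto simp: flags_def)
    then have "(x, \<sigma> b x) \<in> parcs K" unfolding parcs_K by blast
    then show ?thesis unfolding faces_def using orbit_block_face[OF xb] by blast
  qed
  ultimately show "insert outer_face (block_face ` \<B>) \<subseteq> faces K (rotation \<pi>)" by blast
qed

lemma fst_triangle: "bounded_by_triangle f b \<Longrightarrow> fst ` f = b"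
  by (auto simp: bounded_by_triangle_def)

text \<open>The outer face passes through all of at least seven points. Since
  \<open>block_faces\<close> recognizes faces by their shape alone, this is what keeps it from being
  counted as a block face.\<close>

lemma outer_face_not_triangle:
  assumes "b \<in> \<B>"
  shows "\<not> bounded_by_triangle outer_face b"
proof
  assume "bounded_by_triangle outer_face b"
  then have "fst ` outer_face = b" by (rule fst_triangle)
  moreover have "V \<subseteq> fst ` outer_face"
  proof
    fix p assume "p \<in> V"
    then obtain c where "(p, c) \<in> flags" using three_blocks by blast
    then show "p \<in> fst ` outer_face" by (force simp: outer_face_def)
  qed
  ultimately have "card V \<le> card b"
    using assms block_size[of b] by (intro card_mono) (auto intro: card_ge_0_finite)
  then show False using assms block_size[of b] card_points v_ge by simp
qed

lemma block_face_triangle: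
  assumes b: "b \<in> \<B>"
  shows "bounded_by_triangle (block_face b) b"
proof -
  have "b \<noteq> {}" using block_size[OF b] by auto
  then obtain x where x: "x \<in> b" by blast
  note c = block_cycle[OF b x]
  have "block_face b = {(y, \<sigma> b y) | y. y \<in> {x, \<sigma> b x, pre b x}}" unfolding block_face_def using c(8) by simp
  also have "\<dots> = {(x, \<sigma> b x), (\<sigma> b x, \<sigma> b (\<sigma> b x)), (pre b x, \<sigma> b (pre b x))}" by auto
  finally have "block_face b = {(x, \<sigma> b x), (\<sigma> b x, pre b x), (pre b x, x)}"
    using c(6) by (simp add: pre_def)
  moreover have "distinct [x, \<sigma> b x, pre b x]" using c(3-5) by auto
  ultimately show ?thesis unfolding bounded_by_triangle_def using c(8) by blast
qed

text \<open>A triangular face determines its block as the set of initial points of its arcs. This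
  excludes a second face bounded by the same block in the opposite direction.\<close>

lemma triangle_face:
  assumes "b \<in> \<B>" "f \<in> faces K (rotation \<pi>)" "bounded_by_triangle f b"
  shows "f = block_face b"
proof -
  have "f \<noteq> outer_face" using outer_face_not_triangle assms by blast
  then obtain c where c: "c \<in> \<B>" "f = block_face c" using assms(2) unfolding faces_eq by blast
  have "b = c" using fst_triangle[OF assms(3)] fst_triangle[OF block_face_triangle[OF c(1)]] c(2) by simp
  then show ?thesis using c(2) by simp
qed

lemma upper_embedding_rotation:
  "upper_embedding V \<B> (rotation \<pi>)" "induces_orientation V \<B> (rotation \<pi>) \<sigma>"
proof -
  have "block_faces V \<B> (rotation \<pi>) = block_face ` \<B>"
    unfolding block_faces_def using triangle_face block_face_triangle faces_eq by blast
  moreover have "outer_face \<notin> block_face ` \<B>"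
    using block_face_triangle outer_face_not_triangle by (metis imageE)
  ultimately have "outer_faces V \<B> (rotation \<pi>) = {outer_face}"
    unfolding outer_faces_def faces_eq by blast
  moreover have "configuration_embedding V \<B> (rotation \<pi>)"
    unfolding configuration_embedding_def using embedding block_face_triangle faces_eq by blast
  ultimately show "upper_embedding V \<B> (rotation \<pi>)" by (simp add: upper_embedding_def)
  show "induces_orientation V \<B> (rotation \<pi>) \<sigma>"
    unfolding induces_orientation_def using triangle_face by (auto simp: block_face_def)
qed

end

theorem upper_embeddable: "upper_embeddable_in_orientation V \<B> \<sigma>"
proof -
  obtain \<pi> where "partial_rotation V \<pi>" "\<forall>u\<in>flags. \<forall>w\<in>flags. u \<in> orbit (\<pi> \<circ> turn) w"
    using single_orbit_rotation by blast
  then show ?thesis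
    unfolding upper_embeddable_in_orientation_def using upper_embedding_rotation by blast
qed

end

theorem theorem3p2:
  fixes v :: nat and V :: "'a set" and \<B> :: "'a set set"
  assumes "odd v" and "7 \<le> v" and "v \<le> 19"
    and "symmetric_configuration v V \<B>"
    and "connected_configuration V \<B>"
  shows "upper_embeddable_in_every_orientation V \<B>"
  unfolding upper_embeddable_in_every_orientation_def
proof (intro allI impI)
  fix \<sigma> assume "triple_orientation \<B> \<sigma>"
  then interpret oriented_configuration v V \<B> \<sigma>
    using assms by (intro oriented_configuration.intro oriented_configuration_axioms.intro)
  show "upper_embeddable_in_orientation V \<B> \<sigma>" by (rule upper_embeddable)
qed

end
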